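(* Let $K$ be a field of characteristic zero and let $\Lambda=\bigoplus_{i\ge 0}\Lambda_i$ be a positively graded $K$-algebra such that: (i) $\Lambda$ is locally finite dimensional, i.e. each homogeneous component $\Lambda_i$ is finite dimensional; (ii) the homogeneous component $\Lambda_0$ of degree zero is given by a finite acyclic quiver with admissible relations (i.e. $\Lambda_0\cong KQ/I$ with $Q$ a finite acyclic quiver and $I$ an admissible ideal). Write the graded Euler characteristic of the reduced cyclic homology of $\Lambda$ as $\chi_{\overline{\mathrm{HC}}_*(\Lambda)}(x)=\sum_{k\ge 1}a_kx^k$. Then, as formal power series, $$\prod_{k=1}^\infty(1-x^k)^{-a_k}=\prod_{s=1}^\infty\det C_\Lambda(x^s),$$ where $C_\Lambda(x)$ is the graded Cartan matrix of $\Lambda$.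
   Context: Graded Cartan matrix: if $e_1,\dots,e_n\in\Lambda_0$ is a complete list of primitive orthogonal idempotents (here: the vertices of $Q$), then $C_\Lambda(x)=\sum_{k\ge0}C^{(k)}x^k$, where $C^{(k)}_{i,j}=\dim_K(e_i\Lambda_ke_j)$. Cyclic homology (characteristic zero): on $\Lambda^{\otimes i+1}$ let $t(a_0\otimes\cdots\otimes a_i)=(-1)^i a_i\otimes a_0\otimes\cdots\otimes a_{i-1}$. The Hochschild boundary $b$ induces a complex (the Connes complex) $\cdots\to\Lambda^{\otimes 3}/(1-t)\to\Lambda^{\otimes2}/(1-t)\to\Lambda$, with $\Lambda$ in homological degree $0$, and $\mathrm{HC}_i(\Lambda)$ is its $i$th homology; it inherits an internal grading from $\Lambda$. The inclusion $\Lambda_0\hookrightarrow\Lambda$ is a split monomorphism of algebras, so $\mathrm{HC}_i(\Lambda_0)$ is a subspace of $\mathrm{HC}_i(\Lambda)$, and reduced cyclic homology is $\overline{\mathrm{HC}}_i(\Lambda)=\mathrm{HC}_i(\Lambda)/\mathrm{HC}_i(\Lambda_0)$. Hilbert series: $h_V(x)=\sum_{i\ge0}\dim_K(V_i)x^i$ for a positively graded vector space $V$ with finite dimensional components. Graded Euler characteristic of a family $V^*=\{V^{(j)}\}_{j\in\mathbb Z}$ of graded vector spaces (with, in each internal degree, only finitely many $j$ having nonzero, finite dimensional component): $\chi_{V^*}(x)=\sum_j(-1)^jh_{V^{(j)}}(x)$; for $\overline{\mathrm{HC}}_*(\Lambda)$ the index $j$ is the homological degree. *)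

theory Defs
  imports
    "HOL-Algebra.QuotRing"
    "HOL-Algebra.Ideal_Product"
    "HOL-Analysis.Infinite_Products"
    "HOL-Computational_Algebra.Formal_Power_Series"
    "HOL-Library.Poly_Mapping"
    "Graph_Theory.Arc_Walk"
    "Jordan_Normal_Form.Determinant"
begin

section \<open>Dimension of a quotient space\<close>

text \<open>
  The image of a subspace \<open>V\<close> in the quotient by a subspace \<open>D\<close> is \<open>(V + D)/D\<close>; it is not
  required that \<open>D \<subseteq> V\<close>. A set \<open>S \<subseteq> V\<close> is a quotient basis if the cosets of its elements are
  pairwise distinct and form a basis of that image. As for \<open>dim\<close>, infinite dimension is mapped
  to \<open>0\<close>.
\<close>

definition (in vector_space) quotient_basis :: "'b set \<Rightarrow> 'b set \<Rightarrow> 'b set \<Rightarrow> bool" where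
  "quotient_basis V D S \<longleftrightarrow>
     S \<subseteq> V \<and> V \<subseteq> span (S \<union> D) \<and>
     (\<forall>T u. finite T \<longrightarrow> T \<subseteq> S \<longrightarrow> (\<Sum>v\<in>T. scale (u v) v) \<in> D \<longrightarrow> (\<forall>v\<in>T. u v = 0))"

definition (in vector_space) quotient_fin_dim :: "'b set \<Rightarrow> 'b set \<Rightarrow> bool" where
  "quotient_fin_dim V D \<longleftrightarrow> (\<exists>S. finite S \<and> quotient_basis V D S)"

definition (in vector_space) quotient_dim :: "'b set \<Rightarrow> 'b set \<Rightarrow> nat" where
  "quotient_dim V D = card (SOME S. quotient_basis V D S)"


section \<open>Free vector spaces\<close>

definition free_scale :: "'k::field \<Rightarrow> ('b \<Rightarrow>\<^sub>0 'k) \<Rightarrow> ('b \<Rightarrow>\<^sub>0 'k)" where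
  "free_scale c f = Poly_Mapping.map ((*) c) f"

lemma lookup_free_scale [simp]:
  "Poly_Mapping.lookup (free_scale c f) x = c * Poly_Mapping.lookup f x"
  by (simp add: free_scale_def Poly_Mapping.map.rep_eq when_def)

interpretation free: vector_space free_scale
  by unfold_locales
    (auto intro!: poly_mapping_eqI simp: lookup_add algebra_simps)

text \<open>The linear extension of a map given on the basis.\<close>

definition free_extend :: "('b \<Rightarrow> ('c \<Rightarrow>\<^sub>0 'k)) \<Rightarrow> ('b \<Rightarrow>\<^sub>0 'k::field) \<Rightarrow> ('c \<Rightarrow>\<^sub>0 'k)" where
  "free_extend g f = (\<Sum>x\<in>Poly_Mapping.keys f. free_scale (Poly_Mapping.lookup f x) (g x))"

lemma free_extend_superset:
  assumes "finite S" "Poly_Mapping.keys f \<subseteq> S"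
  shows "free_extend g f = (\<Sum>x\<in>S. free_scale (Poly_Mapping.lookup f x) (g x))"
  unfolding free_extend_def
  by (rule sum.mono_neutral_left) (use assms in \<open>auto simp: not_in_keys_iff_lookup_eq_zero\<close>)

lemma free_extend_zero [simp]: "free_extend g 0 = 0"
  by (simp add: free_extend_def)

lemma free_extend_single [simp]:
  "free_extend g (Poly_Mapping.single x c) = free_scale c (g x)"
  by (subst free_extend_superset[of "{x}"]) auto

lemma free_extend_add: "free_extend g (f1 + f2) = free_extend g f1 + free_extend g f2"
proof -
  let ?S = "Poly_Mapping.keys f1 \<union> Poly_Mapping.keys f2"
  have "Poly_Mapping.keys (f1 + f2) \<subseteq> ?S"
    by (rule Poly_Mapping.keys_add)
  then show ?thesis
    by (simp add: free_extend_superset[of ?S] lookup_add free.scale_left_distrib sum.distrib)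
qed

lemma free_extend_free_scale: "free_extend g (free_scale c f) = free_scale c (free_extend g f)"
proof -
  have "Poly_Mapping.keys (free_scale c f) \<subseteq> Poly_Mapping.keys f"
    by (auto simp: in_keys_iff)
  then show ?thesis
    by (simp add: free_extend_superset[of "Poly_Mapping.keys f"] free.scale_sum_right)
qed

lemma free_additive_eq:
  fixes F H :: "('b \<Rightarrow>\<^sub>0 'k::field) \<Rightarrow> ('c \<Rightarrow>\<^sub>0 'k)"
  assumes "\<And>f g. F (f + g) = F f + F g" "\<And>f g. H (f + g) = H f + H g"
    and "\<And>x c. x \<in> Poly_Mapping.keys f \<Longrightarrow> F (Poly_Mapping.single x c) = H (Poly_Mapping.single x c)"
  shows "F f = H f"
proof -
  have zero: "F 0 = 0" "H 0 = 0"
    using assms(1)[of 0 0] assms(2)[of 0 0] by simp_all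
  have *: "F (\<Sum>x\<in>S. Poly_Mapping.single x (u x)) = H (\<Sum>x\<in>S. Poly_Mapping.single x (u x))"
    if "finite S" "S \<subseteq> Poly_Mapping.keys f" for S u
    using that by (induction S) (auto simp: zero assms)
  have "f = (\<Sum>x\<in>Poly_Mapping.keys f. Poly_Mapping.single x (Poly_Mapping.lookup f x))"
    by (rule poly_mapping_eqI)
      (auto simp: lookup_sum lookup_single when_def not_in_keys_iff_lookup_eq_zero sum.delta)
  then show ?thesis
    using *[of "Poly_Mapping.keys f" "Poly_Mapping.lookup f"] by simp
qed

lemma free_extend_fun_add: "free_extend (\<lambda>x. g x + g' x) f = free_extend g f + free_extend g' f"
  by (simp add: free_extend_def free.scale_right_distrib sum.distrib)

lemma free_extend_fun_scale: "free_extend (\<lambda>x. free_scale c (g x)) f = free_scale c (free_extend g f)"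
  by (simp add: free_extend_def free.scale_sum_right mult.commute)

lemma free_extend_fun_zero [simp]: "free_extend (\<lambda>x. 0) f = 0"
  by (simp add: free_extend_def)

lemma keys_free_extend:
  assumes "\<And>x. x \<in> Poly_Mapping.keys f \<Longrightarrow> Poly_Mapping.keys (g x) \<subseteq> A"
  shows "Poly_Mapping.keys (free_extend g f) \<subseteq> A"
proof -
  have "Poly_Mapping.lookup (free_extend g f) y = 0" if "y \<notin> A" for y
    using assms that
    by (fastforce simp: free_extend_def lookup_sum in_keys_iff subset_iff intro!: sum.neutral)
  then show ?thesis by (auto simp: in_keys_iff)
qed


section \<open>Graded algebras\<close>

text \<open>
  The sort is that of a unital associative ring without \<open>0 \<noteq> 1\<close>, so the zero algebra (with
  the empty quiver) is included.
\<close>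

locale graded_algebra = vector_space scl
  for scl :: "'k::field \<Rightarrow> 'a::{ring, monoid_mult} \<Rightarrow> 'a" +
  fixes G :: "nat \<Rightarrow> 'a set"
  assumes scale_mult_left: "scl c x * y = scl c (x * y)"
    and scale_mult_right: "x * scl c y = scl c (x * y)"
    and subspace_component: "subspace (G i)"
    and direct_sum:
      "\<exists>!c. finite {i. c i \<noteq> 0} \<and> (\<forall>i. c i \<in> G i) \<and> x = (\<Sum>i | c i \<noteq> 0. c i)"
    and one_component: "1 \<in> G 0"
    and mult_component: "x \<in> G i \<Longrightarrow> y \<in> G j \<Longrightarrow> x * y \<in> G (i + j)"

definition (in graded_algebra) locally_finite_dimensional :: bool where
  "locally_finite_dimensional \<longleftrightarrow> (\<forall>i. \<exists>B. finite B \<and> span B = G i)"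


section \<open>Path algebras and admissible ideals\<close>

text \<open>
  A quiver is a directed multigraph (loops allowed). A path is a pair of its starting vertex and
  its list of arrows; the trivial path at \<open>v\<close> is \<open>(v, [])\<close>. The product of paths \<open>x y\<close> means
  first \<open>x\<close>, then \<open>y\<close>.
\<close>

definition quiver_paths :: "('v, 'e) pre_digraph \<Rightarrow> ('v \<times> 'e list) set" where
  "quiver_paths Q = {(u, p). \<exists>v. pre_digraph.awalk Q u p v}"

definition path_end :: "('v, 'e) pre_digraph \<Rightarrow> 'v \<times> 'e list \<Rightarrow> 'v" where
  "path_end Q x = (if snd x = [] then fst x else head Q (last (snd x)))"

definition path_mult ::
  "('v, 'e) pre_digraph \<Rightarrow> 'v \<times> 'e list \<Rightarrow> 'v \<times> 'e list \<Rightarrow> (('v \<times> 'e list) \<Rightarrow>\<^sub>0 'k::field)" where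
  "path_mult Q x y =
     (if path_end Q x = fst y then Poly_Mapping.single (fst x, snd x @ snd y) 1 else 0)"

definition path_algebra_mult ::
  "('v, 'e) pre_digraph \<Rightarrow> (('v \<times> 'e list) \<Rightarrow>\<^sub>0 'k::field) \<Rightarrow>
   (('v \<times> 'e list) \<Rightarrow>\<^sub>0 'k) \<Rightarrow> (('v \<times> 'e list) \<Rightarrow>\<^sub>0 'k)" where
  "path_algebra_mult Q f g = free_extend (\<lambda>x. free_extend (path_mult Q x) g) f"

definition path_algebra ::
  "('v, 'e) pre_digraph \<Rightarrow> (('v \<times> 'e list) \<Rightarrow>\<^sub>0 'k::field) ring" where
  "path_algebra Q =
     \<lparr>carrier = {f. Poly_Mapping.keys f \<subseteq> quiver_paths Q},
      monoid.mult = path_algebra_mult Q,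
      one = (\<Sum>v\<in>verts Q. Poly_Mapping.single (v, []) 1),
      zero = 0,
      add = (+)\<rparr>"

lemma path_algebra_mult_add: "path_algebra_mult Q (f + f') g = path_algebra_mult Q f g + path_algebra_mult Q f' g" "path_algebra_mult Q f (g + g') = path_algebra_mult Q f g + path_algebra_mult Q f g'"
  by (simp_all add: path_algebra_mult_def free_extend_add free_extend_fun_add)

lemma path_algebra_mult_scale: "path_algebra_mult Q (free_scale c f) g = free_scale c (path_algebra_mult Q f g)"
   "path_algebra_mult Q f (free_scale c g) = free_scale c (path_algebra_mult Q f g)"
  by (simp_all add: path_algebra_mult_def free_extend_free_scale free_extend_fun_scale)

lemma single_eq_free_scale: "Poly_Mapping.single x c = free_scale c (Poly_Mapping.single x 1)"
  by (rule poly_mapping_eqI) (simp add: lookup_single when_def)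

lemma path_algebra_mult_single: "path_algebra_mult Q (Poly_Mapping.single x 1) (Poly_Mapping.single y 1) = path_mult Q x y"
  by (simp add: path_algebra_mult_def)

lemma path_algebra_mult_zero: "path_algebra_mult Q 0 g = 0" "path_algebra_mult Q f 0 = 0"
  by (simp_all add: path_algebra_mult_def)

lemma quiver_paths_path_mult:
  assumes "wf_digraph Q" "x \<in> quiver_paths Q" "y \<in> quiver_paths Q" "path_end Q x = fst y"
  shows "(fst x, snd x @ snd y) \<in> quiver_paths Q" 
proof -
  interpret wf_digraph Q by fact
  obtain v w where v: "awalk (fst x) (snd x) v" and w: "awalk (fst y) (snd y) w"
    using assms(2,3) by (auto simp: quiver_paths_def)
  have "awlast (fst x) (snd x) = v" using v by auto
  moreover have "awlast u p = path_end Q (u, p)" if "awalk u p v'" for u p v'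
    using that by (induction p arbitrary: u) (auto simp: path_end_def awalk_Cons_iff)
  ultimately have "v = fst y" using assms(4) v by (metis prod.collapse)
  then show ?thesis using awalk_appendI v w by (auto simp: quiver_paths_def)
qed

lemma ring_path_algebra:
  assumes "fin_digraph Q"
  shows "ring (path_algebra Q :: (('v \<times> 'e list) \<Rightarrow>\<^sub>0 'k::field) ring)"
proof -
  interpret fin_digraph Q by fact
  let ?P = "quiver_paths Q" 
  let ?A = "{f::('v \<times> 'e list) \<Rightarrow>\<^sub>0 'k. Poly_Mapping.keys f \<subseteq> ?P}"
  let ?one = "(\<Sum>v\<in>verts Q. Poly_Mapping.single (v, []) 1) :: ('v \<times> 'e list) \<Rightarrow>\<^sub>0 'k"
  have mult: "monoid.mult (path_algebra Q) = path_algebra_mult Q" by (auto simp: path_algebra_def)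
  have rest: "carrier (path_algebra Q) = ?A" "ring.add (path_algebra Q) = (+)" "ring.zero (path_algebra Q) = 0"
    "monoid.one (path_algebra Q) = ?one" by (auto simp: path_algebra_def)
  have lone: "path_algebra_mult Q ?one f = f" if "f \<in> ?A" for f
  proof (rule free_additive_eq[where H = "\<lambda>x. x"])
    fix x c assume "x \<in> Poly_Mapping.keys f"
    then have x: "fst x \<in> verts Q" using that by (auto simp: quiver_paths_def awalk_def)
    have s: "path_algebra_mult Q (sum g S) f' = (\<Sum>v\<in>S. path_algebra_mult Q (g v) f')" if "finite S" for g S f'
      using that by (induction S) (auto simp: path_algebra_mult_zero path_algebra_mult_add)
    have "path_algebra_mult Q ?one (Poly_Mapping.single x 1) = (\<Sum>v\<in>verts Q. path_mult Q (v, []) x)"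
      by (simp add: s path_algebra_mult_single)
    also have "\<dots> = (\<Sum>v\<in>{fst x}. path_mult Q (v, []) x)"
      by (rule sum.mono_neutral_right) (use x in \<open>auto simp: path_mult_def path_end_def\<close>)
    also have "\<dots> = Poly_Mapping.single x 1" by (simp add: path_mult_def path_end_def)
    finally show "path_algebra_mult Q ?one (Poly_Mapping.single x c) = Poly_Mapping.single x c"
      by (metis single_eq_free_scale path_algebra_mult_scale(2))
  qed (auto simp: path_algebra_mult_add)
  have rone: "path_algebra_mult Q f ?one = f" if "f \<in> ?A" for f
  proof (rule free_additive_eq[where H = "\<lambda>x. x"])
    fix x c assume "x \<in> Poly_Mapping.keys f"
    then have "x \<in> ?P" using that by auto
    then have "fst x \<in> verts Q" "set (snd x) \<subseteq> arcs Q"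
      by (cases x; auto simp: quiver_paths_def awalk_def)+
    then have x: "path_end Q x \<in> verts Q"
      by (auto simp: path_end_def intro!: head_in_verts)
    have s: "path_algebra_mult Q f' (sum g S) = (\<Sum>v\<in>S. path_algebra_mult Q f' (g v))" if "finite S" for g S f'
      using that by (induction S) (auto simp: path_algebra_mult_zero path_algebra_mult_add)
    have "path_algebra_mult Q (Poly_Mapping.single x 1) ?one = (\<Sum>v\<in>verts Q. path_mult Q x (v, []))"
      by (simp add: s path_algebra_mult_single)
    also have "\<dots> = (\<Sum>v\<in>{path_end Q x}. path_mult Q x (v, []))"
      by (rule sum.mono_neutral_right) (use x in \<open>auto simp: path_mult_def\<close>)
    also have "\<dots> = Poly_Mapping.single x 1" by (simp add: path_mult_def)
    finally show "path_algebra_mult Q (Poly_Mapping.single x c) ?one = Poly_Mapping.single x c"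
      by (metis single_eq_free_scale path_algebra_mult_scale(1))
  qed (auto simp: path_algebra_mult_add)
  have closed: "path_algebra_mult Q f g \<in> ?A" if "f \<in> ?A" "g \<in> ?A" for f g
    unfolding path_algebra_mult_def mem_Collect_eq
    by (intro keys_free_extend) 
      (use that quiver_paths_path_mult[OF wf_digraph] in \<open>fastforce simp: path_mult_def split: if_splits\<close>)
  have assoc: "path_algebra_mult Q (path_algebra_mult Q f g) k = path_algebra_mult Q f (path_algebra_mult Q g k)" if "f \<in> ?A" "g \<in> ?A" "k \<in> ?A" for f g k
  proof -
    have 1: "path_algebra_mult Q (path_mult Q x y) (Poly_Mapping.single z 1) = path_algebra_mult Q (Poly_Mapping.single x 1) (path_mult Q y z)"
      for x y z :: "'v \<times> 'e list"
      by (auto simp: path_mult_def path_algebra_mult_zero path_algebra_mult_def path_end_def)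
    show ?thesis
      apply (rule free_additive_eq[of "\<lambda>f. path_algebra_mult Q (path_algebra_mult Q f g) k" "\<lambda>f. path_algebra_mult Q f (path_algebra_mult Q g k)"]; (simp add: path_algebra_mult_add)?)
      subgoal for x c
        apply (rule free_additive_eq[of "\<lambda>g. path_algebra_mult Q (path_algebra_mult Q _ g) k" "\<lambda>g. path_algebra_mult Q _ (path_algebra_mult Q g k)"]; (simp add: path_algebra_mult_add)?)
        subgoal for y d
          apply (rule free_additive_eq[of "\<lambda>k. path_algebra_mult Q (path_algebra_mult Q _ _) k" "\<lambda>k. path_algebra_mult Q _ (path_algebra_mult Q _ k)"]; (simp add: path_algebra_mult_add)?)
          subgoal for z e
            by (subst (1 2 3 4 5 6) single_eq_free_scale) (simp only: path_algebra_mult_scale path_algebra_mult_single 1)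
          done
        done
      done
  qed
  show ?thesis
  proof (rule ringI)
    show "abelian_group (path_algebra Q :: (('v \<times> 'e list) \<Rightarrow>\<^sub>0 'k) ring)"
    proof (rule abelian_groupI; simp add: rest)
      fix x y :: "('v \<times> 'e list) \<Rightarrow>\<^sub>0 'k" assume "Poly_Mapping.keys x \<subseteq> ?P" "Poly_Mapping.keys y \<subseteq> ?P"
      then show "Poly_Mapping.keys (x + y) \<subseteq> ?P" using Poly_Mapping.keys_add[of x y] by blast
    next
      fix x :: "('v \<times> 'e list) \<Rightarrow>\<^sub>0 'k" assume "Poly_Mapping.keys x \<subseteq> ?P"
      then show "\<exists>y. Poly_Mapping.keys y \<subseteq> ?P \<and> y + x = 0"
        by (intro exI[of _ "- x"]) (auto simp: in_keys_iff)
    qed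
    have "?one \<in> ?A"
    proof -
      have "(v, []) \<in> ?P" if "v \<in> verts Q" for v
        using that by (auto simp: quiver_paths_def awalk_def intro!: exI[of _ v])
      then have "Poly_Mapping.lookup ?one x = 0" if "x \<notin> ?P" for x
        using that by (fastforce simp: lookup_sum lookup_single when_def intro!: sum.neutral)
      then show ?thesis by (auto simp: in_keys_iff)
    qed
    then show "Group.monoid (path_algebra Q :: (('v \<times> 'e list) \<Rightarrow>\<^sub>0 'k) ring)"
      by (auto simp: rest mult intro!: monoidI simp del: mem_Collect_eq
          simp: closed assoc lone rone)
  qed (simp_all add: rest mult path_algebra_mult_add)
qed

definition arrow_ideal ::
  "('v, 'e) pre_digraph \<Rightarrow> (('v \<times> 'e list) \<Rightarrow>\<^sub>0 'k::field) set" where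
  "arrow_ideal Q =
     genideal (path_algebra Q) ((\<lambda>e. Poly_Mapping.single (tail Q e, [e]) 1) ` arcs Q)"

primrec ideal_power :: "('a, 'b) ring_scheme \<Rightarrow> 'a set \<Rightarrow> nat \<Rightarrow> 'a set" where
  "ideal_power R J 0 = carrier R"
| "ideal_power R J (Suc n) = ideal_prod R J (ideal_power R J n)"

definition admissible_ideal ::
  "('v, 'e) pre_digraph \<Rightarrow> (('v \<times> 'e list) \<Rightarrow>\<^sub>0 'k::field) set \<Rightarrow> bool" where
  "admissible_ideal Q I \<longleftrightarrow>
     ideal I (path_algebra Q) \<and>
     (\<exists>m\<ge>2. ideal_power (path_algebra Q) (arrow_ideal Q) m \<subseteq> I) \<and>
     I \<subseteq> ideal_power (path_algebra Q) (arrow_ideal Q) 2"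

definition finite_acyclic_quiver :: "('v, 'e) pre_digraph \<Rightarrow> bool" where
  "finite_acyclic_quiver Q \<longleftrightarrow> fin_digraph Q \<and> \<not> (\<exists>p. pre_digraph.cycle Q p)"

text \<open>A multiplicatively closed subspace containing \<open>1\<close>, as a ring in its own right.\<close>

definition subring_of :: "'a::{ring, monoid_mult} set \<Rightarrow> 'a ring" where
  "subring_of A = \<lparr>carrier = A, monoid.mult = (*), one = 1, zero = 0, add = (+)\<rparr>"

text \<open>\<open>h\<close> is an isomorphism of algebras from \<open>KQ/I\<close> onto \<open>A\<close>.\<close>

definition path_algebra_quotient_iso ::
  "('k::field \<Rightarrow> 'a::{ring, monoid_mult} \<Rightarrow> 'a) \<Rightarrow> ('v, 'e) pre_digraph \<Rightarrow>
   (('v \<times> 'e list) \<Rightarrow>\<^sub>0 'k) set \<Rightarrow> 'a set \<Rightarrow> ((('v \<times> 'e list) \<Rightarrow>\<^sub>0 'k) set \<Rightarrow> 'a) \<Rightarrow> bool" where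
  "path_algebra_quotient_iso scl Q I A h \<longleftrightarrow>
     h \<in> ring_iso (path_algebra Q Quot I) (subring_of A) \<and>
     (\<forall>c. \<forall>f\<in>carrier (path_algebra Q).
        h (I +>\<^bsub>path_algebra Q\<^esub> free_scale c f) = scl c (h (I +>\<^bsub>path_algebra Q\<^esub> f)))"

definition vertex_idempotent ::
  "('v, 'e) pre_digraph \<Rightarrow> (('v \<times> 'e list) \<Rightarrow>\<^sub>0 'k::field) set \<Rightarrow>
   ((('v \<times> 'e list) \<Rightarrow>\<^sub>0 'k) set \<Rightarrow> 'a) \<Rightarrow> 'v \<Rightarrow> 'a" where
  "vertex_idempotent Q I h v = h (I +>\<^bsub>path_algebra Q\<^esub> Poly_Mapping.single (v, []) 1)"


section \<open>The graded Cartan matrix\<close>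

definition cartan_matrix ::
  "('k::field \<Rightarrow> 'a::{ring, monoid_mult} \<Rightarrow> 'a) \<Rightarrow> (nat \<Rightarrow> 'a set) \<Rightarrow> 'a list \<Rightarrow> rat fps mat" where
  "cartan_matrix scl G es =
     mat (length es) (length es)
       (\<lambda>(i, j). Abs_fps (\<lambda>k. of_nat (vector_space.dim scl {es ! i * x * es ! j | x. x \<in> G k})))"

text \<open>The matrix \<open>C(x^s)\<close>, for \<open>s > 0\<close>.\<close>

definition subst_power :: "rat fps mat \<Rightarrow> nat \<Rightarrow> rat fps mat" where
  "subst_power C s = map_mat (\<lambda>f. fps_compose f (fps_X ^ s)) C"


section \<open>The Connes complex and reduced cyclic homology\<close>

text \<open>
  The \<open>n\<close>-th tensor power of a subalgebra \<open>A\<close> over the ground field is the quotient of the free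
  vector space on lists of length \<open>n\<close> with entries in \<open>A\<close> by the multilinearity relations; the
  list \<open>[a\<^sub>0, \<dots>, a\<^sub>i]\<close> stands for the pure tensor of its entries. All constructions below are
  carried out by representatives in the free space on lists over the whole algebra.
\<close>

definition tensor_free :: "'a set \<Rightarrow> nat \<Rightarrow> ('a list \<Rightarrow>\<^sub>0 'k::field) set" where
  "tensor_free A n = {f. \<forall>xs\<in>Poly_Mapping.keys f. length xs = n \<and> set xs \<subseteq> A}"

definition pure_tensor :: "'a list \<Rightarrow> ('a list \<Rightarrow>\<^sub>0 'k::field)" where
  "pure_tensor xs = Poly_Mapping.single xs 1"

definition multilinear_relations ::
  "('k::field \<Rightarrow> 'a::{ring, monoid_mult} \<Rightarrow> 'a) \<Rightarrow> 'a set \<Rightarrow> nat \<Rightarrow> ('a list \<Rightarrow>\<^sub>0 'k) set" where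
  "multilinear_relations scl A n =
     {pure_tensor (xs @ [scl c a + b] @ ys)
        - free_scale c (pure_tensor (xs @ [a] @ ys)) - pure_tensor (xs @ [b] @ ys)
      | xs ys a b c. length xs + 1 + length ys = n \<and> set xs \<union> set ys \<union> {a, b} \<subseteq> A}"

definition cyclic_t :: "('a list \<Rightarrow>\<^sub>0 'k::field) \<Rightarrow> ('a list \<Rightarrow>\<^sub>0 'k)" where
  "cyclic_t = free_extend (\<lambda>xs. Poly_Mapping.single (last xs # butlast xs) ((-1) ^ (length xs - 1)))"

text \<open>
  On \<open>[a\<^sub>0, \<dots>, a\<^sub>i]\<close> with \<open>i > 0\<close> this is the Hochschild boundary, the last term being
  \<open>(-1)\<^sup>i [a\<^sub>i a\<^sub>0, a\<^sub>1, \<dots>]\<close>. It vanishes on lists of length \<open>1\<close>, as the complex ends in degree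
  \<open>0\<close>.
\<close>

definition hochschild_b :: "('a::{ring, monoid_mult} list \<Rightarrow>\<^sub>0 'k::field) \<Rightarrow> ('a list \<Rightarrow>\<^sub>0 'k)" where
  "hochschild_b = free_extend (\<lambda>xs.
     if length xs \<le> 1 then 0
     else (\<Sum>j<length xs - 1.
             Poly_Mapping.single (take j xs @ [xs ! j * xs ! (j + 1)] @ drop (j + 2) xs) ((-1) ^ j))
          + Poly_Mapping.single ((last xs * hd xs) # butlast (tl xs)) ((-1) ^ (length xs - 1)))"

text \<open>
  The \<open>i\<close>-th term of the Connes complex is \<open>tensor_free A (i + 1)\<close> modulo
  \<open>connes_relations scl A (i + 1)\<close>. Cycles and boundaries are the preimages in
  \<open>tensor_free A (i + 1)\<close> of those of the Connes complex, so both contain the relations.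
\<close>

definition connes_relations ::
  "('k::field \<Rightarrow> 'a::{ring, monoid_mult} \<Rightarrow> 'a) \<Rightarrow> 'a set \<Rightarrow> nat \<Rightarrow> ('a list \<Rightarrow>\<^sub>0 'k) set" where
  "connes_relations scl A n =
     free.span (multilinear_relations scl A n \<union> (\<lambda>z. z - cyclic_t z) ` tensor_free A n)"

definition connes_cycles ::
  "('k::field \<Rightarrow> 'a::{ring, monoid_mult} \<Rightarrow> 'a) \<Rightarrow> 'a set \<Rightarrow> nat \<Rightarrow> ('a list \<Rightarrow>\<^sub>0 'k) set" where
  "connes_cycles scl A i =
     {z \<in> tensor_free A (i + 1). hochschild_b z \<in> connes_relations scl A i}"

definition connes_boundaries ::
  "('k::field \<Rightarrow> 'a::{ring, monoid_mult} \<Rightarrow> 'a) \<Rightarrow> 'a set \<Rightarrow> nat \<Rightarrow> ('a list \<Rightarrow>\<^sub>0 'k) set" where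
  "connes_boundaries scl A i =
     free.span (hochschild_b ` tensor_free A (i + 2) \<union> connes_relations scl A (i + 1))"

text \<open>
  The pure tensors of homogeneous elements of total degree \<open>k\<close>, and the cycles whose class in
  the Connes complex is homogeneous of internal degree \<open>k\<close>.
\<close>

definition homogeneous_tensors ::
  "(nat \<Rightarrow> 'a set) \<Rightarrow> nat \<Rightarrow> nat \<Rightarrow> ('a list \<Rightarrow>\<^sub>0 'k::field) set" where
  "homogeneous_tensors G n k =
     {pure_tensor xs | xs. length xs = n \<and> (\<exists>ds. list_all2 (\<lambda>x d. x \<in> G d) xs ds \<and> sum_list ds = k)}"

definition homogeneous_cycles ::
  "('k::field \<Rightarrow> 'a::{ring, monoid_mult} \<Rightarrow> 'a) \<Rightarrow> (nat \<Rightarrow> 'a set) \<Rightarrow> nat \<Rightarrow> nat \<Rightarrow>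
   ('a list \<Rightarrow>\<^sub>0 'k) set" where
  "homogeneous_cycles scl G i k =
     connes_cycles scl UNIV i \<inter>
     free.span (homogeneous_tensors G (i + 1) k \<union> connes_relations scl UNIV (i + 1))"

text \<open>
  With \<open>Z\<close>, \<open>B\<close> the cycles and boundaries of the whole algebra and \<open>Z\<^sub>0\<close> the cycles of the
  degree zero part, \<open>HC\<^sub>i = Z/B\<close> has the subspace \<open>(Z\<^sub>0 + B)/B\<close>, the image of the cyclic
  homology of the degree zero part, and the quotient by it is \<open>Z/(Z\<^sub>0 + B)\<close>. Its component of
  internal degree \<open>k\<close> is the image of the homogeneous cycles of degree \<open>k\<close>.
\<close>

definition reduced_denominator ::
  "('k::field \<Rightarrow> 'a::{ring, monoid_mult} \<Rightarrow> 'a) \<Rightarrow> (nat \<Rightarrow> 'a set) \<Rightarrow> nat \<Rightarrow> ('a list \<Rightarrow>\<^sub>0 'k) set" where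
  "reduced_denominator scl G i =
     free.span (connes_boundaries scl UNIV i \<union> connes_cycles scl (G 0) i)"

definition reduced_HC_fin_dim ::
  "('k::field \<Rightarrow> 'a::{ring, monoid_mult} \<Rightarrow> 'a) \<Rightarrow> (nat \<Rightarrow> 'a set) \<Rightarrow> nat \<Rightarrow> nat \<Rightarrow> bool" where
  "reduced_HC_fin_dim scl G i k \<longleftrightarrow>
     free.quotient_fin_dim (homogeneous_cycles scl G i k) (reduced_denominator scl G i)"

definition reduced_HC_dim ::
  "('k::field \<Rightarrow> 'a::{ring, monoid_mult} \<Rightarrow> 'a) \<Rightarrow> (nat \<Rightarrow> 'a set) \<Rightarrow> nat \<Rightarrow> nat \<Rightarrow> nat" where
  "reduced_HC_dim scl G i k =
     free.quotient_dim (homogeneous_cycles scl G i k) (reduced_denominator scl G i)"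

text \<open>
  The graded Euler characteristic of a family with dimensions \<open>d j k\<close> in position \<open>j\<close> and
  internal degree \<open>k\<close>, coefficientwise; meaningful if every \<open>{j. d j k \<noteq> 0}\<close> is finite.
\<close>

definition graded_euler_char :: "(nat \<Rightarrow> nat \<Rightarrow> nat) \<Rightarrow> int fps" where
  "graded_euler_char d = Abs_fps (\<lambda>k. \<Sum>j | d j k \<noteq> 0. (-1) ^ j * int (d j k))"

end

theory Submission
  imports
    Defs
    "HOL-Number_Theory.Totient"
    "HOL-Number_Theory.Cong"
    "HOL-Computational_Algebra.Formal_Laurent_Series"
begin

text \<open>
  Write \<open>\<Lambda> = S \<oplus> J\<close>, where \<open>S\<close> is spanned by the vertex idempotents and
  \<open>J = rad \<Lambda>\<^sub>0 \<oplus> \<Lambda>\<^sub>1 \<oplus> \<Lambda>\<^sub>2 \<oplus> \<dots>\<close> is a two-sided ideal.  A homogeneous basis \<open>B\<close> of \<open>J\<close>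
  adapted to the decomposition into corners \<open>e\<^sub>i J e\<^sub>j\<close> behaves like the set of arrows of a graded
  quiver: the Cartan matrix is \<open>C = 1 + N\<close>, where \<open>N\<^sub>i\<^sub>j\<close> counts the arrows from \<open>i\<close> to \<open>j\<close> by
  degree, and the trace of \<open>N\<^sup>d\<close> counts the closed paths made of \<open>d\<close> arrows.  The theorem says
  that only these numbers matter for the Euler characteristic.

  Cyclic homology is reduced to closed paths as follows.  Chains are tested against multilinear
  cyclic cochains, and these detect exactly the relations defining the Connes complex
  (\<open>mem_connes_relations_iff\<close>); the Hochschild boundary becomes a coboundary \<open>\<beta>\<close> that multiplies
  two cyclically adjacent letters.  Inserting an idempotent behind every letter of \<open>J\<close> gives an
  operator \<open>\<eta>\<close> for which \<open>\<beta>\<eta> + \<eta>\<beta>\<close> is diagonal on words of basis elements (\<open>homotopy\<close>,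
  \<open>defect_word\<close>): its eigenvalue on a word is the number of arrows whose cyclic successor is not an
  arrow composable with it.  In characteristic zero the words with nonzero eigenvalue therefore
  contribute nothing to homology.  In degree \<open>k \<ge> 1\<close> the other words are the closed paths, and there
  are finitely many of them, because the quiver of \<open>\<Lambda>\<^sub>0\<close> is acyclic, so that arrows of degree zero
  cannot be concatenated indefinitely (\<open>closed_path_length_le\<close>).  Hence the degree \<open>k\<close> part of
  reduced cyclic homology is the homology of a finite complex whose terms are the spaces of cyclic
  closed paths (\<open>reduced_HC_dim_eq\<close>); in degree \<open>0\<close> every class comes from \<open>\<Lambda>\<^sub>0\<close>.

  Consequently \<open>a\<^sub>k\<close> is the alternating sum of the dimensions of these spaces
  (\<open>euler_char_coeff\<close>).  Such a dimension is the trace of the averaging projection over rotations,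
  so it is a signed count of closed paths fixed by a rotation (\<open>closed_dim_eq\<close>), and a word fixed by
  a rotation is a power of a shorter word.  Collecting powers gives
  \<open>k a\<^sub>k = \<Sum>\<^bsub>d | k\<^esub> d \<phi>(k/d) L\<^sub>d\<close>, where
  \<open>L\<^sub>d = \<Sum>\<^bsub>l\<^esub> (-1)\<^bsup>l-1\<^esup>/l [x\<^sup>d] tr N\<^sup>l\<close> (\<open>euler_char_log_coeff\<close>).

  On the other side \<open>L\<^sub>d\<close> is the coefficient of \<open>x\<^sup>d\<close> in
  \<open>log det (1 + N) = \<Sum>\<^bsub>l\<^esub> (-1)\<^bsup>l-1\<^esup>/l tr N\<^sup>l\<close>, which is derived from Jacobi's formula for the
  derivative of a determinant (\<open>is_log_deriv_det\<close>).  The operator \<open>f \<mapsto> x f'/f\<close> turns the two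
  infinite products into power series whose coefficients at \<open>x\<^sup>m\<close> are \<open>\<Sum>\<^bsub>k | m\<^esub> k a\<^sub>k\<close> and
  \<open>m \<Sum>\<^bsub>d | m\<^esub> L\<^sub>d\<close>; they agree by \<open>\<Sum>\<^bsub>u | n\<^esub> \<phi>(u) = n\<close> (\<open>product_formula\<close>).
\<close>

section \<open>Pairing chains with cochains\<close>

definition pairing :: "('b \<Rightarrow>\<^sub>0 'k::field) \<Rightarrow> ('b \<Rightarrow> 'k) \<Rightarrow> 'k" where
  "pairing f c = (\<Sum>x\<in>Poly_Mapping.keys f. Poly_Mapping.lookup f x * c x)"

lemma pairing_superset:
  assumes "finite S" "Poly_Mapping.keys f \<subseteq> S"
  shows "pairing f c = (\<Sum>x\<in>S. Poly_Mapping.lookup f x * c x)"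
  unfolding pairing_def
  by (rule sum.mono_neutral_left) (use assms in \<open>auto simp: not_in_keys_iff_lookup_eq_zero\<close>)

lemma pairing_zero [simp]: "pairing 0 c = 0"
  by (simp add: pairing_def)

lemma pairing_add: "pairing (f + g) c = pairing f c + pairing g c"
proof -
  let ?S = "Poly_Mapping.keys f \<union> Poly_Mapping.keys g"
  have "Poly_Mapping.keys (f + g) \<subseteq> ?S" by (rule Poly_Mapping.keys_add)
  then show ?thesis
    by (simp add: pairing_superset[of ?S] lookup_add algebra_simps sum.distrib)
qed

lemma pairing_free_scale: "pairing (free_scale a f) c = a * pairing f c"
proof -
  have "Poly_Mapping.keys (free_scale a f) \<subseteq> Poly_Mapping.keys f"
    by (auto simp: in_keys_iff)
  then show ?thesis
    by (simp add: pairing_superset[of "Poly_Mapping.keys f"] sum_distrib_left mult.assoc)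
qed

lemma pairing_uminus: "pairing (- f) c = - pairing f c"
  using pairing_add[of f "- f" c] by (simp add: eq_neg_iff_add_eq_0 add.commute)

lemma pairing_diff: "pairing (f - g) c = pairing f c - pairing g c"
  using pairing_add[of f "- g" c] by (simp add: pairing_uminus)

lemma pairing_sum: "pairing (\<Sum>i\<in>A. f i) c = (\<Sum>i\<in>A. pairing (f i) c)"
  by (induction A rule: infinite_finite_induct) (simp_all add: pairing_add)

lemma pairing_single [simp]: "pairing (Poly_Mapping.single x a) c = a * c x"
  by (subst pairing_superset[of "{x}"]) auto

lemma pairing_free_extend: "pairing (free_extend F f) c = pairing f (\<lambda>x. pairing (F x) c)"
  unfolding free_extend_def pairing_sum pairing_free_scale by (simp add: pairing_def[of f])

lemma pairing_cong:
  "(\<And>x. x \<in> Poly_Mapping.keys f \<Longrightarrow> c x = c' x) \<Longrightarrow> pairing f c = pairing f c'"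
  by (simp add: pairing_def)

lemma pairing_add_right: "pairing f (\<lambda>x. c x + c' x) = pairing f c + pairing f c'"
  by (simp add: pairing_def algebra_simps sum.distrib)

lemma pairing_scale_right: "pairing f (\<lambda>x. a * c x) = a * pairing f c"
  by (simp add: pairing_def algebra_simps sum_distrib_left)

lemma pairing_zero_right [simp]: "pairing f (\<lambda>x. 0) = 0"
  by (simp add: pairing_def)

lemma pairing_sum_right: "pairing f (\<lambda>x. \<Sum>i\<in>A. c i x) = (\<Sum>i\<in>A. pairing f (c i))"
  by (induction A rule: infinite_finite_induct) (simp_all add: pairing_add_right)

lemma sum_single_keys: "f = (\<Sum>x\<in>Poly_Mapping.keys f. free_scale (Poly_Mapping.lookup f x) (Poly_Mapping.single x 1))"
proof -
  have "f = (\<Sum>x\<in>Poly_Mapping.keys f. Poly_Mapping.single x (Poly_Mapping.lookup f x))"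
    by (rule poly_mapping_eqI)
      (auto simp: lookup_sum lookup_single when_def not_in_keys_iff_lookup_eq_zero sum.delta)
  then show ?thesis unfolding single_eq_free_scale[symmetric] .
qed

lemma additive_functional_eq_pairing:
  fixes F :: "('b \<Rightarrow>\<^sub>0 'k::field) \<Rightarrow> 'k"
  assumes "\<And>f g. F (f + g) = F f + F g" "\<And>a f. F (free_scale a f) = a * F f"
  shows "F f = pairing f (\<lambda>x. F (Poly_Mapping.single x 1))"
proof -
  have zero: "F 0 = 0" using assms(2)[of 0 0] by simp
  have *: "F (\<Sum>x\<in>S. g x) = (\<Sum>x\<in>S. F (g x))" for S and g :: "'b \<Rightarrow> 'b \<Rightarrow>\<^sub>0 'k"
    by (induction S rule: infinite_finite_induct) (simp_all add: zero assms)
  have "F f = F (\<Sum>x\<in>Poly_Mapping.keys f. free_scale (Poly_Mapping.lookup f x) (Poly_Mapping.single x 1))"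
    by (rule arg_cong[OF sum_single_keys])
  then show ?thesis by (simp only: * assms(2) pairing_def)
qed

text \<open>A vector outside a subspace is separated from it by a linear functional, and every linear functional
  on the free space is pairing with a function. This turns membership questions about spans into
  identities between cochains.\<close>

lemma subspace_separation:
  fixes D :: "('b \<Rightarrow>\<^sub>0 'k::field) set"
  assumes "free.subspace D" and "\<And>c. (\<forall>g\<in>D. pairing g c = 0) \<Longrightarrow> pairing f c = 0"
  shows "f \<in> D"
proof (rule ccontr)
  assume f: "f \<notin> D"
  interpret k: vector_space "(*) :: 'k \<Rightarrow> 'k \<Rightarrow> 'k"
    by unfold_locales (simp_all add: algebra_simps)
  interpret pr: vector_space_pair "free_scale :: 'k \<Rightarrow> ('b \<Rightarrow>\<^sub>0 'k) \<Rightarrow> _" "(*) :: 'k \<Rightarrow> 'k \<Rightarrow> 'k" ..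
  obtain B where B: "B \<subseteq> D" "free.independent B" "D \<subseteq> free.span B"
    by (rule free.basis_exists[of D])
  have sp: "free.span B = D"
    using free.span_minimal[OF B(1) assms(1)] B(3) by (rule subset_antisym)
  have ind: "free.independent (insert f B)"
    using f B sp by (simp add: free.independent_insert)
  obtain F where F: "Vector_Spaces.linear free_scale (*) F" "\<forall>x\<in>insert f B. F x = (if x = f then 1 else 0)"
    using pr.linear_independent_extend[OF ind, of "\<lambda>x. if x = f then 1 else 0"] by (elim exE conjE) (rule that)
  interpret F: Vector_Spaces.linear free_scale "(*)" F by fact
  define c where "c = (\<lambda>x. F (Poly_Mapping.single x 1))"
  have Fc: "F g = pairing g c" for g
    unfolding c_def by (rule additive_functional_eq_pairing) (simp_all add: F.add F.scale)
  have "B \<subseteq> {g. F g = 0}" using F(2) f sp free.span_base[of _ B] by auto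
  moreover have "free.subspace {g. F g = 0}"
    by (auto simp: free.subspace_def F.add F.scale F.zero)
  ultimately have "free.span B \<subseteq> {g. F g = 0}" by (rule free.span_minimal)
  then have "pairing f c = 0" using sp Fc by (intro assms(2)) auto
  then show False using F(2) Fc by simp
qed

lemma subspace_pairing_eq_0: "free.subspace {f. pairing f c = 0}"
  by (auto simp: free.subspace_def pairing_add pairing_free_scale)

lemma span_pairing_eq_0:
  assumes "\<And>g. g \<in> S \<Longrightarrow> pairing g c = 0" "f \<in> free.span S"
  shows "pairing f c = 0"
  using free.span_minimal[of S "{f. pairing f c = 0}"] assms subspace_pairing_eq_0 by auto

section \<open>Cyclic cochains\<close>

text \<open>Cochains on words that are invariant under the signed rotation of Connes. The sum over all signed
  rotations of a function is such a cochain, and every operator on cochains below is built this way.\<close>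

definition cyclic_cochain :: "('a list \<Rightarrow> 'k::comm_ring_1) \<Rightarrow> bool" where
  "cyclic_cochain c \<longleftrightarrow> (\<forall>x xs. c (x # xs) = (-1) ^ length xs * c (xs @ [x]))"

definition cyclic_sum :: "('a list \<Rightarrow> 'k::comm_ring_1) \<Rightarrow> 'a list \<Rightarrow> 'k" where
  "cyclic_sum F xs = (\<Sum>r<length xs. (-1) ^ (r * (length xs + 1)) * F (rotate r xs))"

lemma minus_one_power_eq: "even (m + n) \<Longrightarrow> (-1 :: 'k::comm_ring_1) ^ m = (-1) ^ n"
  by (auto simp: minus_one_power_iff)

lemma cyclic_cochain_append:
  assumes "cyclic_cochain c"
  shows "c (us @ ws) = (-1) ^ (length us * length ws) * c (ws @ us)"
proof (induction us arbitrary: ws)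
  case (Cons u us)
  have "c ((u # us) @ ws) = (-1) ^ length (us @ ws) * c (us @ (ws @ [u]))"
    using assms by (simp add: cyclic_cochain_def)
  also have "\<dots> = (-1) ^ length (us @ ws) * ((-1) ^ (length us * length (ws @ [u])) * c ((ws @ [u]) @ us))"
    by (simp only: Cons)
  also have "\<dots> = (-1) ^ (length (us @ ws) + length us * length (ws @ [u])) * c (ws @ (u # us))"
    by (simp add: power_add)
  also have "(-1 :: 'b) ^ (length (us @ ws) + length us * length (ws @ [u])) = (-1) ^ (length (u # us) * length ws)"
    by (rule minus_one_power_eq) (simp add: algebra_simps)
  finally show ?case .
qed simp

lemma cyclic_cochain_rotate:
  assumes "cyclic_cochain c" "xs \<noteq> []"
  shows "c (rotate r xs) = (-1) ^ (r * (length xs + 1)) * c xs"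
proof (induction r)
  case (Suc r)
  show ?case
  proof (cases "rotate r xs")
    case Nil
    then show ?thesis using assms(2) by (simp add: rotate_is_Nil_conv)
  next
    case (Cons y ys)
    have l: "length xs = Suc (length ys)" using Cons by (metis length_rotate length_Cons)
    have "c (rotate (Suc r) xs) = c (ys @ [y])" using Cons by (simp add: rotate_Suc)
    also have "\<dots> = (-1) ^ length ys * c (y # ys)"
      using assms(1) by (simp add: cyclic_cochain_def mult.assoc[symmetric] power_mult_distrib[symmetric])
    also have "\<dots> = (-1) ^ length ys * ((-1) ^ (r * (length xs + 1)) * c xs)"
      using Suc Cons by simp
    also have "\<dots> = (-1) ^ (length ys + r * (length xs + 1)) * c xs" by (simp add: power_add)
    also have "(-1 :: 'b) ^ (length ys + r * (length xs + 1)) = (-1) ^ (Suc r * (length xs + 1))"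
      by (rule minus_one_power_eq) (auto simp: l)
    finally show ?thesis .
  qed
qed simp

lemma cyclic_sum_cyclic:
  assumes "cyclic_cochain c"
  shows "cyclic_sum c xs = of_nat (length xs) * c xs"
proof -
  have "(-1) ^ (r * (length xs + 1)) * c (rotate r xs) = c xs" if "xs \<noteq> []" for r
    using that by (simp add: cyclic_cochain_rotate[OF assms] mult.assoc[symmetric] power_mult_distrib[symmetric])
  then show ?thesis by (cases "xs = []") (simp_all add: cyclic_sum_def)
qed

lemma cyclic_sum_rotate1:
  fixes F :: "'a list \<Rightarrow> 'k::comm_ring_1"
  shows
  "cyclic_sum (\<lambda>ys. F (rotate1 ys)) xs = (-1) ^ (length xs + 1) * cyclic_sum F xs"
proof -
  let ?n = "length xs" and ?T = "\<lambda>r. (-1) ^ (r * (length xs + 1)) * F (rotate r xs)"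
  have "(\<Sum>r<?n. ?T (Suc r)) + ?T 0 = (\<Sum>r<?n. ?T r) + ?T ?n"
    using sum.lessThan_Suc_shift[of ?T ?n] by (simp add: add.commute)
  moreover have "?T ?n = ?T 0" by simp
  ultimately have shift: "(\<Sum>r<?n. ?T (Suc r)) = (\<Sum>r<?n. ?T r)" by simp
  have "cyclic_sum (\<lambda>ys. F (rotate1 ys)) xs = (\<Sum>r<?n. (-1) ^ (?n + 1) * ?T (Suc r))"
    unfolding cyclic_sum_def
  proof (rule sum.cong)
    fix r
    have e: "(-1 :: 'k) ^ (r * (?n + 1)) = (-1) ^ (?n + 1) * (-1) ^ (Suc r * (?n + 1))"
      unfolding power_add[symmetric] by (rule minus_one_power_eq) auto
    show "(-1) ^ (r * (?n + 1)) * F (rotate1 (rotate r xs)) = (-1) ^ (?n + 1) * ?T (Suc r)"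
      by (simp only: e mult.assoc rotate_Suc)
  qed simp
  then show ?thesis by (simp only: sum_distrib_left[symmetric] shift cyclic_sum_def)
qed

lemma cyclic_sum_rotate:
  "cyclic_sum (\<lambda>ys. F (rotate k ys)) xs = (-1) ^ (k * (length xs + 1)) * cyclic_sum F xs"
proof (induction k arbitrary: F)
  case (Suc k)
  have "cyclic_sum (\<lambda>ys. F (rotate (Suc k) ys)) xs = cyclic_sum (\<lambda>ys. (\<lambda>zs. F (rotate1 zs)) (rotate k ys)) xs"
    by (simp add: rotate_Suc)
  also have "\<dots> = (-1) ^ (k * (length xs + 1)) * ((-1) ^ (length xs + 1) * cyclic_sum F xs)"
    unfolding Suc[of "\<lambda>zs. F (rotate1 zs)"] cyclic_sum_rotate1 ..
  finally show ?case by (simp add: power_add algebra_simps)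
qed simp

lemma cyclic_sum_cong:
  "(\<And>ys. length ys = length xs \<Longrightarrow> set ys = set xs \<Longrightarrow> F ys = F' ys) \<Longrightarrow> cyclic_sum F xs = cyclic_sum F' xs"
  by (simp add: cyclic_sum_def)

lemma cyclic_sum_add: "cyclic_sum (\<lambda>ys. F ys + F' ys) xs = cyclic_sum F xs + cyclic_sum F' xs"
  by (simp add: cyclic_sum_def algebra_simps sum.distrib)

lemma cyclic_sum_mult: "cyclic_sum (\<lambda>ys. a * F ys) xs = a * cyclic_sum F xs"
  by (simp add: cyclic_sum_def algebra_simps sum_distrib_left)

lemma cyclic_sum_sum: "cyclic_sum (\<lambda>ys. \<Sum>i\<in>A. F i ys) xs = (\<Sum>i\<in>A. cyclic_sum (F i) xs)"
  unfolding cyclic_sum_def sum_distrib_left by (rule sum.swap)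

lemma cyclic_cochain_cyclic_sum: "cyclic_cochain (cyclic_sum F)"
  unfolding cyclic_cochain_def
proof (intro allI)
  fix x :: 'a and xs
  have "cyclic_sum F (xs @ [x]) = cyclic_sum F (rotate1 (x # xs))" by simp
  also have "\<dots> = cyclic_sum (\<lambda>ys. F (rotate1 ys)) (x # xs)"
    by (simp add: cyclic_sum_def rotate1_rotate_swap)
  also have "\<dots> = (-1) ^ length xs * cyclic_sum F (x # xs)"
    by (simp add: cyclic_sum_rotate1)
  finally show "cyclic_sum F (x # xs) = (-1) ^ length xs * cyclic_sum F (xs @ [x])"
    by (simp add: mult.assoc[symmetric] power_mult_distrib[symmetric])
qed

lemma rotate_append_Cons:
  "\<exists>us ws. length us + length ws = length xs + length ys \<and> (\<forall>a. rotate r (xs @ a # ys) = us @ a # ws)"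
proof (induction r)
  case 0
  show ?case by auto
next
  case (Suc r)
  then obtain us ws where *: "length us + length ws = length xs + length ys" "\<And>a. rotate r (xs @ a # ys) = us @ a # ws"
    by blast
  show ?case
  proof (cases us)
    case Nil
    then show ?thesis using * by (intro exI[of _ ws] exI[of _ "[]"]) (auto simp: rotate_Suc)
  next
    case (Cons u us')
    then show ?thesis using * by (intro exI[of _ us'] exI[of _ "ws @ [u]"]) (auto simp: rotate_Suc)
  qed
qed

locale algebra_over = vector_space scl
  for scl :: "'k::field_char_0 \<Rightarrow> 'a::{ring, monoid_mult} \<Rightarrow> 'a" +
  assumes scale_mult_left: "scl c x * y = scl c (x * y)"
    and scale_mult_right: "x * scl c y = scl c (x * y)"
begin

definition multilinear_cochain :: "('a list \<Rightarrow> 'k) \<Rightarrow> bool" where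
  "multilinear_cochain c \<longleftrightarrow>
     (\<forall>xs ys k a b. c (xs @ (scl k a + b) # ys) = k * c (xs @ a # ys) + c (xs @ b # ys))"

lemma multilinear_cochainD:
  "multilinear_cochain c \<Longrightarrow> c (xs @ (scl k a + b) # ys) = k * c (xs @ a # ys) + c (xs @ b # ys)"
  unfolding multilinear_cochain_def by (elim allE)

lemma multilinear_cochain_zero: "multilinear_cochain c \<Longrightarrow> c (xs @ 0 # ys) = 0"
  using multilinear_cochainD[of c xs 1 0 0 ys] by simp

lemma multilinear_cochain_add:
  "multilinear_cochain c \<Longrightarrow> c (xs @ (a + b) # ys) = c (xs @ a # ys) + c (xs @ b # ys)"
  using multilinear_cochainD[of c xs 1 a b ys] by simp

lemma multilinear_cochain_scale:
  "multilinear_cochain c \<Longrightarrow> c (xs @ scl k a # ys) = k * c (xs @ a # ys)"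
  using multilinear_cochainD[of c xs k a 0 ys] by (simp add: multilinear_cochain_zero)

lemma multilinear_cochain_diff:
  "multilinear_cochain c \<Longrightarrow> c (xs @ (a - b) # ys) = c (xs @ a # ys) - c (xs @ b # ys)"
  using multilinear_cochain_add[of c xs "a - b" b ys] by simp

lemma multilinear_cochain_sum:
  "multilinear_cochain c \<Longrightarrow> c (xs @ (\<Sum>i\<in>A. g i) # ys) = (\<Sum>i\<in>A. c (xs @ g i # ys))"
  by (induction A rule: infinite_finite_induct)
    (simp_all add: multilinear_cochain_zero multilinear_cochain_add)

lemma multilinear_cochain_cyclic_sum:
  assumes "multilinear_cochain F"
  shows "multilinear_cochain (cyclic_sum F)"
  unfolding multilinear_cochain_def
proof (intro allI)
  fix xs ys :: "'a list" and k a b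
  let ?n = "length xs + length ys + 1"
  have "F (rotate r (xs @ (scl k a + b) # ys)) = k * F (rotate r (xs @ a # ys)) + F (rotate r (xs @ b # ys))" for r
  proof -
    obtain us ws where *: "\<And>a. rotate r (xs @ a # ys) = us @ a # ws"
      using rotate_append_Cons[of xs ys r] by blast
    show ?thesis unfolding * by (rule multilinear_cochainD[OF assms])
  qed
  then show "cyclic_sum F (xs @ (scl k a + b) # ys) = k * cyclic_sum F (xs @ a # ys) + cyclic_sum F (xs @ b # ys)"
    unfolding cyclic_sum_def by (simp add: algebra_simps sum.distrib sum_distrib_left)
qed

end

section \<open>Cochains that detect the Connes relations\<close>

text \<open>A functional vanishing on the relations over the subspace \<open>A\<close> becomes, after composition with a
  linear projection \<open>\<pi>\<close> onto \<open>A\<close>, a multilinear cyclic cochain on the whole algebra. So cochains of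
  the algebra detect the relations of a subspace as well.\<close>

lemma (in algebra_over) connes_relationsI:
  assumes n: "n \<ge> 1" and f: "f \<in> tensor_free A n"
    and \<pi>: "\<And>k a b. \<pi> (scl k a + b) = scl k (\<pi> a) + \<pi> b" "\<And>x. \<pi> x \<in> A" "\<And>x. x \<in> A \<Longrightarrow> \<pi> x = x"
    and *: "\<And>c. multilinear_cochain c \<Longrightarrow> cyclic_cochain c \<Longrightarrow> pairing f c = 0"
  shows "f \<in> connes_relations scl A n"
proof (rule subspace_separation)
  show "free.subspace (connes_relations scl A n)"
    by (simp add: connes_relations_def)
  fix c assume c: "\<forall>g\<in>connes_relations scl A n. pairing g c = 0"
  define c' where "c' xs = (if length xs = n then c (map \<pi> xs) else 0)" for xs
  have "multilinear_cochain c'"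
    unfolding multilinear_cochain_def
  proof (intro allI)
    fix xs ys k a b
    show "c' (xs @ (scl k a + b) # ys) = k * c' (xs @ a # ys) + c' (xs @ b # ys)"
    proof (cases "length xs + 1 + length ys = n")
      case True
      let ?xs = "map \<pi> xs" and ?ys = "map \<pi> ys"
      have "pure_tensor (?xs @ [scl k (\<pi> a) + \<pi> b] @ ?ys)
          - free_scale k (pure_tensor (?xs @ [\<pi> a] @ ?ys)) - pure_tensor (?xs @ [\<pi> b] @ ?ys)
        \<in> connes_relations scl A n"
        unfolding connes_relations_def multilinear_relations_def using True \<pi>(2)
        by (intro free.span_base UnI1 CollectI exI conjI) (rule refl, auto)
      with c have "pairing (pure_tensor (?xs @ [scl k (\<pi> a) + \<pi> b] @ ?ys)
          - free_scale k (pure_tensor (?xs @ [\<pi> a] @ ?ys)) - pure_tensor (?xs @ [\<pi> b] @ ?ys)) c = 0"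
        by blast
      then show ?thesis using True
        by (simp add: c'_def pure_tensor_def pairing_diff pairing_free_scale \<pi>(1)) (simp add: algebra_simps)
    qed (simp add: c'_def)
  qed
  moreover have "cyclic_cochain c'"
    unfolding cyclic_cochain_def
  proof (intro allI)
    fix x xs
    show "c' (x # xs) = (-1) ^ length xs * c' (xs @ [x])"
    proof (cases "length xs + 1 = n")
      case True
      let ?z = "Poly_Mapping.single (map \<pi> (xs @ [x])) (1::'k)"
      have "?z - cyclic_t ?z \<in> connes_relations scl A n"
        unfolding connes_relations_def using True \<pi>(2)
        by (intro free.span_base UnI2 imageI) (auto simp: tensor_free_def)
      then have "pairing (?z - cyclic_t ?z) c = 0" using c by blast
      then have "c (map \<pi> (xs @ [x])) = (-1) ^ length xs * c (map \<pi> (x # xs))"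
        by (simp add: pairing_diff cyclic_t_def pairing_free_scale)
      then show ?thesis using True
        by (simp add: c'_def mult.assoc[symmetric] power_mult_distrib[symmetric])
    qed (simp add: c'_def)
  qed
  ultimately have "pairing f c' = 0" by (rule *)
  moreover have "c' xs = c xs" if "xs \<in> Poly_Mapping.keys f" for xs
  proof -
    have "length xs = n" "set xs \<subseteq> A" using f that by (auto simp: tensor_free_def)
    moreover from this have "map \<pi> xs = xs" using \<pi>(3) by (intro map_idI) auto
    ultimately show ?thesis by (simp add: c'_def)
  qed
  ultimately show "pairing f c = 0" using pairing_cong[of f c' c] by simp
qed

lemma (in algebra_over) mem_connes_relations_iff:
  assumes n: "n \<ge> 1" and f: "f \<in> tensor_free UNIV n"
  shows "f \<in> connes_relations scl UNIV n \<longleftrightarrow>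
    (\<forall>c. multilinear_cochain c \<longrightarrow> cyclic_cochain c \<longrightarrow> pairing f c = 0)"
proof (intro iffI allI impI)
  fix c assume c: "multilinear_cochain c" "cyclic_cochain c" and fR: "f \<in> connes_relations scl UNIV n"
  show "pairing f c = 0"
  proof (rule span_pairing_eq_0[OF _ fR[unfolded connes_relations_def]])
    fix g assume "g \<in> multilinear_relations scl UNIV n \<union> (\<lambda>z. z - cyclic_t z) ` tensor_free UNIV n"
    then consider xs ys a b k where "g = pure_tensor (xs @ [scl k a + b] @ ys)
        - free_scale k (pure_tensor (xs @ [a] @ ys)) - pure_tensor (xs @ [b] @ ys)"
      | z where "z \<in> tensor_free UNIV n" "g = z - cyclic_t z"
      by (auto simp: multilinear_relations_def)
    then show "pairing g c = 0"
    proof cases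
      case 1
      then show ?thesis
        by (simp add: pure_tensor_def pairing_diff pairing_free_scale multilinear_cochainD[OF c(1)])
    next
      case 2
      have "c (last xs # butlast xs) = (-1) ^ (length xs - 1) * c xs" if "xs \<noteq> []" for xs :: "'a list"
        using c(2) that append_butlast_last_id[OF that] unfolding cyclic_cochain_def
        by (metis length_butlast)
      moreover have "xs \<noteq> []" if "xs \<in> Poly_Mapping.keys z" for xs
        using 2(1) n that by (auto simp: tensor_free_def)
      ultimately have "pairing (cyclic_t z) c = pairing z c"
        unfolding cyclic_t_def pairing_free_extend pairing_single
        by (intro pairing_cong) (simp add: mult.assoc[symmetric] power_mult_distrib[symmetric])
      then show ?thesis using 2 by (simp add: pairing_diff)
    qed
  qed
next
  assume "\<forall>c. multilinear_cochain c \<longrightarrow> cyclic_cochain c \<longrightarrow> pairing f c = 0"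
  then show "f \<in> connes_relations scl UNIV n"
    by (intro connes_relationsI[OF n f, of "\<lambda>x. x"]) simp_all
qed

section \<open>The transpose of the Hochschild boundary\<close>

definition merge_first :: "('a::times list \<Rightarrow> 'k::zero) \<Rightarrow> 'a list \<Rightarrow> 'k" where
  "merge_first c ys = (case ys of x # y # w \<Rightarrow> c (x * y # w) | _ \<Rightarrow> 0)"

lemma merge_first_simps [simp]:
  "merge_first c [] = 0" "merge_first c [x] = 0" "merge_first c (x # y # w) = c (x * y # w)"
  by (simp_all add: merge_first_def)

text \<open>Multiplying the letters \<open>j\<close> and \<open>j + 1\<close> of a word is, for a cyclic cochain, the same as rotating by
  \<open>j\<close> and multiplying the first two letters. The whole Hochschild boundary, including its last face,
  is thus the cyclic sum of one operation.\<close>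

definition coboundary :: "('a::times list \<Rightarrow> 'k::comm_ring_1) \<Rightarrow> 'a list \<Rightarrow> 'k" where
  "coboundary c = cyclic_sum (merge_first c)"

lemma rotate_merge:
  assumes c: "cyclic_cochain c" and j: "Suc j < length xs"
  shows "(-1) ^ (j * (length xs + 1)) * merge_first c (rotate j xs)
       = (-1) ^ j * c (take j xs @ [xs ! j * xs ! (j + 1)] @ drop (j + 2) xs)"
proof -
  have d: "drop j xs = xs ! j # xs ! (j + 1) # drop (j + 2) xs"
    using j by (metis Cons_nth_drop_Suc Suc_eq_plus1 Suc_lessD add_2_eq_Suc')
  let ?A = "[xs ! j * xs ! (j + 1)] @ drop (j + 2) xs"
  have "merge_first c (rotate j xs) = c (?A @ take j xs)"
    using j d by (simp add: rotate_drop_take)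
  also have "\<dots> = (-1) ^ (length ?A * length (take j xs)) * c (take j xs @ ?A)"
    by (rule cyclic_cochain_append[OF c])
  finally have "(-1) ^ (j * (length xs + 1)) * merge_first c (rotate j xs)
     = (-1) ^ (j * (length xs + 1) + length ?A * length (take j xs)) * c (take j xs @ ?A)"
    by (simp add: power_add mult.assoc)
  also have "(-1 :: 'b) ^ (j * (length xs + 1) + length ?A * length (take j xs)) = (-1) ^ j"
  proof (rule minus_one_power_eq)
    obtain l where l: "length xs = j + 2 + l" using j less_iff_Suc_add[of "Suc j" "length xs"] by auto
    show "even (j * (length xs + 1) + length ?A * length (take j xs) + j)"
      using l by auto
  qed
  finally show ?thesis by simp
qed

lemma pairing_hochschild_b:
  fixes c :: "'a::{ring, monoid_mult} list \<Rightarrow> 'k::field"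
  assumes c: "cyclic_cochain c"
  shows "pairing (hochschild_b f) c = pairing f (coboundary c)"
proof -
  have "pairing (if length xs \<le> 1 then 0
     else (\<Sum>j<length xs - 1.
             Poly_Mapping.single (take j xs @ [xs ! j * xs ! (j + 1)] @ drop (j + 2) xs) ((-1) ^ j))
          + Poly_Mapping.single ((last xs * hd xs) # butlast (tl xs)) ((-1) ^ (length xs - 1))) c
    = coboundary c xs" for xs :: "'a list"
  proof (cases "length xs \<le> 1")
    case True
    then consider "xs = []" | x where "xs = [x]" by (cases xs) auto
    then show ?thesis by cases (auto simp: coboundary_def cyclic_sum_def)
  next
    case False
    define m where "m = length xs - 2"
    have l: "length xs = Suc (Suc m)" using False by (simp add: m_def)
    obtain x y where xs: "xs = x # butlast (tl xs) @ [y]"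
      using l by (metis append_butlast_last_id length_Suc_conv length_0_conv list.sel(3) nat.simps(3))
    define u where "u = butlast (tl xs)"
    have xs: "xs = x # u @ [y]" using xs by (simp add: u_def)
    have "rotate (Suc m) xs = y # x # u"
    proof -
      have "length (x # u) = Suc m" using l xs by simp
      then show ?thesis using rotate_append[of "x # u" "[y]"] xs by simp
    qed
    moreover have "(-1 :: 'k) ^ (Suc m * (length xs + 1)) = (-1) ^ (Suc m)"
      by (rule minus_one_power_eq) (simp add: l)
    ultimately have last: "(-1) ^ (Suc m * (length xs + 1)) * merge_first c (rotate (Suc m) xs)
       = (-1) ^ Suc m * c (y * x # u)" by simp
    have "coboundary c xs = (\<Sum>j<Suc m. (-1) ^ (j * (length xs + 1)) * merge_first c (rotate j xs))
        + (-1) ^ (Suc m * (length xs + 1)) * merge_first c (rotate (Suc m) xs)"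
      unfolding coboundary_def cyclic_sum_def l by simp
    also have "\<dots> = (\<Sum>j<Suc m. (-1) ^ j * c (take j xs @ [xs ! j * xs ! (j + 1)] @ drop (j + 2) xs))
        + (-1) ^ Suc m * c (y * x # u)"
      unfolding last by (intro arg_cong2[of _ _ _ _ "(+)"] sum.cong rotate_merge c refl) (simp add: l)
    finally show ?thesis
      using l by (simp add: pairing_add pairing_sum xs)
  qed
  then show ?thesis unfolding hochschild_b_def pairing_free_extend by (intro pairing_cong)
qed

lemma rotate_Suc_Cons:
  assumes "k \<le> length w"
  shows "rotate (Suc k) (u # w) = drop k w @ u # take k w"
  using rotate_append[of "u # take k w" "drop k w"] assms by (simp add: min_absorb2)

lemma rotate_Suc_Suc_Cons:
  assumes "k \<le> length w"
  shows "rotate (Suc (Suc k)) (u # v # w) = drop k w @ u # v # take k w"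
  using rotate_append[of "u # v # take k w" "drop k w"] assms by (simp add: min_absorb2)

lemma (in algebra_over) multilinear_cochain_merge_first:
  assumes "multilinear_cochain c"
  shows "multilinear_cochain (merge_first c)"
  unfolding multilinear_cochain_def
proof (intro allI)
  fix xs ys :: "'a list" and k a b
  note D = multilinear_cochainD[OF assms]
  consider "xs = []" "ys = []" | y ys' where "xs = []" "ys = y # ys'"
    | x where "xs = [x]" | x y xs' where "xs = x # y # xs'"
    by (metis neq_Nil_conv)
  then show "merge_first c (xs @ (scl k a + b) # ys) = k * merge_first c (xs @ a # ys) + merge_first c (xs @ b # ys)"
  proof cases
    case 2
    then show ?thesis using D[of "[]" k "a * y" "b * y" ys']
      by (simp add: distrib_right scale_mult_left)
  next
    case (3 x)
    then show ?thesis using D[of "[]" k "x * a" "x * b" ys]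
      by (simp add: distrib_left scale_mult_right)
  next
    case (4 x y xs')
    then show ?thesis using D[of "x * y # xs'" k a b ys] by simp
  qed simp
qed

lemma (in algebra_over) multilinear_cochain_coboundary:
  "multilinear_cochain c \<Longrightarrow> multilinear_cochain (coboundary c)"
  unfolding coboundary_def by (intro multilinear_cochain_cyclic_sum multilinear_cochain_merge_first)

lemma cyclic_cochain_coboundary: "cyclic_cochain (coboundary c)"
  unfolding coboundary_def by (rule cyclic_cochain_cyclic_sum)

lemma coboundary_Cons_Cons:
  fixes c :: "'a::times list \<Rightarrow> 'k::comm_ring_1"
  shows "coboundary c (u # v # w) = c (u * v # w)
     + (-1) ^ (length w + 1) * merge_first c (v # w @ [u])
     + (\<Sum>k<length w. (-1) ^ (k * (length w + 1)) * merge_first c (drop k w @ u # v # take k w))"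
proof -
  let ?n = "length (u # v # w)"
  let ?T = "\<lambda>r. (-1) ^ (r * (?n + 1)) * merge_first c (rotate r (u # v # w))"
  have "coboundary c (u # v # w) = ?T 0 + ?T 1 + (\<Sum>k<length w. ?T (Suc (Suc k)))"
    unfolding coboundary_def cyclic_sum_def length_Cons sum.lessThan_Suc_shift
    by (simp only: One_nat_def add.assoc)
  also have "?T 1 = (-1) ^ (length w + 1) * merge_first c (v # w @ [u])"
    by simp
  also have "(\<Sum>k<length w. ?T (Suc (Suc k)))
      = (\<Sum>k<length w. (-1) ^ (k * (length w + 1)) * merge_first c (drop k w @ u # v # take k w))"
  proof (rule sum.cong)
    fix k assume "k \<in> {..<length w}"
    moreover have "(-1 :: 'k) ^ (Suc (Suc k) * (?n + 1)) = (-1) ^ (k * (length w + 1))"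
      by (rule minus_one_power_eq) auto
    ultimately show "?T (Suc (Suc k)) = (-1) ^ (k * (length w + 1)) * merge_first c (drop k w @ u # v # take k w)"
      by (simp only: rotate_Suc_Suc_Cons lessThan_iff less_imp_le)
  qed simp
  finally show ?thesis by simp
qed

lemma sum_antisymmetric_reflection_eq_0:
  fixes g :: "nat \<Rightarrow> 'k::field_char_0"
  assumes "\<And>k l. k + l + 1 = n \<Longrightarrow> g k = - g l"
  shows "(\<Sum>k<n. g k) = 0"
proof -
  have "(\<Sum>k<n. g k) = (\<Sum>k<n. g (n - Suc k))" by (rule sum.nat_diff_reindex[symmetric])
  also have "\<dots> = (\<Sum>k<n. - g k)"
    by (intro sum.cong refl assms) auto
  finally show ?thesis by (simp add: sum_negf)
qed

lemma obtain_Cons_Cons: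
  assumes "length ys = m + 2"
  obtains x y w where "ys = x # y # w" "length w = m"
  using assms by (metis add_2_eq_Suc' length_Suc_conv)

text \<open>Multiplying two pairs of adjacent letters: disjoint pairs occur in both orders with opposite signs,
  and the two ways to multiply three consecutive letters cancel by associativity.\<close>

lemma coboundary_coboundary:
  fixes c :: "'a::{ring, monoid_mult} list \<Rightarrow> 'k::field_char_0"
  assumes c: "cyclic_cochain c"
  shows "coboundary (coboundary c) xs = 0"
proof (cases "length xs \<ge> 3")
  case False
  then consider "xs = []" | x where "xs = [x]" | x y where "xs = [x, y]"
    by (cases xs; cases "tl xs"; cases "tl (tl xs)") auto
  then show ?thesis by cases (simp_all add: coboundary_def cyclic_sum_def)
next
  case True
  then obtain m where m: "length xs = m + 3" by (metis add.commute le_Suc_ex)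
  \<comment> \<open>\<open>D k\<close>: multiply the first two letters, then the pair that starts behind \<open>k\<close> further letters; for
    \<open>k = m\<close> this second pair consists of the last letter and the first product. \<open>F\<close> is the other
    product of three letters, with the first product as the left factor.\<close>
  define D where "D k ys = (case ys of x # y # w \<Rightarrow> merge_first c (drop k w @ x * y # take k w) | _ \<Rightarrow> 0)"
    for k and ys :: "'a list"
  define F where "F ys = (case ys of x # y # z # w \<Rightarrow> c (x * y * z # w) | _ \<Rightarrow> 0)" for ys :: "'a list"
  have "coboundary (coboundary c) xs = cyclic_sum (\<lambda>ys. F ys + (-1) ^ ((m + 1) * (m + 3)) * D m ys
      + (\<Sum>k<m. (-1) ^ ((k + 1) * (m + 3)) * D k ys)) xs"
    unfolding coboundary_def[of "coboundary c"]
  proof (rule cyclic_sum_cong)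
    fix ys :: "'a list" assume "length ys = length xs"
    then obtain x y z w where ys: "ys = x # y # z # w" and w: "length w = m"
      using m by (auto simp: length_Suc_conv eval_nat_numeral)
    have "merge_first (coboundary c) ys = coboundary c ((x * y) # z # w)" using ys by simp
    also have "\<dots> = (\<Sum>r<Suc (Suc m). (-1) ^ (r * (m + 3)) * merge_first c (rotate r ((x * y) # z # w)))"
    proof -
      have l: "length ((x * y) # z # w) = Suc (Suc m)" "Suc (Suc m) + 1 = m + 3"
        using w by simp_all
      show ?thesis unfolding coboundary_def cyclic_sum_def l ..
    qed
    also have "\<dots> = c (x * y * z # w) + (\<Sum>k<Suc m. (-1) ^ (Suc k * (m + 3)) * merge_first c (rotate (Suc k) ((x * y) # z # w)))"
      unfolding sum.lessThan_Suc_shift[of _ "Suc m"] by simp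
    also have "(\<Sum>k<Suc m. (-1) ^ (Suc k * (m + 3)) * merge_first c (rotate (Suc k) ((x * y) # z # w)))
      = (\<Sum>k<Suc m. (-1) ^ ((k + 1) * (m + 3)) * D k ys)"
    proof (rule sum.cong)
      fix k assume "k \<in> {..<Suc m}"
      then show "(-1) ^ (Suc k * (m + 3)) * merge_first c (rotate (Suc k) ((x * y) # z # w)) = (-1) ^ ((k + 1) * (m + 3)) * D k ys"
        by (subst rotate_Suc_Cons) (simp_all add: w ys D_def)
    qed simp
    finally show "merge_first (coboundary c) ys = F ys + (-1) ^ ((m + 1) * (m + 3)) * D m ys
      + (\<Sum>k<m. (-1) ^ ((k + 1) * (m + 3)) * D k ys)" by (simp add: F_def ys)
  qed
  also have "\<dots> = cyclic_sum F xs + (-1) ^ ((m + 1) * (m + 3)) * cyclic_sum (D m) xs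
      + (\<Sum>k<m. (-1) ^ ((k + 1) * (m + 3)) * cyclic_sum (D k) xs)"
    by (simp only: cyclic_sum_add cyclic_sum_sum cyclic_sum_mult)
  also have "cyclic_sum F xs = cyclic_sum (\<lambda>ys. D m (rotate1 ys)) xs"
  proof (rule cyclic_sum_cong)
    fix ys :: "'a list" assume "length ys = length xs"
    then obtain x y z w where ys: "ys = x # y # z # w" and w: "length w = m"
      using m by (auto simp: length_Suc_conv eval_nat_numeral)
    show "F ys = D m (rotate1 ys)" by (simp add: F_def D_def ys w mult.assoc)
  qed
  also have "\<dots> = (-1) ^ (m + 4) * cyclic_sum (D m) xs"
    unfolding cyclic_sum_rotate1 m by (simp add: add.commute)
  also have "(\<Sum>k<m. (-1) ^ ((k + 1) * (m + 3)) * cyclic_sum (D k) xs) = 0"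
  proof (rule sum_antisymmetric_reflection_eq_0)
    fix k l assume kl: "k + l + 1 = m"
    have "cyclic_sum (D k) xs = cyclic_sum (\<lambda>ys. (-1) ^ ((k + 1) * (l + 1)) * D l (rotate (k + 2) ys)) xs"
    proof (rule cyclic_sum_cong)
      fix ys :: "'a list" assume "length ys = length xs"
      then obtain x y w where ys: "ys = x # y # w" and w: "length w = m + 1"
        using m by (auto simp: length_Suc_conv eval_nat_numeral)
      define w1 where "w1 = take k w"
      have "length (drop k w) = l + 2" using w kl by simp
      then obtain s t w2 where d: "drop k w = s # t # w2" and w2: "length w2 = l"
        by (rule obtain_Cons_Cons)
      have w1: "w = w1 @ s # t # w2" "length w1 = k"
        unfolding d[symmetric] w1_def using kl w by simp_all
      have "rotate (k + 2) ys = s # t # w2 @ x # y # w1"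
        using rotate_append[of "x # y # w1" "s # t # w2"] by (simp add: ys w1)
      then have "D l (rotate (k + 2) ys) = c (x * y # w1 @ s * t # w2)"
        by (simp add: D_def w2)
      moreover have "D k ys = c ((s * t # w2) @ (x * y # w1))"
        by (simp add: D_def ys w1)
      ultimately show "D k ys = (-1) ^ ((k + 1) * (l + 1)) * D l (rotate (k + 2) ys)"
        unfolding cyclic_cochain_append[OF c, of "s * t # w2"] by (simp add: w1 w2 mult.commute)
    qed
    also have "\<dots> = (-1) ^ ((k + 1) * (l + 1) + (k + 2) * (m + 4)) * cyclic_sum (D l) xs"
    proof -
      have "m + 3 + 1 = m + 4" by simp
      then show ?thesis unfolding cyclic_sum_mult cyclic_sum_rotate m by (simp only: power_add mult.assoc)
    qed
    finally have "(-1) ^ ((k + 1) * (m + 3)) * cyclic_sum (D k) xs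
      = (-1) ^ ((k + 1) * (m + 3) + ((k + 1) * (l + 1) + (k + 2) * (m + 4))) * cyclic_sum (D l) xs"
      by (simp only: power_add mult.assoc)
    also have "(-1 :: 'k) ^ ((k + 1) * (m + 3) + ((k + 1) * (l + 1) + (k + 2) * (m + 4))) = (-1) ^ Suc ((l + 1) * (m + 3))"
      by (rule minus_one_power_eq) (auto simp flip: kl)
    finally show "(-1) ^ ((k + 1) * (m + 3)) * cyclic_sum (D k) xs = - ((-1) ^ ((l + 1) * (m + 3)) * cyclic_sum (D l) xs)"
      unfolding power_Suc mult_minus1 minus_mult_left .
  qed
  also have "(-1 :: 'k) ^ ((m + 1) * (m + 3)) = (-1) ^ (Suc (m + 4))"
    by (rule minus_one_power_eq) auto
  finally show ?thesis unfolding power_Suc by simp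
qed

section \<open>The insertion homotopy\<close>

text \<open>Here \<open>p\<close> is the projection onto a two-sided ideal along the span of the orthogonal idempotents. For
  \<open>x = p(x) + s\<close> and \<open>y = p(y) + t\<close> one has \<open>x y = x p(y) + p(x) t + s t\<close>, where the first two terms lie
  in the ideal and \<open>s t\<close> lies in the span of the idempotents; this is the assumption \<open>p_mult\<close>.\<close>

locale algebra_with_idempotents = algebra_over scl
  for scl :: "'k::field_char_0 \<Rightarrow> 'a::{ring, monoid_mult} \<Rightarrow> 'a" +
  fixes n :: nat and e :: "nat \<Rightarrow> 'a" and p :: "'a \<Rightarrow> 'a"
  assumes e_mult: "i < n \<Longrightarrow> j < n \<Longrightarrow> e i * e j = (if i = j then e i else 0)"
    and e_sum: "(\<Sum>i<n. e i) = 1"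
    and p_linear: "p (scl k a + b) = scl k (p a) + p b"
    and p_mult: "p (x * y) = x * p y + p x * (y - p y)"
    and p_complement: "\<exists>s. y - p y = (\<Sum>i<n. scl (s i) (e i))"
begin

text \<open>The element \<open>\<Sum>\<^sub>i p(x) e\<^sub>i \<otimes> e\<^sub>i\<close> is a version of \<open>p(x) \<otimes> 1\<close> that is balanced over the
  semisimple part. Putting it in the place of each letter in turn gives the contracting homotopy.\<close>

definition insert_first :: "('a list \<Rightarrow> 'k) \<Rightarrow> 'a list \<Rightarrow> 'k" where
  "insert_first c ys = (case ys of [] \<Rightarrow> 0 | x # w \<Rightarrow> \<Sum>i<n. c (p x * e i # e i # w))"

definition insertion :: "('a list \<Rightarrow> 'k) \<Rightarrow> 'a list \<Rightarrow> 'k" where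
  "insertion c = cyclic_sum (insert_first c)"

definition defect_first :: "('a list \<Rightarrow> 'k) \<Rightarrow> 'a list \<Rightarrow> 'k" where
  "defect_first c ys = (case ys of [] \<Rightarrow> 0
     | [x] \<Rightarrow> c [p x] - (\<Sum>i<n. c [e i * (p x * e i)])
     | x # y # w \<Rightarrow> c (p x # y # w) - (\<Sum>i<n. c (p x * e i # e i * p y # w)))"

lemma insert_first_simps [simp]:
  "insert_first c [] = 0" "insert_first c (x # w) = (\<Sum>i<n. c (p x * e i # e i # w))"
  by (simp_all add: insert_first_def)

lemma defect_first_simps [simp]:
  "defect_first c [] = 0"
  "defect_first c [x] = c [p x] - (\<Sum>i<n. c [e i * (p x * e i)])"
  "defect_first c (x # y # w) = c (p x # y # w) - (\<Sum>i<n. c (p x * e i # e i * p y # w))"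
  by (simp_all add: defect_first_def)

lemma multilinear_cochain_insert_first:
  assumes "multilinear_cochain c"
  shows "multilinear_cochain (insert_first c)"
  unfolding multilinear_cochain_def
proof (intro allI)
  fix xs ys :: "'a list" and k a b
  note D = multilinear_cochainD[OF assms]
  show "insert_first c (xs @ (scl k a + b) # ys) = k * insert_first c (xs @ a # ys) + insert_first c (xs @ b # ys)"
  proof (cases xs)
    case Nil
    have "c (p (scl k a + b) * e i # e i # ys) = k * c (p a * e i # e i # ys) + c (p b * e i # e i # ys)" for i
      using D[of "[]" k "p a * e i" "p b * e i" "e i # ys"]
      by (simp add: p_linear distrib_right scale_mult_left)
    then show ?thesis by (simp add: Nil sum.distrib sum_distrib_left)
  next
    case (Cons x xs')
    have "c (p x * e i # e i # xs' @ (scl k a + b) # ys) = k * c (p x * e i # e i # xs' @ a # ys) + c (p x * e i # e i # xs' @ b # ys)" for i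
      using D[of "p x * e i # e i # xs'" k a b ys] by simp
    then show ?thesis by (simp add: Cons sum.distrib sum_distrib_left)
  qed
qed

lemma multilinear_cochain_insertion: "multilinear_cochain c \<Longrightarrow> multilinear_cochain (insertion c)"
  unfolding insertion_def by (intro multilinear_cochain_cyclic_sum multilinear_cochain_insert_first)

lemma cyclic_cochain_insertion: "cyclic_cochain (insertion c)"
  unfolding insertion_def by (rule cyclic_cochain_cyclic_sum)

lemma sum_split_idempotents:
  assumes c: "multilinear_cochain c"
  shows "(\<Sum>i<n. c (x * e i * e i # w)) = c (x # w)"
proof -
  have "(\<Sum>i<n. c (x * e i * e i # w)) = (\<Sum>i<n. c (x * e i # w))"
    by (intro sum.cong refl) (simp add: mult.assoc e_mult)
  also have "\<dots> = c ((\<Sum>i<n. x * e i) # w)"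
    using multilinear_cochain_sum[OF c, of "[]" "\<lambda>i. x * e i" "{..<n}" w] by simp
  finally show ?thesis by (simp add: sum_distrib_left[symmetric] e_sum)
qed

text \<open>The element \<open>\<Sum>\<^sub>i e\<^sub>i \<otimes> e\<^sub>i\<close> commutes with the span of the idempotents, so the semisimple part of
  a letter may be moved across the insertion.\<close>

lemma sum_move_complement:
  assumes c: "multilinear_cochain c"
  shows "(\<Sum>i<n. c (x * (y - p y) * e i # e i # w)) = (\<Sum>i<n. c (x * e i # e i * (y - p y) # w))"
proof -
  obtain s where s: "y - p y = (\<Sum>i<n. scl (s i) (e i))" using p_complement by blast
  have 1: "(y - p y) * e i = scl (s i) (e i)" if "i < n" for i
  proof -
    have "(y - p y) * e i = (\<Sum>j<n. if j = i then scl (s i) (e i) else 0)"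
      unfolding s sum_distrib_right by (intro sum.cong refl) (simp add: scale_mult_left e_mult that)
    then show ?thesis using that by simp
  qed
  have 2: "e i * (y - p y) = scl (s i) (e i)" if "i < n" for i
  proof -
    have "e i * (y - p y) = (\<Sum>j<n. if j = i then scl (s i) (e i) else 0)"
      unfolding s sum_distrib_left by (intro sum.cong refl) (simp add: scale_mult_right e_mult that)
    then show ?thesis using that by simp
  qed
  have "c (x * (y - p y) * e i # e i # w) = c (x * e i # e i * (y - p y) # w)" if "i < n" for i
    using multilinear_cochain_scale[OF c, of "[]" "s i" "x * e i" "e i # w"]
      multilinear_cochain_scale[OF c, of "[x * e i]" "s i" "e i" w]
    by (simp add: mult.assoc 1 2 that scale_mult_right)
  then show ?thesis by simp
qed

text \<open>Products that avoid the inserted idempotent cancel between the two compositions. What survives are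
  the products involving the letter at which the insertion takes place or the inserted idempotent
  itself; by \<open>p_mult\<close> and \<open>sum_move_complement\<close> they add up to a comparison of adjacent letters
  with the balanced tensor product over the semisimple part.\<close>

lemma homotopy:
  assumes ml: "multilinear_cochain c" and cy: "cyclic_cochain c"
  shows "coboundary (insertion c) xs + insertion (coboundary c) xs = cyclic_sum (defect_first c) xs"
proof (cases "length xs \<ge> 2")
  case False
  then consider "xs = []" | x where "xs = [x]" by (cases xs; cases "tl xs") auto
  then show ?thesis
  proof cases
    case 2
    have "coboundary c [u, v] = c [u * v] - c [v * u]" for u v
      unfolding coboundary_Cons_Cons by simp
    moreover have "coboundary c' [x] = 0" for c' :: "'a list \<Rightarrow> 'k"
      by (simp add: coboundary_def cyclic_sum_def)
    ultimately show ?thesis using sum_split_idempotents[OF ml, of "p x" "[]"]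
      by (simp add: 2 insertion_def cyclic_sum_def sum_subtractf)
  qed (simp add: coboundary_def insertion_def cyclic_sum_def)
next
  case True
  then obtain m where m: "length xs = m + 2" by (metis add.commute le_Suc_ex)
  \<comment> \<open>\<open>A k\<close> inserts behind the first letter and multiplies a pair of letters, which for \<open>k = m\<close> is the
    last letter and the first; \<open>B k\<close> multiplies the first two letters and inserts elsewhere. \<open>P\<close> collects
    the products with the inserted idempotent, \<open>Q\<close> the insertions behind a product.\<close>
  define A where "A k ys = (case ys of [] \<Rightarrow> 0 | x # w \<Rightarrow> \<Sum>i<n. merge_first c (drop k w @ p x * e i # e i # take k w))"
    for k and ys :: "'a list"
  define B where "B k ys = (case ys of x # y # w \<Rightarrow> insert_first c (drop k w @ x * y # take k w) | _ \<Rightarrow> 0)"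
    for k and ys :: "'a list"
  define P where "P ys = (case ys of x # y # w \<Rightarrow> c (p x # y # w) - (\<Sum>i<n. c (p x * e i # e i * y # w)) | _ \<Rightarrow> 0)"
    for ys :: "'a list"
  define Q where "Q ys = (case ys of x # y # w \<Rightarrow> \<Sum>i<n. c (p (x * y) * e i # e i # w) | _ \<Rightarrow> 0)"
    for ys :: "'a list"
  define f where "f k = (-1) ^ (k * (m + 2)) * cyclic_sum (A k) xs" for k
  define g where "g k = (-1) ^ ((k + 1) * (m + 2)) * cyclic_sum (B k) xs" for k
  have "insertion (coboundary c) xs = cyclic_sum (\<lambda>ys. P ys + (-1) ^ (m * (m + 2)) * A m ys
      + (\<Sum>k<m. (-1) ^ (k * (m + 2)) * A k ys)) xs"
    unfolding insertion_def
  proof (rule cyclic_sum_cong)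
    fix ys :: "'a list" assume "length ys = length xs"
    then obtain x y w where ys: "ys = x # y # w" and w: "length w = m"
      using m obtain_Cons_Cons by metis
    have "insert_first (coboundary c) ys = (\<Sum>i<n. c (p x * e i * e i # y # w)
        + (-1) ^ m * c ((e i * y # w) @ [p x * e i])
        + (\<Sum>k<Suc m. (-1) ^ (k * (m + 2)) * merge_first c (drop k (y # w) @ p x * e i # e i # take k (y # w))))"
      unfolding ys insert_first_simps coboundary_Cons_Cons by (simp add: w)
    also have "\<dots> = c (p x # y # w) + (\<Sum>i<n. (-1) ^ m * c ((e i * y # w) @ [p x * e i]))
        + (\<Sum>i<n. \<Sum>k<Suc m. (-1) ^ (k * (m + 2)) * merge_first c (drop k (y # w) @ p x * e i # e i # take k (y # w)))"
      by (simp only: sum.distrib sum_split_idempotents[OF ml])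
    also have "(\<Sum>i<n. (-1) ^ m * c ((e i * y # w) @ [p x * e i])) = - (\<Sum>i<n. c (p x * e i # e i * y # w))"
      unfolding sum_negf[symmetric]
    proof (intro sum.cong refl)
      fix i
      have "c (p x * e i # e i * y # w) = (-1) ^ (m + 1) * c ((e i * y # w) @ [p x * e i])"
        using cy w by (simp add: cyclic_cochain_def)
      then show "(-1) ^ m * c ((e i * y # w) @ [p x * e i]) = - c (p x * e i # e i * y # w)"
        by simp
    qed
    also have "(\<Sum>i<n. \<Sum>k<Suc m. (-1) ^ (k * (m + 2)) * merge_first c (drop k (y # w) @ p x * e i # e i # take k (y # w)))
       = (\<Sum>k<Suc m. (-1) ^ (k * (m + 2)) * A k ys)"
      unfolding A_def ys by (subst sum.swap) (simp add: sum_distrib_left)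
    finally show "insert_first (coboundary c) ys = P ys + (-1) ^ (m * (m + 2)) * A m ys
      + (\<Sum>k<m. (-1) ^ (k * (m + 2)) * A k ys)"
      by (simp add: P_def ys)
  qed
  also have "\<dots> = cyclic_sum P xs + (-1) ^ (m * (m + 2)) * cyclic_sum (A m) xs + (\<Sum>k<m. f k)"
    by (simp only: cyclic_sum_add cyclic_sum_sum cyclic_sum_mult f_def)
  finally have 1: "insertion (coboundary c) xs
    = cyclic_sum P xs + (-1) ^ (m * (m + 2)) * cyclic_sum (A m) xs + (\<Sum>k<m. f k)" .
  have "coboundary (insertion c) xs = cyclic_sum (\<lambda>ys. Q ys + (\<Sum>k<m. (-1) ^ ((k + 1) * (m + 2)) * B k ys)) xs"
    unfolding coboundary_def
  proof (rule cyclic_sum_cong)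
    fix ys :: "'a list" assume "length ys = length xs"
    then obtain x y w where ys: "ys = x # y # w" and w: "length w = m"
      using m obtain_Cons_Cons by metis
    have "merge_first (insertion c) ys = insertion c ((x * y) # w)" using ys by simp
    also have "\<dots> = (\<Sum>r<Suc m. (-1) ^ (r * (m + 2)) * insert_first c (rotate r ((x * y) # w)))"
    proof -
      have l: "length ((x * y) # w) = Suc m" "Suc m + 1 = m + 2"
        using w by simp_all
      show ?thesis unfolding insertion_def cyclic_sum_def l ..
    qed
    also have "\<dots> = Q ys + (\<Sum>k<m. (-1) ^ (Suc k * (m + 2)) * insert_first c (rotate (Suc k) ((x * y) # w)))"
      unfolding sum.lessThan_Suc_shift by (simp add: Q_def ys)
    also have "(\<Sum>k<m. (-1) ^ (Suc k * (m + 2)) * insert_first c (rotate (Suc k) ((x * y) # w)))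
      = (\<Sum>k<m. (-1) ^ ((k + 1) * (m + 2)) * B k ys)"
    proof (rule sum.cong)
      fix k assume "k \<in> {..<m}"
      then show "(-1) ^ (Suc k * (m + 2)) * insert_first c (rotate (Suc k) ((x * y) # w)) = (-1) ^ ((k + 1) * (m + 2)) * B k ys"
        by (subst rotate_Suc_Cons) (simp_all add: w ys B_def)
    qed simp
    finally show "merge_first (insertion c) ys = Q ys + (\<Sum>k<m. (-1) ^ ((k + 1) * (m + 2)) * B k ys)" .
  qed
  also have "\<dots> = cyclic_sum Q xs + (\<Sum>k<m. g k)"
    by (simp only: cyclic_sum_add cyclic_sum_sum cyclic_sum_mult g_def)
  finally have 2: "coboundary (insertion c) xs = cyclic_sum Q xs + (\<Sum>k<m. g k)" .
  have "f k = - g l" if kl: "k + l + 1 = m" for k l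
  proof -
    have "cyclic_sum (B l) xs = cyclic_sum (\<lambda>ys. (-1) ^ ((k + 2) * (l + 1)) * A k (rotate (l + 2) ys)) xs"
    proof (rule cyclic_sum_cong)
      fix ys :: "'a list" assume "length ys = length xs"
      then obtain x y w where ys: "ys = x # y # w" and w: "length w = m"
        using m obtain_Cons_Cons by metis
      define w1 where "w1 = take l w"
      obtain z w2 where d: "drop l w = z # w2" and w2: "length w2 = k"
        using w kl by (cases "drop l w") (auto dest: arg_cong[of _ _ length])
      have w1: "w = w1 @ z # w2" "length w1 = l"
        unfolding d[symmetric] w1_def using kl w by simp_all
      have "rotate (l + 2) ys = z # w2 @ x # y # w1"
        using rotate_append[of "x # y # w1" "z # w2"] by (simp add: ys w1)
      then have "A k (rotate (l + 2) ys) = (\<Sum>i<n. c (x * y # w1 @ p z * e i # e i # w2))"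
        by (simp add: A_def w2)
      moreover have "B l ys = (\<Sum>i<n. c ((p z * e i # e i # w2) @ (x * y # w1)))"
        by (simp add: B_def ys w1)
      moreover have "c ((p z * e i # e i # w2) @ (x * y # w1))
         = (-1) ^ ((k + 2) * (l + 1)) * c (x * y # w1 @ p z * e i # e i # w2)" for i
        unfolding cyclic_cochain_append[OF cy, of "p z * e i # e i # w2"] by (simp add: w1 w2)
      ultimately show "B l ys = (-1) ^ ((k + 2) * (l + 1)) * A k (rotate (l + 2) ys)"
        by (simp only: sum_distrib_left)
    qed
    also have "\<dots> = (-1) ^ ((k + 2) * (l + 1) + (l + 2) * (m + 3)) * cyclic_sum (A k) xs"
    proof -
      have "m + 2 + 1 = m + 3" by simp
      then show ?thesis unfolding cyclic_sum_mult cyclic_sum_rotate m by (simp only: power_add mult.assoc)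
    qed
    finally have "g l = (-1) ^ ((l + 1) * (m + 2) + ((k + 2) * (l + 1) + (l + 2) * (m + 3))) * cyclic_sum (A k) xs"
      by (simp only: g_def power_add mult.assoc)
    also have "(-1 :: 'k) ^ ((l + 1) * (m + 2) + ((k + 2) * (l + 1) + (l + 2) * (m + 3))) = (-1) ^ Suc (k * (m + 2))"
      by (rule minus_one_power_eq) (auto simp flip: kl)
    finally show ?thesis by (simp add: f_def)
  qed
  then have "(\<Sum>k<m. f (m - Suc k)) = (\<Sum>k<m. - g k)"
    by (intro sum.cong refl) auto
  then have 3: "(\<Sum>k<m. f k) = - (\<Sum>k<m. g k)"
    by (simp add: sum.nat_diff_reindex sum_negf)
  have "cyclic_sum (\<lambda>ys. A m (rotate1 ys)) xs = (-1) ^ (m + 3) * cyclic_sum (A m) xs"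
    unfolding cyclic_sum_rotate1 m by (simp add: power_add numeral_eq_Suc)
  moreover have "(-1 :: 'k) ^ (m * (m + 2)) = - ((-1) ^ (m + 3))"
    by (cases "even m") (simp_all del: power_Suc)
  ultimately have "(-1) ^ (m * (m + 2)) * cyclic_sum (A m) xs = - cyclic_sum (\<lambda>ys. A m (rotate1 ys)) xs"
    by simp
  also have "\<dots> = cyclic_sum (\<lambda>ys. - 1 * A m (rotate1 ys)) xs" unfolding cyclic_sum_mult by simp
  finally have 4: "(-1) ^ (m * (m + 2)) * cyclic_sum (A m) xs = cyclic_sum (\<lambda>ys. - 1 * A m (rotate1 ys)) xs" .
  have "cyclic_sum P xs + cyclic_sum (\<lambda>ys. - 1 * A m (rotate1 ys)) xs + cyclic_sum Q xs
     = cyclic_sum (\<lambda>ys. P ys + (- 1 * A m (rotate1 ys)) + Q ys) xs"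
    by (simp only: cyclic_sum_add)
  also have "\<dots> = cyclic_sum (defect_first c) xs"
  proof (rule cyclic_sum_cong)
    fix ys :: "'a list" assume "length ys = length xs"
    then obtain x y w where ys: "ys = x # y # w" and w: "length w = m"
      using m obtain_Cons_Cons by metis
    have "A m (rotate1 ys) = (\<Sum>i<n. c (x * (p y * e i) # e i # w))"
      by (simp add: A_def ys w)
    moreover have "Q ys = (\<Sum>i<n. c (x * (p y * e i) # e i # w)) + (\<Sum>i<n. c (p x * (y - p y) * e i # e i # w))"
      unfolding Q_def ys list.case p_mult distrib_right sum.distrib[symmetric]
      using multilinear_cochain_add[OF ml, of "[]"] by (simp add: mult.assoc)
    moreover have "(\<Sum>i<n. c (p x * (y - p y) * e i # e i # w)) = (\<Sum>i<n. c (p x * e i # e i * y # w)) - (\<Sum>i<n. c (p x * e i # e i * p y # w))"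
      unfolding sum_move_complement[OF ml] sum_subtractf[symmetric]
    proof (intro sum.cong refl)
      fix i
      show "c (p x * e i # e i * (y - p y) # w) = c (p x * e i # e i * y # w) - c (p x * e i # e i * p y # w)"
        using multilinear_cochain_diff[OF ml, of "[p x * e i]" "e i * y" "e i * p y" w]
        by (simp add: right_diff_distrib)
    qed
    ultimately show "P ys + (- 1 * A m (rotate1 ys)) + Q ys = defect_first c ys"
      by (simp add: P_def ys)
  qed
  finally show ?thesis unfolding 1 2 3 4 by (simp add: ac_simps)
qed

end

lemma coboundary_add: "coboundary (\<lambda>xs. c xs + d xs) xs = coboundary c xs + coboundary d xs"
proof -
  have "merge_first (\<lambda>xs. c xs + d xs) = (\<lambda>ys. merge_first c ys + merge_first d ys)"
    by (auto simp: merge_first_def fun_eq_iff split: list.split)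
  then show ?thesis by (simp add: coboundary_def cyclic_sum_add)
qed

lemma coboundary_mult: "coboundary (\<lambda>xs. a * c xs) xs = a * coboundary c xs"
proof -
  have "merge_first (\<lambda>xs. a * c xs) = (\<lambda>ys. a * merge_first c ys)"
    by (auto simp: merge_first_def fun_eq_iff split: list.split)
  then show ?thesis by (simp add: coboundary_def cyclic_sum_mult)
qed

lemma (in algebra_over) multilinear_cochain_plus:
  "multilinear_cochain c \<Longrightarrow> multilinear_cochain d \<Longrightarrow> multilinear_cochain (\<lambda>xs. c xs + d xs)"
  unfolding multilinear_cochain_def by (simp add: algebra_simps)

lemma (in algebra_over) multilinear_cochain_times:
  "multilinear_cochain c \<Longrightarrow> multilinear_cochain (\<lambda>xs. r * c xs)"
  unfolding multilinear_cochain_def by (simp add: algebra_simps)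

lemma cyclic_cochain_times:
  "(\<And>x xs. g (x # xs) = g (xs @ [x])) \<Longrightarrow> cyclic_cochain c \<Longrightarrow> cyclic_cochain (\<lambda>xs. g xs * c xs)"
  unfolding cyclic_cochain_def by (simp add: algebra_simps)

context algebra_with_idempotents begin

definition defect :: "('a list \<Rightarrow> 'k) \<Rightarrow> 'a list \<Rightarrow> 'k" where
  "defect c = cyclic_sum (defect_first c)"

lemma insertion_zero: "insertion (\<lambda>xs. 0) xs = 0"
proof -
  have "insert_first (\<lambda>xs. 0) = (\<lambda>ys. 0)"
    by (auto simp: insert_first_def fun_eq_iff split: list.split)
  then show ?thesis by (simp add: insertion_def cyclic_sum_def)
qed

lemma defect_eq:
  assumes "multilinear_cochain c" "cyclic_cochain c"
  shows "defect c = (\<lambda>xs. coboundary (insertion c) xs + insertion (coboundary c) xs)"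
  using homotopy[OF assms] by (simp add: defect_def fun_eq_iff)

text \<open>The operator \<open>\<beta>\<eta> + \<eta>\<beta>\<close> commutes with \<open>\<beta>\<close> because \<open>\<beta>\<beta> = 0\<close>.\<close>

lemma coboundary_defect:
  assumes c: "multilinear_cochain c" "cyclic_cochain c"
  shows "coboundary (defect c) xs = defect (coboundary c) xs"
proof -
  have "coboundary (coboundary d) = (\<lambda>xs. 0)" if "cyclic_cochain d" for d :: "'a list \<Rightarrow> 'k"
    using coboundary_coboundary[OF that] by (simp add: fun_eq_iff)
  then show ?thesis
    unfolding defect_eq[OF c]
      defect_eq[OF multilinear_cochain_coboundary[OF c(1)] cyclic_cochain_coboundary]
    by (simp add: coboundary_add cyclic_cochain_insertion c insertion_zero)
qed

lemma multilinear_cochain_defect: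
  "multilinear_cochain c \<Longrightarrow> cyclic_cochain c \<Longrightarrow> multilinear_cochain (defect c)"
  by (simp add: defect_eq multilinear_cochain_plus multilinear_cochain_coboundary multilinear_cochain_insertion)

end

section \<open>Bases of idempotents and arrows\<close>

lemma sum_single_support:
  "finite A \<Longrightarrow> x \<in> A \<Longrightarrow> (\<And>y. y \<in> A \<Longrightarrow> y \<noteq> x \<Longrightarrow> f y = 0) \<Longrightarrow> sum f A = f x"
  by (simp add: sum.remove)

lemma (in algebra_over) span_mult:
  assumes "\<And>x y. x \<in> S \<Longrightarrow> y \<in> T \<Longrightarrow> x * y \<in> span U" and "x \<in> span S" "y \<in> span T"
  shows "x * y \<in> span U"
proof -
  have "x * y \<in> span U" if "x \<in> S" for x
    using assms(3)
  proof (induction rule: span_induct_alt)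
    case base then show ?case by (simp add: span_zero)
  next
    case (step k z w)
    then show ?case using assms(1)[OF that step(1)]
      by (simp add: distrib_left scale_mult_right span_add span_scale)
  qed
  with assms(2) show ?thesis
  proof (induction rule: span_induct_alt)
    case base then show ?case by (simp add: span_zero)
  next
    case (step k z w)
    then show ?case by (simp add: distrib_right scale_mult_left span_add span_scale)
  qed
qed

text \<open>The basis elements in \<open>B\<close> are arrows: each lies in one corner and is homogeneous of degree \<open>dg\<close>. The
  potential \<open>ht\<close> grows along arrows of degree zero, which makes the length of a path bounded in terms
  of its degree.\<close>

locale arrow_basis = algebra_over scl
  for scl :: "'k::field_char_0 \<Rightarrow> 'a::{ring, monoid_mult} \<Rightarrow> 'a" +
  fixes n :: nat and e :: "nat \<Rightarrow> 'a" and B :: "'a set"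
    and src tgt dg :: "'a \<Rightarrow> nat" and ht :: "nat \<Rightarrow> nat" and H :: nat
  assumes e_mult: "i < n \<Longrightarrow> j < n \<Longrightarrow> e i * e j = (if i = j then e i else 0)"
    and e_sum: "(\<Sum>i<n. e i) = 1"
    and e_notin_B: "i < n \<Longrightarrow> e i \<notin> B"
    and inj_e: "inj_on e {..<n}"
    and independent_letters: "independent (e ` {..<n} \<union> B)"
    and span_letters: "span (e ` {..<n} \<union> B) = UNIV"
    and src_less: "x \<in> B \<Longrightarrow> src x < n" and tgt_less: "x \<in> B \<Longrightarrow> tgt x < n"
    and e_src: "x \<in> B \<Longrightarrow> e (src x) * x = x" and e_tgt: "x \<in> B \<Longrightarrow> x * e (tgt x) = x"
    and B_mult: "x \<in> B \<Longrightarrow> y \<in> B \<Longrightarrow> tgt x = src y \<Longrightarrow>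
      x * y \<in> span {z \<in> B. src z = src x \<and> tgt z = tgt y \<and> dg z = dg x + dg y}"
    and finite_degree: "finite {z \<in> B. dg z = k}"
    and ht_le: "i < n \<Longrightarrow> ht i \<le> H"
    and ht_less: "x \<in> B \<Longrightarrow> dg x = 0 \<Longrightarrow> ht (src x) < ht (tgt x)"
begin

abbreviation "letters \<equiv> e ` {..<n} \<union> B"

definition deg :: "'a \<Rightarrow> nat" where
  "deg x = (if x \<in> B then dg x else 0)"

definition wdeg :: "'a list \<Rightarrow> nat" where
  "wdeg w = sum_list (map deg w)"

lemma e_mult_B:
  assumes "i < n" "x \<in> B"
  shows "e i * x = (if i = src x then x else 0)"
proof -
  have "e i * x = e i * e (src x) * x" using e_src[OF assms(2)] by (simp add: mult.assoc)
  then show ?thesis using assms e_src by (simp add: e_mult src_less)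
qed

lemma B_mult_e:
  assumes "i < n" "x \<in> B"
  shows "x * e i = (if i = tgt x then x else 0)"
proof -
  have "x * e i = x * (e (tgt x) * e i)" using e_tgt[OF assms(2)] by (simp add: mult.assoc[symmetric])
  then show ?thesis using assms e_tgt by (simp add: e_mult tgt_less)
qed

lemma B_mult_B:
  assumes "x \<in> B" "y \<in> B" "tgt x \<noteq> src y"
  shows "x * y = 0"
proof -
  have "x * y = x * e (src y) * y" using e_src[OF assms(2)] by (simp add: mult.assoc)
  then show ?thesis using assms by (simp add: B_mult_e src_less)
qed

definition rad_proj :: "'a \<Rightarrow> 'a" where
  "rad_proj = (SOME p. Vector_Spaces.linear scl scl p \<and> (\<forall>x\<in>letters. p x = (if x \<in> B then x else 0)))"

lemma linear_rad_proj: "Vector_Spaces.linear scl scl rad_proj"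
  and rad_proj_letter: "x \<in> letters \<Longrightarrow> rad_proj x = (if x \<in> B then x else 0)"
proof -
  interpret pr: vector_space_pair scl scl ..
  have "\<exists>p. Vector_Spaces.linear scl scl p \<and> (\<forall>x\<in>letters. p x = (if x \<in> B then x else 0))"
    by (rule pr.linear_independent_extend[OF independent_letters])
  from someI_ex[OF this] show "Vector_Spaces.linear scl scl rad_proj"
    "x \<in> letters \<Longrightarrow> rad_proj x = (if x \<in> B then x else 0)"
    unfolding rad_proj_def[symmetric] by blast+
qed

lemma rad_proj_linear: "rad_proj (scl k a + b) = scl k (rad_proj a) + rad_proj b"
  and rad_proj_add: "rad_proj (a + b) = rad_proj a + rad_proj b"
  and rad_proj_diff: "rad_proj (a - b) = rad_proj a - rad_proj b"
  and rad_proj_zero: "rad_proj 0 = 0"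
proof -
  interpret p: Vector_Spaces.linear scl scl rad_proj by (rule linear_rad_proj)
  show "rad_proj (scl k a + b) = scl k (rad_proj a) + rad_proj b"
    "rad_proj (a + b) = rad_proj a + rad_proj b" "rad_proj (a - b) = rad_proj a - rad_proj b" "rad_proj 0 = 0"
    by (simp_all add: p.add p.scale p.diff p.zero)
qed

lemma rad_proj_span_B: "x \<in> span B \<Longrightarrow> rad_proj x = x"
  by (induction rule: span_induct_alt) (simp_all add: rad_proj_zero rad_proj_linear rad_proj_letter)

lemma rad_proj_span_e: "x \<in> span (e ` {..<n}) \<Longrightarrow> rad_proj x = 0"
proof (induction rule: span_induct_alt)
  case (step c x y)
  then show ?case using e_notin_B by (auto simp: rad_proj_linear rad_proj_letter)
qed (simp add: rad_proj_zero)

lemma rad_proj_split: "rad_proj y \<in> span B \<and> y - rad_proj y \<in> span (e ` {..<n})"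
proof -
  have "y \<in> span (e ` {..<n} \<union> B)" using span_letters by simp
  then show ?thesis
  proof (induction rule: span_induct_alt)
    case base
    then show ?case by (simp add: rad_proj_zero span_zero)
  next
    case (step c x y)
    have "rad_proj x \<in> span B \<and> x - rad_proj x \<in> span (e ` {..<n})"
      using step(1) by (auto simp: rad_proj_letter span_base span_zero)
    moreover have "scl c x + y - rad_proj (scl c x + y) = scl c (x - rad_proj x) + (y - rad_proj y)"
      by (simp add: rad_proj_linear scale_right_diff_distrib)
    ultimately show ?case using step(2)
      by (simp only: rad_proj_linear) (simp add: span_add span_scale)
  qed
qed

lemma letter_mult_B: "x \<in> letters \<Longrightarrow> y \<in> B \<Longrightarrow> x * y \<in> span B"
proof -
  assume x: "x \<in> letters" and y: "y \<in> B"
  show ?thesis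
  proof (cases "x \<in> B")
    case True
    show ?thesis
    proof (cases "tgt x = src y")
      case match: True
      have "{z \<in> B. src z = src x \<and> tgt z = tgt y \<and> dg z = dg x + dg y} \<subseteq> B" by blast
      then show ?thesis using B_mult[OF True y match] span_mono by blast
    qed (simp add: B_mult_B True y span_zero)
  next
    case False
    then show ?thesis using x y by (auto simp: e_mult_B span_base span_zero)
  qed
qed

lemma rad_proj_mult: "rad_proj (x * y) = x * rad_proj y + rad_proj x * (y - rad_proj y)"
proof -
  let ?s = "\<lambda>x. x - rad_proj x"
  note sp = rad_proj_split[THEN conjunct1] rad_proj_split[THEN conjunct2]
  have 1: "x * rad_proj y \<in> span B"
    by (rule span_mult[where S = letters, OF letter_mult_B _ sp(1)]) (simp_all add: span_letters)
  have 2: "rad_proj x * ?s y \<in> span B"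
    by (rule span_mult[OF _ sp]) (auto simp: B_mult_e span_base span_zero)
  have 3: "?s x * ?s y \<in> span (e ` {..<n})"
    by (rule span_mult[OF _ sp(2) sp(2)]) (auto simp: e_mult span_base span_zero)
  have "x * y = x * rad_proj y + rad_proj x * ?s y + ?s x * ?s y" by (simp add: algebra_simps)
  then show ?thesis
    using rad_proj_span_B[OF 1] rad_proj_span_B[OF 2] rad_proj_span_e[OF 3]
    by (simp only: rad_proj_add) simp
qed

sublocale algebra_with_idempotents scl n e rad_proj
proof unfold_locales
  fix y
  have "y - rad_proj y \<in> span (e ` {..<n})" using rad_proj_split by blast
  then obtain t where "y - rad_proj y = (\<Sum>v\<in>e ` {..<n}. scl (t v) v)"
    using span_finite[of "e ` {..<n}"] by auto
  also have "\<dots> = (\<Sum>i<n. scl (t (e i)) (e i))" by (simp add: sum.reindex[OF inj_e])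
  finally show "\<exists>s. y - rad_proj y = (\<Sum>i<n. scl (s i) (e i))" by (rule exI[of _ "\<lambda>i. t (e i)"])
qed (simp_all add: e_mult e_sum rad_proj_linear rad_proj_mult)

definition coords :: "'a \<Rightarrow> ('a \<Rightarrow> 'k) \<Rightarrow> 'k" where
  "coords x f = (\<Sum>y | representation letters x y \<noteq> 0. representation letters x y * f y)"

lemma finite_coords: "finite {y. representation letters x y \<noteq> 0}"
  by (rule finite_representation)

lemma in_span_letters [simp]: "x \<in> span letters"
  by (simp add: span_letters)

lemma coords_superset:
  assumes "finite S" "{y. representation letters x y \<noteq> 0} \<subseteq> S"
  shows "coords x f = (\<Sum>y\<in>S. representation letters x y * f y)"
  unfolding coords_def by (rule sum.mono_neutral_left) (use assms in auto)

lemma coords_linear: "coords (scl k a + b) f = k * coords a f + coords b f"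
proof -
  let ?S = "{y. representation letters a y \<noteq> 0} \<union> {y. representation letters b y \<noteq> 0}"
  have r: "representation letters (scl k a + b) y = k * representation letters a y + representation letters b y" for y
    by (simp add: representation_add representation_scale independent_letters)
  have "{y. representation letters (scl k a + b) y \<noteq> 0} \<subseteq> ?S" by (auto simp: r)
  then show ?thesis
    by (simp add: coords_superset[of ?S] finite_coords)
      (simp add: r distrib_right sum.distrib sum_distrib_left mult.assoc)
qed

lemma coords_letter: "x \<in> letters \<Longrightarrow> coords x f = f x"
  unfolding coords_def
  by (subst sum_single_support[of _ x])
    (auto simp: representation_basis independent_letters simp del: Un_iff split: if_splits)

lemma coords_cong:
  "(\<And>y. y \<in> letters \<Longrightarrow> f y = g y) \<Longrightarrow> coords x f = coords x g"
  unfolding coords_def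
  by (intro sum.cong refl) (use representation_ne_zero[of letters x] in auto)

lemma coords_mult_right: "coords x (\<lambda>y. a * f y) = a * coords x f"
  by (simp add: coords_def sum_distrib_left algebra_simps)

lemma coords_sum_right: "coords x (\<lambda>y. \<Sum>i\<in>A. f i y) = (\<Sum>i\<in>A. coords x (f i))"
  unfolding coords_def by (simp add: sum_distrib_left) (rule sum.swap)

lemma coords_swap: "coords x (\<lambda>y. coords z (\<lambda>u. f y u)) = coords z (\<lambda>u. coords x (\<lambda>y. f y u))"
  unfolding coords_def by (simp add: sum_distrib_left algebra_simps) (rule sum.swap)

lemma coords_degree_cong:
  assumes x: "x \<in> span {z \<in> letters. deg z = d}" and fg: "\<And>y. y \<in> letters \<Longrightarrow> deg y = d \<Longrightarrow> f y = g y"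
  shows "coords x f = coords x g"
  using x
proof (induction rule: span_induct_alt)
  case base
  then show ?case using coords_linear[of 0 0 0] by (simp add: coords_def representation_zero)
next
  case (step c x y)
  then show ?case using fg by (auto simp: coords_linear coords_letter simp del: Un_iff)
qed

lemma multilinear_cochain_coords:
  assumes "multilinear_cochain c"
  shows "c (xs @ x # ys) = coords x (\<lambda>y. c (xs @ y # ys))"
proof -
  have "x \<in> span letters" by simp
  then show ?thesis
  proof (induction rule: span_induct_alt)
    case base
    then show ?case by (simp add: multilinear_cochain_zero[OF assms] coords_def representation_zero)
  next
    case (step c x y)
    then show ?case by (simp add: coords_linear coords_letter multilinear_cochainD[OF assms] del: Un_iff)
  qed
qed

text \<open>Multilinear cochains are determined by arbitrary values on words of basis elements; \<open>extend\<close> is the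
  multilinear extension of such values.\<close>

primrec extend :: "'a list \<Rightarrow> ('a list \<Rightarrow> 'k) \<Rightarrow> 'k" where
  "extend [] c = c []"
| "extend (x # xs) c = coords x (\<lambda>y. extend xs (\<lambda>ys. c (y # ys)))"

lemma extend_word: "set w \<subseteq> letters \<Longrightarrow> extend w c = c w"
  by (induction w arbitrary: c) (simp_all add: coords_letter del: Un_iff)

lemma extend_cong:
  "(\<And>w. length w = length xs \<Longrightarrow> set w \<subseteq> letters \<Longrightarrow> c w = c' w) \<Longrightarrow> extend xs c = extend xs c'"
proof (induction xs arbitrary: c c')
  case (Cons x xs)
  show ?case unfolding extend.simps
    by (intro coords_cong Cons.IH Cons.prems) auto
qed simp

lemma extend_degree_cong:
  assumes "list_all2 (\<lambda>x d. x \<in> span {z \<in> letters. deg z = d}) xs ds"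
    and "\<And>w. length w = length xs \<Longrightarrow> set w \<subseteq> letters \<Longrightarrow> wdeg w = sum_list ds \<Longrightarrow> c w = c' w"
  shows "extend xs c = extend xs c'"
  using assms
proof (induction arbitrary: c c' rule: list_all2_induct)
  case Nil
  then show ?case by (simp add: wdeg_def)
next
  case (Cons x xs d ds)
  show ?case unfolding extend.simps
    by (intro coords_degree_cong[OF Cons(1)] Cons.IH Cons.prems) (auto simp: wdeg_def)
qed

lemma extend_mult_right: "extend xs (\<lambda>w. a * c w) = a * extend xs c"
  by (induction xs arbitrary: c) (simp_all add: coords_mult_right)

lemma extend_sum_right: "extend xs (\<lambda>w. \<Sum>i\<in>A. c i w) = (\<Sum>i\<in>A. extend xs (c i))"
  by (induction xs arbitrary: c) (simp_all add: coords_sum_right)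

lemma multilinear_cochain_extend: "multilinear_cochain (\<lambda>xs. extend xs c)"
  unfolding multilinear_cochain_def
proof (intro allI)
  fix xs ys k a b
  show "extend (xs @ (scl k a + b) # ys) c = k * extend (xs @ a # ys) c + extend (xs @ b # ys) c"
  proof (induction xs arbitrary: c)
    case (Cons x xs)
    then show ?case by (simp add: coords_def algebra_simps sum.distrib sum_distrib_left)
  qed (simp add: coords_linear)
qed

lemma multilinear_cochain_eq_extend: "multilinear_cochain c \<Longrightarrow> c xs = extend xs c"
proof (induction xs arbitrary: c)
  case (Cons x xs)
  have "multilinear_cochain (\<lambda>ys. c (y # ys))" for y
    unfolding multilinear_cochain_def
    using multilinear_cochainD[OF Cons.prems, of "y # _"] by simp
  then have "extend (x # xs) c = coords x (\<lambda>y. c (y # xs))"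
    unfolding extend.simps using Cons.IH by (intro coords_cong) metis
  then show ?case using multilinear_cochain_coords[OF Cons.prems, of "[]" x xs] by simp
qed simp

lemma multilinear_cochain_eqI:
  assumes "multilinear_cochain c" "multilinear_cochain c'"
    and "\<And>w. set w \<subseteq> letters \<Longrightarrow> c w = c' w"
  shows "c = c'"
  using assms multilinear_cochain_eq_extend extend_cong by (metis ext)

lemma extend_append1: "extend (xs @ [x]) c = coords x (\<lambda>y. extend xs (\<lambda>ys. c (ys @ [y])))"
  by (induction xs arbitrary: c) (simp_all add: coords_swap[of x])

lemma cyclic_cochain_extend:
  assumes "cyclic_cochain c"
  shows "cyclic_cochain (\<lambda>xs. extend xs c)"
  unfolding cyclic_cochain_def
proof (intro allI)
  fix x xs
  have "extend (x # xs) c = coords x (\<lambda>y. extend xs (\<lambda>ys. (-1) ^ length xs * c (ys @ [y])))"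
    unfolding extend.simps using assms
    by (intro coords_cong extend_cong) (simp add: cyclic_cochain_def)
  then show "extend (x # xs) c = (-1) ^ length xs * extend (xs @ [x]) c"
    by (simp add: extend_append1 extend_mult_right coords_mult_right)
qed

lemma letter_mult_degree:
  assumes "x \<in> letters" "y \<in> letters"
  shows "x * y \<in> span {z \<in> letters. deg z = deg x + deg y}"
proof (cases "x \<in> B")
  case xB: True
  show ?thesis
  proof (cases "y \<in> B")
    case yB: True
    show ?thesis
    proof (cases "tgt x = src y")
      case True
      have "{z \<in> B. src z = src x \<and> tgt z = tgt y \<and> dg z = dg x + dg y} \<subseteq> {z \<in> letters. deg z = deg x + deg y}"
        using xB yB by (auto simp: deg_def)
      then show ?thesis using B_mult[OF xB yB True] span_mono by blast
    qed (simp add: B_mult_B xB yB span_zero)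
  next
    case False
    then obtain i where "i < n" "y = e i" using assms(2) by auto
    then show ?thesis using False xB
      by (cases "i = tgt x") (auto simp: B_mult_e deg_def span_zero span_base)
  qed
next
  case False
  then obtain i where i: "i < n" "x = e i" using assms(1) by auto
  show ?thesis
  proof (cases "y \<in> B")
    case True
    then show ?thesis using i False
      by (cases "i = src y") (auto simp: e_mult_B deg_def span_zero span_base)
  next
    case yB: False
    then obtain j where "j < n" "y = e j" using assms(2) by auto
    then show ?thesis using i False e_notin_B
      by (cases "i = j") (auto simp: e_mult deg_def span_zero span_base)
  qed
qed

lemma wdeg_rotate [simp]: "wdeg (rotate r w) = wdeg w"
proof -
  have "sum_list (rotate r xs) = sum_list xs" for xs :: "nat list"
  proof -
    have "mset (rotate r xs) = mset xs"
      by (simp add: rotate_drop_take union_commute flip: mset_append)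
        (metis append_take_drop_id mset_append union_commute)
    then show ?thesis by (metis sum_mset_sum_list)
  qed
  then show ?thesis by (simp add: wdeg_def rotate_map[symmetric])
qed

lemma wdeg_rotate1 [simp]: "wdeg (rotate1 w) = wdeg w"
  using wdeg_rotate[of 1 w] by simp

lemma wdeg_simps: "wdeg [] = 0" "wdeg (x # w) = deg x + wdeg w" "wdeg (u @ v) = wdeg u + wdeg v"
  by (simp_all add: wdeg_def)

lemma letter_span_degree: "x \<in> letters \<Longrightarrow> x \<in> span {z \<in> letters. deg z = deg x}"
  by (intro span_base) auto

text \<open>Multiplication respects degrees, so a value of the coboundary on a word only involves values of the
  cochain on words of the same total degree.\<close>

lemma coboundary_degree_cong:
  assumes c: "multilinear_cochain c" "multilinear_cochain c'" and w: "set w \<subseteq> letters"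
    and eq: "\<And>u. set u \<subseteq> letters \<Longrightarrow> wdeg u = wdeg w \<Longrightarrow> c u = c' u"
  shows "coboundary c w = coboundary c' w"
  unfolding coboundary_def cyclic_sum_def
proof (intro sum.cong refl arg_cong2[of _ _ _ _ "(*)"])
  fix r
  show "merge_first c (rotate r w) = merge_first c' (rotate r w)"
  proof (cases "\<exists>x y v. rotate r w = x # y # v")
    case False
    then show ?thesis by (auto simp: merge_first_def split: list.split)
  next
    case True
    then obtain x y v where r: "rotate r w = x # y # v" by blast
    have "wdeg (x # y # v) = wdeg w" "set (x # y # v) = set w" unfolding r[symmetric] by simp_all
    then have d: "deg x + deg y + wdeg v = wdeg w" and l: "x \<in> letters" "y \<in> letters" "set v \<subseteq> letters"
      using w by (auto simp: wdeg_simps)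
    have "list_all2 (\<lambda>x d. x \<in> span {z \<in> letters. deg z = d}) v (map deg v)"
      unfolding list_all2_conv_all_nth using letter_span_degree[OF subsetD[OF l(3) nth_mem]] by simp
    then have "list_all2 (\<lambda>x d. x \<in> span {z \<in> letters. deg z = d}) (x * y # v) ((deg x + deg y) # map deg v)"
      using letter_mult_degree[OF l(1,2)] by simp
    then have "extend (x * y # v) c = extend (x * y # v) c'"
      by (rule extend_degree_cong) (intro eq, simp_all add: wdeg_def d[unfolded wdeg_def])
    then show ?thesis unfolding r merge_first_simps
      by (simp only: multilinear_cochain_eq_extend[OF c(1), symmetric] multilinear_cochain_eq_extend[OF c(2), symmetric])
  qed
qed

section \<open>Closed paths\<close>

text \<open>The number of arrows whose cyclic successor is not composable with them is invariant under rotation;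
  it will be the eigenvalue of \<open>defect\<close>.\<close>

definition bad_start :: "'a list \<Rightarrow> bool" where
  "bad_start ys \<longleftrightarrow> hd ys \<in> B \<and> \<not> (hd (rotate1 ys) \<in> B \<and> tgt (hd ys) = src (hd (rotate1 ys)))"

definition bad :: "'a list \<Rightarrow> nat" where
  "bad w = (\<Sum>r<length w. if bad_start (rotate r w) then 1 else 0)"

primrec path :: "nat \<Rightarrow> 'a list \<Rightarrow> nat \<Rightarrow> bool" where
  "path i [] j \<longleftrightarrow> i = j"
| "path i (x # xs) j \<longleftrightarrow> x \<in> B \<and> src x = i \<and> path (tgt x) xs j"

definition closed_path :: "'a list \<Rightarrow> bool" where
  "closed_path w \<longleftrightarrow> w \<noteq> [] \<and> (\<exists>i. path i w i)"

lemma path_append: "path i (u @ v) j \<longleftrightarrow> (\<exists>k. path i u k \<and> path k v j)"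
  by (induction u arbitrary: i) auto

lemma path_set: "path i w j \<Longrightarrow> set w \<subseteq> B"
  by (induction w arbitrary: i) auto

lemma closed_path_append_commute: "closed_path (u @ v) \<Longrightarrow> closed_path (v @ u)"
  by (auto simp: closed_path_def path_append)

lemma closed_path_rotate [simp]: "closed_path (rotate r w) \<longleftrightarrow> closed_path w"
proof -
  have *: "closed_path (rotate1 w) \<longleftrightarrow> closed_path w" for w
  proof (cases w)
    case (Cons x xs)
    then show ?thesis
      using closed_path_append_commute[of "[x]" xs] closed_path_append_commute[of xs "[x]"] by auto
  qed simp
  show ?thesis by (induction r) (simp_all add: *)
qed

lemma bad_rotate1: "bad (rotate1 w) = bad w"
proof -
  let ?f = "\<lambda>r. if bad_start (rotate r w) then 1 else 0 :: nat"
  have "bad (rotate1 w) = (\<Sum>r<length w. ?f (Suc r))"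
    by (simp add: bad_def rotate1_rotate_swap)
  also have "\<dots> + ?f 0 = (\<Sum>r<length w. ?f r) + ?f (length w)"
    using sum.lessThan_Suc_shift[of ?f "length w"] by simp
  finally show ?thesis by (simp add: bad_def)
qed

lemma bad_Cons: "bad (x # xs) = bad (xs @ [x])"
  using bad_rotate1[of "x # xs"] by simp

lemma wdeg_Cons: "wdeg (x # xs) = wdeg (xs @ [x])"
  by (simp add: wdeg_simps)

lemma closed_path_not_bad_start:
  assumes "closed_path w"
  shows "\<not> bad_start w"
proof -
  obtain x xs where w: "w = x # xs" using assms by (cases w) (auto simp: closed_path_def)
  then show ?thesis using assms
    by (cases xs) (auto simp: closed_path_def bad_start_def)
qed

lemma closed_path_bad: "closed_path w \<Longrightarrow> bad w = 0"
  by (simp add: bad_def closed_path_not_bad_start)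

lemma bad_eq_0D:
  assumes "bad w = 0" "w \<noteq> []"
  shows "\<not> bad_start (rotate r w)"
proof -
  have "\<not> bad_start (rotate (r mod length w) w)"
    using assms by (auto simp: bad_def split: if_splits)
  then show ?thesis by (metis rotate_conv_mod)
qed

lemma path_nth:
  assumes "w \<noteq> []" "set w \<subseteq> B" "\<And>k. Suc k < length w \<Longrightarrow> tgt (w ! k) = src (w ! Suc k)"
  shows "path (src (hd w)) w (tgt (last w))"
  using assms
proof (induction w rule: list_nonempty_induct)
  case (cons x xs)
  have "path (src (hd xs)) xs (tgt (last xs))"
    using cons.prems(1) cons.prems(2)[of "Suc _"] by (intro cons.IH) auto
  moreover have "tgt x = src (hd xs)" using cons.prems(2)[of 0] cons.hyps by (simp add: hd_conv_nth)
  ultimately show ?case using cons by simp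
qed simp

text \<open>A nonzero degree forces at least one arrow into the word. Its successor must be a composable arrow,
  and so on around the circle. Without it, the word could consist of idempotents only.\<close>

lemma bad_eq_0_imp_closed_path:
  assumes w: "set w \<subseteq> letters" "wdeg w \<noteq> 0" and bad: "bad w = 0"
  shows "closed_path w"
proof -
  have ne: "w \<noteq> []" using w by (auto simp: wdeg_def)
  note nb = bad_eq_0D[OF bad ne]
  obtain y where y: "y \<in> set w" "deg y \<noteq> 0" using w(2) by (auto simp: wdeg_def sum_list_eq_0_iff)
  then obtain r0 where r0: "r0 < length w" "w ! r0 = y" by (auto simp: in_set_conv_nth)
  have hd_rot: "hd (rotate r w) = w ! (r mod length w)" for r by (rule hd_rotate_conv_nth[OF ne])
  have B0: "hd (rotate (r0 + k) w) \<in> B" for k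
  proof (induction k)
    case 0
    then show ?case using r0 y by (auto simp: hd_rot deg_def split: if_splits)
  next
    case (Suc k)
    then show ?case using nb[of "r0 + k"] by (auto simp: bad_start_def)
  qed
  have inB: "w ! j \<in> B" if "j < length w" for j
  proof -
    have "(r0 + (length w - r0 + j)) mod length w = j" using r0 that by simp
    then show ?thesis using B0[of "length w - r0 + j"] hd_rot by metis
  qed
  have adj: "tgt (w ! (r mod length w)) = src (w ! (Suc r mod length w))" for r
  proof -
    have "hd (rotate r w) \<in> B" using inB ne by (simp add: hd_rot)
    then show ?thesis using nb[of r] hd_rot[of r] hd_rot[of "Suc r"] by (auto simp: bad_start_def)
  qed
  have "path (src (hd w)) w (tgt (last w))"
  proof (rule path_nth[OF ne])
    show "set w \<subseteq> B" using inB by (auto simp: in_set_conv_nth)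
    fix k assume "Suc k < length w"
    then show "tgt (w ! k) = src (w ! Suc k)" using adj[of k] by simp
  qed
  moreover have "tgt (last w) = src (hd w)"
    using adj[of "length w - 1"] ne by (simp add: last_conv_nth hd_conv_nth)
  ultimately show ?thesis using ne by (auto simp: closed_path_def)
qed

text \<open>Each arrow either has positive degree, which is charged \<open>H + 1\<close>, or raises the potential by at least
  one; an arrow of positive degree lowers the potential by at most \<open>H\<close>.\<close>

lemma path_length_le:
  "path i w j \<Longrightarrow> i < n \<Longrightarrow> length w + ht i \<le> ht j + (H + 1) * wdeg w"
proof (induction w arbitrary: i)
  case (Cons x w)
  then have x: "x \<in> B" "src x = i" and p: "path (tgt x) w j" by auto
  have IH: "length w + ht (tgt x) \<le> ht j + (H + 1) * wdeg w"
    using Cons.IH[OF p] tgt_less x by blast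
  have "1 + ht i \<le> ht (tgt x) + (H + 1) * deg x"
  proof (cases "dg x = 0")
    case True
    then show ?thesis using ht_less[OF x(1)] x by simp
  next
    case False
    then have "(H + 1) * 1 \<le> (H + 1) * deg x" using x by (intro mult_le_mono2) (simp add: deg_def)
    then show ?thesis using ht_le[OF Cons.prems(2)] by simp
  qed
  then show ?case using IH by (simp add: wdeg_simps algebra_simps)
qed simp

lemma closed_path_length_le: "closed_path w \<Longrightarrow> length w \<le> (H + 1) * wdeg w"
proof -
  assume "closed_path w"
  then obtain i x xs where "path i w i" "w = x # xs" by (cases w) (auto simp: closed_path_def)
  then show ?thesis using path_length_le[of i w i] src_less by auto
qed

section \<open>Diagonal operators\<close>

lemma defect_first_word:
  assumes c: "multilinear_cochain c" and w: "set ys \<subseteq> letters" "ys \<noteq> []"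
  shows "defect_first c ys = (if bad_start ys then c ys else 0)"
proof -
  note c0 = multilinear_cochain_zero[OF c]
  obtain x v where ys: "ys = x # v" using w by (cases ys) auto
  have x: "x \<in> letters" using w ys by simp
  show ?thesis
  proof (cases v)
    case Nil
    show ?thesis
    proof (cases "x \<in> B")
      case False
      then show ?thesis using x c0[of "[]" "[]"]
        by (simp add: ys Nil rad_proj_letter bad_start_def)
    next
      case True
      have "(\<Sum>i<n. c [e i * (x * e i)]) = c [e (tgt x) * (x * e (tgt x))]"
        using True tgt_less c0[of "[]" "[]"] by (intro sum_single_support) (auto simp: B_mult_e)
      also have "\<dots> = (if tgt x = src x then c [x] else 0)"
        using True tgt_less c0[of "[]" "[]"] by (simp add: B_mult_e e_mult_B)
      finally show ?thesis using True by (simp add: ys Nil rad_proj_letter bad_start_def)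
    qed
  next
    case (Cons y u)
    have y: "y \<in> letters" using w ys Cons by simp
    show ?thesis
    proof (cases "x \<in> B")
      case False
      then show ?thesis using x c0[of "[]"]
        by (simp add: ys Cons rad_proj_letter bad_start_def)
    next
      case True
      have "(\<Sum>i<n. c (x * e i # e i * rad_proj y # u)) = c (x * e (tgt x) # e (tgt x) * rad_proj y # u)"
        using True tgt_less c0[of "[]"] by (intro sum_single_support) (auto simp: B_mult_e)
      also have "\<dots> = (if y \<in> B \<and> tgt x = src y then c (x # y # u) else 0)"
        using True y tgt_less c0[of "[x]" u] by (cases "y \<in> B") (auto simp: e_tgt e_mult_B rad_proj_letter e_src)
      finally show ?thesis using True by (simp add: ys Cons rad_proj_letter bad_start_def)
    qed
  qed
qed

text \<open>Comparing a letter \<open>x\<close> and its successor \<open>y\<close> with \<open>\<Sum>\<^sub>i p(x) e\<^sub>i \<otimes> e\<^sub>i p(y)\<close> gives zero exactly when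
  \<open>x\<close> is no arrow or both are arrows and composable; otherwise the second term vanishes and the word is
  reproduced.\<close>

lemma defect_word:
  assumes c: "multilinear_cochain c" "cyclic_cochain c" and w: "set w \<subseteq> letters"
  shows "defect c w = of_nat (bad w) * c w"
proof (cases "w = []")
  case False
  have "defect c w = (\<Sum>r<length w. if bad_start (rotate r w) then c w else 0)"
    unfolding defect_def cyclic_sum_def
  proof (intro sum.cong refl)
    fix r
    have "(-1) ^ (r * (length w + 1)) * c (rotate r w) = c w"
      by (simp add: cyclic_cochain_rotate[OF c(2) False] mult.assoc[symmetric] power_mult_distrib[symmetric])
    then show "(-1) ^ (r * (length w + 1)) * defect_first c (rotate r w) = (if bad_start (rotate r w) then c w else 0)"
      using defect_first_word[OF c(1), of "rotate r w"] w False by (simp del: Un_iff)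
  qed
  also have "\<dots> = of_nat (bad w) * c w"
    unfolding bad_def of_nat_sum sum_distrib_right by (intro sum.cong) auto
  finally show ?thesis .
qed (simp add: defect_def cyclic_sum_def bad_def)

text \<open>Operators that multiply the value on a word of basis elements by a function of its number of bad
  positions and its degree.\<close>

definition diag :: "(nat \<Rightarrow> nat \<Rightarrow> 'k) \<Rightarrow> ('a list \<Rightarrow> 'k) \<Rightarrow> 'a list \<Rightarrow> 'k" where
  "diag g c xs = extend xs (\<lambda>w. g (bad w) (wdeg w) * c w)"

lemma multilinear_cochain_diag: "multilinear_cochain (diag g c)"
  unfolding diag_def[abs_def] by (rule multilinear_cochain_extend)

lemma cyclic_cochain_diag: "cyclic_cochain c \<Longrightarrow> cyclic_cochain (diag g c)"
  unfolding diag_def[abs_def]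
  by (intro cyclic_cochain_extend cyclic_cochain_times) (simp_all only: bad_Cons wdeg_Cons)

lemma diag_word: "set w \<subseteq> letters \<Longrightarrow> diag g c w = g (bad w) (wdeg w) * c w"
  by (simp add: diag_def extend_word)

text \<open>The coboundary commutes with \<open>defect\<close> and preserves degrees, hence it preserves the number \<open>a\<close> of bad
  positions. The reason is the identity \<open>g(b) - g(a) = (b - a) q(b)\<close>; applied to \<open>defect\<close>
  it writes \<open>diag g c - g(a) c\<close> as \<open>defect - a\<close> of a cochain, whose coboundary vanishes at words with
  \<open>a\<close> bad positions. Characteristic zero is what makes the quotient \<open>q\<close> available.\<close>

lemma coboundary_diag_word:
  assumes c: "multilinear_cochain c" "cyclic_cochain c" and w: "set w \<subseteq> letters"
  shows "coboundary (diag g c) w = g (bad w) (wdeg w) * coboundary c w"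
proof -
  define a where "a = bad w"
  define k where "k = wdeg w"
  define q where "q b d = (g b d - g a d) / (of_nat b - of_nat a)" for b d
  define c' where "c' = diag q c"
  have c': "multilinear_cochain c'" "cyclic_cochain c'"
    using c by (simp_all add: c'_def multilinear_cochain_diag cyclic_cochain_diag)
  have "coboundary (defect c') w = of_nat a * coboundary c' w"
    unfolding coboundary_defect[OF c'] a_def
    by (rule defect_word[OF multilinear_cochain_coboundary[OF c'(1)] cyclic_cochain_coboundary w])
  then have "0 = coboundary (\<lambda>u. defect c' u + (- of_nat a) * c' u) w"
    by (simp only: coboundary_add coboundary_mult) simp
  also have "\<dots> = coboundary (\<lambda>u. diag g c u + (- g a k) * c u) w"
  proof (rule coboundary_degree_cong[OF _ _ w])
    show "multilinear_cochain (\<lambda>u. defect c' u + (- of_nat a) * c' u)"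
      "multilinear_cochain (\<lambda>u. diag g c u + (- g a k) * c u)"
      by (intro multilinear_cochain_plus multilinear_cochain_times multilinear_cochain_defect c' c multilinear_cochain_diag)+
    fix u assume u: "set u \<subseteq> letters" "wdeg u = wdeg w"
    show "defect c' u + (- of_nat a) * c' u = diag g c u + (- g a k) * c u"
    proof -
      have "c' u = q (bad u) k * c u" unfolding c'_def diag_word[OF u(1)] u(2) k_def ..
      then show ?thesis
        unfolding defect_word[OF c' u(1)] diag_word[OF u(1)] u(2) k_def[symmetric] q_def
        by (cases "bad u = a") (simp_all add: field_simps)
    qed
  qed
  finally show ?thesis by (simp only: coboundary_add coboundary_mult a_def k_def) simp
qed

lemma coboundary_diag:
  assumes c: "multilinear_cochain c" "cyclic_cochain c"
  shows "coboundary (diag g c) = diag g (coboundary c)"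
  using c by (intro multilinear_cochain_eqI multilinear_cochain_coboundary multilinear_cochain_diag)
    (simp add: coboundary_diag_word diag_word)

end

section \<open>Dimensions of quotients, kernels and images of projections\<close>

context vector_space begin

lemma independentI_sum:
  assumes "\<And>T u. finite T \<Longrightarrow> T \<subseteq> S \<Longrightarrow> (\<Sum>v\<in>T. scale (u v) v) = 0 \<Longrightarrow> \<forall>v\<in>T. u v = 0"
  shows "independent S"
  using assms unfolding dependent_explicit by blast

end

context vector_space_pair begin

lemma rank_nullity_subspace:
  assumes f: "Vector_Spaces.linear s1 s2 f" and W: "vs1.subspace W" "W \<subseteq> vs1.span S" "finite S"
  shows "vs1.dim {u \<in> W. f u = 0} + vs2.dim (f ` W) = vs1.dim W"
proof -
  interpret f: Vector_Spaces.linear s1 s2 f by fact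
  let ?K = "{u \<in> W. f u = 0}"
  have K: "vs1.subspace ?K"
    using W(1) by (auto simp: vs1.subspace_def f.add f.scale f.zero)
  obtain A where A: "A \<subseteq> ?K" "vs1.independent A" "?K \<subseteq> vs1.span A" "card A = vs1.dim ?K"
    by (rule vs1.basis_exists[of ?K])
  have "A \<subseteq> W" using A(1) by blast
  then obtain C where C: "A \<subseteq> C" "C \<subseteq> W" "vs1.independent C" "W \<subseteq> vs1.span C"
    using vs1.maximal_independent_subset_extend[OF _ A(2)] by metis
  have fin: "finite C" using vs1.independent_span_bound[OF W(3) C(3)] C(2) W(2) by blast
  let ?T = "C - A"
  have inj0: "\<forall>v\<in>T. u v = 0" if T: "finite T" "T \<subseteq> ?T" and s: "(\<Sum>v\<in>T. s2 (u v) (f v)) = 0" for T u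
  proof -
    let ?x = "\<Sum>v\<in>T. s1 (u v) v"
    have "?x \<in> W" using T C(2) W(1) by (intro vs1.subspace_sum vs1.subspace_scale) auto
    moreover have "f ?x = 0" using s by (simp add: f.sum f.scale)
    ultimately have "?x \<in> vs1.span A" using A(3) by blast
    then obtain r where r: "?x = (\<Sum>a\<in>A. s1 (r a) a)"
      using vs1.span_finite[of A] fin C(1) finite_subset by blast
    define q where "q v = (if v \<in> T then u v else - r v)" for v
    have dis: "T \<inter> A = {}" "finite A" using T fin C(1) finite_subset by blast+
    have "(\<Sum>v\<in>T \<union> A. s1 (q v) v) = (\<Sum>v\<in>T. s1 (q v) v) + (\<Sum>v\<in>A. s1 (q v) v)"
      using T(1) dis by (intro sum.union_disjoint) auto
    also have "(\<Sum>v\<in>T. s1 (q v) v) = ?x" by (intro sum.cong) (simp_all add: q_def)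
    also have "(\<Sum>v\<in>A. s1 (q v) v) = (\<Sum>v\<in>A. - s1 (r v) v)"
      using dis by (intro sum.cong) (auto simp: q_def)
    finally have "(\<Sum>v\<in>T \<union> A. s1 (q v) v) = 0" by (simp add: r sum_negf)
    moreover have "finite (T \<union> A)" "T \<union> A \<subseteq> C" using T dis C(1) by auto
    ultimately have "\<forall>v\<in>T \<union> A. q v = 0"
      using C(3) unfolding vs1.dependent_explicit by blast
    then show ?thesis by (metis UnI1 q_def)
  qed
  have inj: "inj_on f ?T"
  proof (rule inj_onI, rule ccontr)
    fix x y assume xy: "x \<in> ?T" "y \<in> ?T" "f x = f y" "x \<noteq> y"
    then have "\<forall>v\<in>{x, y}. (if v = x then 1 else - 1 :: 'a) = 0"
      by (intro inj0) auto
    then show False by simp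
  qed
  have ind: "vs2.independent (f ` ?T)"
  proof (rule vs2.independentI_sum)
    fix T u assume T: "finite T" "T \<subseteq> f ` ?T" "(\<Sum>v\<in>T. s2 (u v) v) = 0"
    then obtain T' where T': "T' \<subseteq> ?T" "finite T'" "T = f ` T'" by (meson finite_subset_image)
    have "(\<Sum>v\<in>T'. s2 (u (f v)) (f v)) = 0"
      using T(3) inj_on_subset[OF inj T'(1)] unfolding T'(3) by (simp add: sum.reindex)
    then show "\<forall>v\<in>T. u v = 0" using inj0[of T' "\<lambda>v. u (f v)"] T' by auto
  qed
  have "f ` W \<subseteq> vs2.span (f ` ?T)"
  proof -
    have "f ` C \<subseteq> vs2.span (f ` ?T)"
    proof
      fix y assume "y \<in> f ` C"
      then obtain x where "x \<in> C" "y = f x" by blast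
      then show "y \<in> vs2.span (f ` ?T)"
        using A(1) by (cases "x \<in> A") (auto simp: vs2.span_zero intro: vs2.span_base)
    qed
    then have "vs2.span (f ` C) \<subseteq> vs2.span (f ` ?T)"
      by (simp add: vs2.span_minimal)
    moreover have "f ` W \<subseteq> f ` vs1.span C" using C(4) by blast
    ultimately show ?thesis by (simp add: f.span_image)
  qed
  moreover have "f ` ?T \<subseteq> f ` W" using C(2) by blast
  ultimately have "vs2.dim (f ` W) = card (f ` ?T)"
    using ind by (metis vs2.basis_card_eq_dim)
  moreover have "vs1.dim W = card C" using C by (metis vs1.basis_card_eq_dim)
  moreover have "card C = card A + card ?T"
    using fin C(1) by (metis card_Diff_subset card_mono finite_subset le_add_diff_inverse)
  ultimately show ?thesis using A(4) by (simp add: card_image[OF inj])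
qed

text \<open>The map \<open>f\<close> induces an isomorphism from \<open>V / D\<close> onto \<open>f V / B\<close>. The space \<open>V\<close> itself may have
  infinite dimension; only its image is assumed to be finite dimensional.\<close>

lemma quotient_dim_eq_image:
  assumes f: "Vector_Spaces.linear s1 s2 f" and V: "vs1.subspace V" and D: "vs1.subspace D"
    and S: "f ` V \<subseteq> vs2.span S" "finite S"
    and B: "vs2.subspace B" "B \<subseteq> f ` V" and D_iff: "\<And>z. z \<in> V \<Longrightarrow> z \<in> D \<longleftrightarrow> f z \<in> B"
  shows "vs1.quotient_fin_dim V D" "vs1.quotient_dim V D + vs2.dim B = vs2.dim (f ` V)"
proof -
  interpret f: Vector_Spaces.linear s1 s2 f by fact
  have Z: "vs2.subspace (f ` V)" by (rule f.subspace_image[OF V])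
  obtain A where A: "A \<subseteq> B" "vs2.independent A" "B \<subseteq> vs2.span A" "card A = vs2.dim B"
    by (rule vs2.basis_exists[of B])
  have spA: "vs2.span A = B" using vs2.span_minimal[OF A(1) B(1)] A(3) by (rule subset_antisym)
  have finA: "finite A"
    using vs2.independent_span_bound[OF S(2) A(2)] A(1) B(2) S(1) by blast
  have "A \<subseteq> f ` V" using A(1) B(2) by blast
  then obtain C where C: "A \<subseteq> C" "C \<subseteq> f ` V" "vs2.independent C" "f ` V \<subseteq> vs2.span C"
    using vs2.maximal_independent_subset_extend[OF _ A(2)] by metis
  have finC: "finite C" using vs2.independent_span_bound[OF S(2) C(3)] C(2) S(1) by blast
  have V_sum: "(\<Sum>v\<in>T. s1 (u v) v) \<in> V" if "T \<subseteq> V" for T u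
    using that V by (intro vs1.subspace_sum vs1.subspace_scale) auto
  define g where "g = inv_into V f"
  have g: "g y \<in> V" "f (g y) = y" if "y \<in> C" for y
    using that C(2) unfolding g_def by (auto intro: inv_into_into f_inv_into_f)
  let ?S = "g ` (C - A)"
  have inj_g: "inj_on g (C - A)" using g(2) by (metis DiffD1 inj_onI)
  have qb: "vs1.quotient_basis V D ?S"
    unfolding vs1.quotient_basis_def
  proof (intro conjI allI impI)
    show "?S \<subseteq> V" using g by auto
    show "V \<subseteq> vs1.span (?S \<union> D)"
    proof
      fix z assume z: "z \<in> V"
      then have "f z \<in> vs2.span C" using C(4) by blast
      then obtain r where r: "f z = (\<Sum>y\<in>C. s2 (r y) y)" using vs2.span_finite[OF finC] by auto
      define x where "x = (\<Sum>y\<in>C - A. s1 (r y) (g y))"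
      have x: "x \<in> vs1.span ?S" unfolding x_def by (intro vs1.span_sum vs1.span_scale vs1.span_base) auto
      have xV: "x \<in> V" unfolding x_def using g V by (intro vs1.subspace_sum vs1.subspace_scale) auto
      have "f x = (\<Sum>y\<in>C - A. s2 (r y) y)" by (simp add: x_def f.sum f.scale g)
      then have "f (z - x) = (\<Sum>y\<in>A. s2 (r y) y)"
        using r sum.subset_diff[OF C(1) finC, of "\<lambda>y. s2 (r y) y"] by (simp add: f.diff)
      also have "\<dots> \<in> vs2.span A" by (intro vs2.span_sum vs2.span_scale vs2.span_base)
      finally have "z - x \<in> D" using D_iff[of "z - x"] z xV V spA by (simp add: vs1.subspace_diff)
      then have "x + (z - x) \<in> vs1.span (?S \<union> D)"
        using x by (intro vs1.span_add) (auto intro: vs1.span_base vs1.span_mono[THEN subsetD, of ?S])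
      then show "z \<in> vs1.span (?S \<union> D)" by simp
    qed
    fix T u assume T: "finite T" "T \<subseteq> ?S" "(\<Sum>v\<in>T. s1 (u v) v) \<in> D"
    then obtain T' where T': "T' \<subseteq> C - A" "finite T'" "T = g ` T'" by (meson finite_subset_image)
    have "T \<subseteq> V" using T(2) g by auto
    then have "f (\<Sum>v\<in>T. s1 (u v) v) \<in> B" using T(3) D_iff V_sum by blast
    also have "f (\<Sum>v\<in>T. s1 (u v) v) = (\<Sum>v\<in>T. s2 (u v) (f v))" by (simp add: f.sum f.scale)
    also have "\<dots> = (\<Sum>y\<in>T'. s2 (u (g y)) (f (g y)))"
      unfolding T'(3) using inj_on_subset[OF inj_g T'(1)] by (simp add: sum.reindex)
    also have "\<dots> = (\<Sum>y\<in>T'. s2 (u (g y)) y)"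
      using T'(1) g(2) by (intro sum.cong) auto
    finally obtain r where r: "(\<Sum>y\<in>T'. s2 (u (g y)) y) = (\<Sum>a\<in>A. s2 (r a) a)"
      using spA vs2.span_finite[OF finA] by auto
    define q where "q v = (if v \<in> T' then u (g v) else - r v)" for v
    have dis: "T' \<inter> A = {}" using T' by blast
    have "(\<Sum>v\<in>T' \<union> A. s2 (q v) v) = (\<Sum>v\<in>T'. s2 (q v) v) + (\<Sum>v\<in>A. s2 (q v) v)"
      using T'(2) finA dis by (intro sum.union_disjoint) auto
    also have "(\<Sum>v\<in>T'. s2 (q v) v) = (\<Sum>y\<in>T'. s2 (u (g y)) y)"
      by (intro sum.cong) (simp_all add: q_def)
    also have "(\<Sum>v\<in>A. s2 (q v) v) = (\<Sum>v\<in>A. - s2 (r v) v)"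
      using dis by (intro sum.cong) (auto simp: q_def)
    finally have "(\<Sum>v\<in>T' \<union> A. s2 (q v) v) = 0" by (simp add: r sum_negf)
    moreover have "finite (T' \<union> A)" "T' \<union> A \<subseteq> C" using T' finA C(1) by auto
    ultimately have "\<forall>v\<in>T' \<union> A. q v = 0"
      using C(3) unfolding vs2.dependent_explicit by blast
    then show "\<forall>v\<in>T. u v = 0" using T'(3) by (metis UnI1 imageE q_def)
  qed
  then show "vs1.quotient_fin_dim V D"
    unfolding vs1.quotient_fin_dim_def using finC by (intro exI[of _ ?S]) simp
  have card_eq: "card T + card A = vs2.dim (f ` V)" if qT: "vs1.quotient_basis V D T" for T
  proof -
    have T: "T \<subseteq> V" "V \<subseteq> vs1.span (T \<union> D)"
      and Tind: "\<And>T' u. finite T' \<Longrightarrow> T' \<subseteq> T \<Longrightarrow> (\<Sum>v\<in>T'. s1 (u v) v) \<in> D \<Longrightarrow> \<forall>v\<in>T'. u v = 0"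
      using qT unfolding vs1.quotient_basis_def by auto
    have ind0: "\<forall>v\<in>T'. u v = 0" if "finite T'" "T' \<subseteq> T" "(\<Sum>v\<in>T'. s2 (u v) (f v)) \<in> B" for T' u
    proof -
      have "f (\<Sum>v\<in>T'. s1 (u v) v) \<in> B" using that(3) by (simp add: f.sum f.scale)
      then have "(\<Sum>v\<in>T'. s1 (u v) v) \<in> D" using D_iff V_sum that(2) T(1) by blast
      then show ?thesis using Tind that by blast
    qed
    have injT: "inj_on f T"
    proof (rule inj_onI, rule ccontr)
      fix x y assume xy: "x \<in> T" "y \<in> T" "f x = f y" "x \<noteq> y"
      then have "\<forall>v\<in>{x, y}. (if v = x then 1 else - 1 :: 'a) = 0"
        using vs2.subspace_0[OF B(1)] by (intro ind0) auto
      then show False by simp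
    qed
    have dis: "f ` T \<inter> A = {}"
    proof (rule ccontr)
      assume "f ` T \<inter> A \<noteq> {}"
      then obtain x where "x \<in> T" "f x \<in> B" using A(1) by blast
      then have "\<forall>v\<in>{x}. (1 :: 'a) = 0" by (intro ind0) auto
      then show False by simp
    qed
    have ind: "vs2.independent (f ` T \<union> A)"
    proof (rule vs2.independentI_sum)
      fix U u assume U: "finite U" "U \<subseteq> f ` T \<union> A" "(\<Sum>v\<in>U. s2 (u v) v) = 0"
      let ?U1 = "U \<inter> f ` T" and ?U2 = "U \<inter> A"
      have split: "(\<Sum>v\<in>?U1. s2 (u v) v) + (\<Sum>v\<in>?U2. s2 (u v) v) = 0"
      proof -
        have "U = ?U1 \<union> ?U2" using U(2) by blast
        moreover have "(\<Sum>v\<in>?U1 \<union> ?U2. s2 (u v) v) = (\<Sum>v\<in>?U1. s2 (u v) v) + (\<Sum>v\<in>?U2. s2 (u v) v)"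
          using U(1) dis by (intro sum.union_disjoint) auto
        ultimately show ?thesis using U(3) by simp
      qed
      have "(\<Sum>v\<in>?U2. s2 (u v) v) \<in> B"
        using A(1) B(1) by (intro vs2.subspace_sum vs2.subspace_scale) auto
      then have inB: "(\<Sum>v\<in>?U1. s2 (u v) v) \<in> B"
        using split B(1) by (metis eq_neg_iff_add_eq_0 vs2.subspace_neg)
      obtain T' where T': "T' \<subseteq> T" "finite T'" "?U1 = f ` T'" using U(1)
        by (metis finite_Int finite_subset_image inf_le2)
      have "(\<Sum>v\<in>T'. s2 (u (f v)) (f v)) \<in> B"
        using inB inj_on_subset[OF injT T'(1)] unfolding T'(3) by (simp add: sum.reindex)
      then have u1: "\<forall>v\<in>?U1. u v = 0" using ind0[of T' "\<lambda>v. u (f v)"] T' by auto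
      then have "(\<Sum>v\<in>?U2. s2 (u v) v) = 0" using split by simp
      then have "\<forall>v\<in>?U2. u v = 0"
        using A(2) U(1) unfolding vs2.dependent_explicit by blast
      then show "\<forall>v\<in>U. u v = 0" using u1 U(2) by blast
    qed
    have sub: "f ` T \<union> A \<subseteq> f ` V" using T(1) A(1) B(2) by blast
    have "f ` V \<subseteq> vs2.span (f ` T \<union> A)"
    proof
      fix y assume "y \<in> f ` V"
      then obtain z where z: "z \<in> V" "y = f z" by blast
      then have "z \<in> vs1.span (T \<union> D)" using T(2) by blast
      then obtain a b where ab: "z = a + b" "a \<in> vs1.span T" "b \<in> vs1.span D"
        unfolding vs1.span_Un by blast
      have "vs1.span D = D" using D by (rule vs1.span_eq_iff[THEN iffD2])
      moreover have "a \<in> V" using ab(2) vs1.span_minimal[OF T(1) V] by blast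
      then have "b \<in> V" using z(1) ab(1) V by (metis add_diff_cancel_left' vs1.subspace_diff)
      ultimately have "f b \<in> vs2.span A" using ab(3) D_iff spA by blast
      moreover have "f a \<in> vs2.span (f ` T)" using ab(2) f.span_image[of T] by blast
      ultimately show "y \<in> vs2.span (f ` T \<union> A)"
        unfolding z(2) ab(1) f.add vs2.span_Un by blast
    qed
    then have "card (f ` T \<union> A) = vs2.dim (f ` V)"
      using sub ind by (metis vs2.basis_card_eq_dim)
    moreover have "finite (f ` T)"
      using vs2.independent_span_bound[OF S(2) ind] sub S(1) by blast
    ultimately show ?thesis
      using finA dis by (simp add: card_Un_disjoint card_image[OF injT])
  qed
  have "vs1.quotient_basis V D (SOME S. vs1.quotient_basis V D S)" using qb by (rule someI)
  from card_eq[OF this] show "vs1.quotient_dim V D + vs2.dim B = vs2.dim (f ` V)"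
    unfolding vs1.quotient_dim_def A(4) .
qed

end

text \<open>The rank of a projection equals its trace in the ground field. In characteristic zero this turns the
  dimension of a space of invariants into a count of fixed points.\<close>

lemma dim_projection_eq_trace:
  fixes E :: "('b \<Rightarrow>\<^sub>0 'k::field_char_0) \<Rightarrow> ('b \<Rightarrow>\<^sub>0 'k)"
  assumes E: "Vector_Spaces.linear free_scale free_scale E" and X: "finite X"
    and range: "\<And>u. Poly_Mapping.keys (E u) \<subseteq> X"
    and idem: "\<And>u. Poly_Mapping.keys u \<subseteq> X \<Longrightarrow> E (E u) = E u"
  shows "of_nat (free.dim (E ` {u. Poly_Mapping.keys u \<subseteq> X}))
    = (\<Sum>x\<in>X. Poly_Mapping.lookup (E (Poly_Mapping.single x 1)) x)"
proof -
  interpret E: Vector_Spaces.linear free_scale free_scale E by fact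
  let ?U = "{u :: 'b \<Rightarrow>\<^sub>0 'k. Poly_Mapping.keys u \<subseteq> X}" and ?s = "\<lambda>x. Poly_Mapping.single x (1::'k)"
  have expand: "u = (\<Sum>x\<in>X. free_scale (Poly_Mapping.lookup u x) (?s x))" if "u \<in> ?U" for u
  proof (rule poly_mapping_eqI)
    fix k
    have "(\<Sum>x\<in>X. Poly_Mapping.lookup u x * (if x = k then 1 else 0)) = (\<Sum>x\<in>X. if x = k then Poly_Mapping.lookup u x else 0)"
      by (intro sum.cong) auto
    then show "Poly_Mapping.lookup u k = Poly_Mapping.lookup (\<Sum>x\<in>X. free_scale (Poly_Mapping.lookup u x) (?s x)) k"
      using that X by (auto simp: lookup_sum lookup_single when_def subset_iff not_in_keys_iff_lookup_eq_zero[symmetric])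
  qed
  have sp: "?U \<subseteq> free.span (?s ` X)"
  proof
    fix u assume u: "u \<in> ?U"
    show "u \<in> free.span (?s ` X)"
      by (subst expand[OF u]) (intro free.span_sum free.span_scale free.span_base imageI)
  qed
  obtain A where A: "A \<subseteq> E ` ?U" "free.independent A" "E ` ?U \<subseteq> free.span A" "card A = free.dim (E ` ?U)"
    by (rule free.basis_exists[of "E ` ?U"])
  have "A \<subseteq> free.span (?s ` X)" using A(1) range sp by blast
  then have finA: "finite A" using free.independent_span_bound[OF finite_imageI[OF X] A(2)] by blast
  define r where "r = free.representation A"
  have rep: "E u = (\<Sum>a\<in>A. free_scale (r (E u) a) a)" if "u \<in> ?U" for u
  proof -
    have "E u \<in> free.span A" using A(3) that by blast
    then show ?thesis unfolding r_def using free.sum_representation_eq[OF A(2) _ finA] by simp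
  qed
  have in_U: "?s x \<in> ?U" if "x \<in> X" for x using that by simp
  have fix_A: "E a = a" "a \<in> ?U" if "a \<in> A" for a
  proof -
    obtain u where u: "u \<in> ?U" "a = E u" using \<open>a \<in> A\<close> A(1) by blast
    then show "E a = a" "a \<in> ?U" using idem[of u] range[of u] by simp_all
  qed
  have "(\<Sum>x\<in>X. Poly_Mapping.lookup (E (?s x)) x)
      = (\<Sum>x\<in>X. \<Sum>a\<in>A. r (E (?s x)) a * Poly_Mapping.lookup a x)"
    by (rule sum.cong[OF refl], subst rep[OF in_U]) (simp_all add: lookup_sum)
  also have "\<dots> = (\<Sum>a\<in>A. \<Sum>x\<in>X. Poly_Mapping.lookup a x * r (E (?s x)) a)"
    by (subst sum.swap) (simp add: mult.commute)
  also have "\<dots> = (\<Sum>a\<in>A. 1)"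
  proof (rule sum.cong[OF refl])
    fix a assume a: "a \<in> A"
    have "a = E (\<Sum>x\<in>X. free_scale (Poly_Mapping.lookup a x) (?s x))"
      using fix_A[OF a] expand[of a] by simp
    also have "\<dots> = (\<Sum>x\<in>X. free_scale (Poly_Mapping.lookup a x) (E (?s x)))"
      by (simp add: E.sum E.scale)
    finally have "r a a = r (\<Sum>x\<in>X. free_scale (Poly_Mapping.lookup a x) (E (?s x))) a" by simp
    also have "\<dots> = (\<Sum>x\<in>X. Poly_Mapping.lookup a x * r (E (?s x)) a)"
    proof -
      have m: "E (?s x) \<in> free.span A" if "x \<in> X" for x using A(3) in_U[OF that] by blast
      then have "r (\<Sum>x\<in>X. free_scale (Poly_Mapping.lookup a x) (E (?s x)))
        = (\<lambda>b. \<Sum>x\<in>X. r (free_scale (Poly_Mapping.lookup a x) (E (?s x))) b)"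
        unfolding r_def by (intro free.representation_sum[OF A(2)] free.span_scale)
      then show ?thesis unfolding r_def using m by (simp add: free.representation_scale[OF A(2)])
    qed
    finally show "(\<Sum>x\<in>X. Poly_Mapping.lookup a x * r (E (?s x)) a) = 1"
      unfolding r_def using free.representation_basis[OF A(2) a] by simp
  qed
  finally show ?thesis using A(4) by simp
qed

section \<open>Cycles and boundaries of the Connes complex in terms of cochains\<close>

lemma subspace_keys: "free.subspace {f :: 'b \<Rightarrow>\<^sub>0 'k::field. Poly_Mapping.keys f \<subseteq> A}"
proof -
  have "Poly_Mapping.keys (f + g) \<subseteq> A" if "Poly_Mapping.keys f \<subseteq> A" "Poly_Mapping.keys g \<subseteq> A" for f g :: "'b \<Rightarrow>\<^sub>0 'k"
    using that Poly_Mapping.keys_add[of f g] by blast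
  moreover have "Poly_Mapping.keys (free_scale c f) \<subseteq> A" if "Poly_Mapping.keys f \<subseteq> A" for f :: "'b \<Rightarrow>\<^sub>0 'k" and c
    using that by (auto simp: in_keys_iff)
  ultimately show ?thesis by (simp add: free.subspace_def)
qed

lemma keys_subset_span:
  "{u :: 'b \<Rightarrow>\<^sub>0 'k::field. Poly_Mapping.keys u \<subseteq> X} \<subseteq> free.span ((\<lambda>x. Poly_Mapping.single x 1) ` X)"
proof
  fix u :: "'b \<Rightarrow>\<^sub>0 'k" assume "u \<in> {u. Poly_Mapping.keys u \<subseteq> X}"
  then have "(\<Sum>x\<in>Poly_Mapping.keys u. free_scale (Poly_Mapping.lookup u x) (Poly_Mapping.single x 1))
      \<in> free.span ((\<lambda>x. Poly_Mapping.single x 1) ` X)"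
    by (intro free.span_sum free.span_scale free.span_base) auto
  then show "u \<in> free.span ((\<lambda>x. Poly_Mapping.single x 1) ` X)"
    using sum_single_keys[of u] by simp
qed

lemma tensor_free_eq: "tensor_free A n = {f. Poly_Mapping.keys f \<subseteq> {xs. length xs = n \<and> set xs \<subseteq> A}}"
  by (auto simp: tensor_free_def)

lemma subspace_tensor_free: "free.subspace (tensor_free A n)"
  unfolding tensor_free_eq by (rule subspace_keys)

lemma single_tensor_free: "length xs = n \<Longrightarrow> set xs \<subseteq> A \<Longrightarrow> Poly_Mapping.single xs c \<in> tensor_free A n"
  by (auto simp: tensor_free_def)

lemma free_extend_tensor_free:
  assumes "f \<in> tensor_free A n" and "\<And>xs. length xs = n \<Longrightarrow> set xs \<subseteq> A \<Longrightarrow> F xs \<in> tensor_free A' n'"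
  shows "free_extend F f \<in> tensor_free A' n'"
  unfolding tensor_free_eq mem_Collect_eq
proof (rule keys_free_extend)
  fix xs assume "xs \<in> Poly_Mapping.keys f"
  then have "F xs \<in> tensor_free A' n'"
    using assms(1) by (intro assms(2)) (auto simp: tensor_free_def)
  then show "Poly_Mapping.keys (F xs) \<subseteq> {xs. length xs = n' \<and> set xs \<subseteq> A'}"
    unfolding tensor_free_def by blast
qed

lemma hochschild_b_tensor_free:
  fixes f :: "'a::{ring, monoid_mult} list \<Rightarrow>\<^sub>0 'k::field"
  assumes f: "f \<in> tensor_free A (Suc n)" and A: "\<And>x y. x \<in> A \<Longrightarrow> y \<in> A \<Longrightarrow> x * y \<in> A"
  shows "hochschild_b f \<in> tensor_free A n"
  unfolding hochschild_b_def
proof (rule free_extend_tensor_free[OF f])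
  fix xs :: "'a list" assume xs: "length xs = Suc n" "set xs \<subseteq> A"
  let ?F = "if length xs \<le> 1 then 0
     else (\<Sum>j<length xs - 1.
             Poly_Mapping.single (take j xs @ [xs ! j * xs ! (j + 1)] @ drop (j + 2) xs) ((-1) ^ j))
          + Poly_Mapping.single ((last xs * hd xs) # butlast (tl xs)) ((-1) ^ (length xs - 1)) :: 'a list \<Rightarrow>\<^sub>0 'k"
  note sub = subspace_tensor_free[of A n]
  show "?F \<in> tensor_free A n"
  proof (cases "length xs \<le> 1")
    case True
    then show ?thesis using free.subspace_0[OF sub] by simp
  next
    case False
    have "Poly_Mapping.single (take j xs @ [xs ! j * xs ! (j + 1)] @ drop (j + 2) xs) ((-1) ^ j) \<in> tensor_free A n"
      if "j < length xs - 1" for j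
    proof (rule single_tensor_free)
      show "set (take j xs @ [xs ! j * xs ! (j + 1)] @ drop (j + 2) xs) \<subseteq> A"
      proof -
        have "xs ! j \<in> A" "xs ! (j + 1) \<in> A" using that xs by (auto intro!: subsetD[OF xs(2)] nth_mem)
        then show ?thesis using xs(2) A by (auto dest: in_set_takeD in_set_dropD)
      qed
    qed (use that xs in simp)
    moreover have "Poly_Mapping.single ((last xs * hd xs) # butlast (tl xs)) ((-1) ^ (length xs - 1)) \<in> tensor_free A n"
    proof (rule single_tensor_free)
      obtain x y w where w: "xs = x # y # w" using False by (cases xs; cases "tl xs") auto
      show "set ((last xs * hd xs) # butlast (tl xs)) \<subseteq> A"
        using xs A last_in_set[of xs] unfolding w by (auto dest!: in_set_butlastD)
    qed (use False xs in simp)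
    ultimately show ?thesis
      unfolding if_not_P[OF False]
      by (intro free.subspace_add[OF sub] free.subspace_sum[OF sub]) auto
  qed
qed

context algebra_over begin

lemma connes_relations_subset_tensor_free:
  assumes "n \<ge> 1"
  shows "connes_relations scl UNIV n \<subseteq> tensor_free UNIV n"
  unfolding connes_relations_def
proof (rule free.span_minimal[OF _ subspace_tensor_free], intro Un_least subsetI)
  note sub = subspace_tensor_free[of UNIV n]
  fix g :: "'a list \<Rightarrow>\<^sub>0 'k" assume "g \<in> multilinear_relations scl UNIV n"
  then obtain xs ys a b c where "length xs + 1 + length ys = n"
    and g: "g = pure_tensor (xs @ [scl c a + b] @ ys) - free_scale c (pure_tensor (xs @ [a] @ ys)) - pure_tensor (xs @ [b] @ ys)"
    unfolding multilinear_relations_def by blast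
  then show "g \<in> tensor_free UNIV n"
    unfolding g pure_tensor_def
    by (intro free.subspace_diff[OF sub] free.subspace_scale[OF sub] single_tensor_free) auto
next
  note sub = subspace_tensor_free[of UNIV n]
  fix g :: "'a list \<Rightarrow>\<^sub>0 'k" assume "g \<in> (\<lambda>z. z - cyclic_t z) ` tensor_free UNIV n"
  then obtain z where z: "z \<in> tensor_free UNIV n" "g = z - cyclic_t z" by blast
  have "cyclic_t z \<in> tensor_free UNIV n"
    unfolding cyclic_t_def using assms
    by (intro free_extend_tensor_free[OF z(1)] single_tensor_free) auto
  then show "g \<in> tensor_free UNIV n" using z by (simp add: free.subspace_diff[OF sub])
qed

lemma mem_connes_cycles_iff:
  "z \<in> connes_cycles scl UNIV i \<longleftrightarrow> z \<in> tensor_free UNIV (i + 1) \<and>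
    (\<forall>c. multilinear_cochain c \<longrightarrow> cyclic_cochain c \<longrightarrow> pairing z (coboundary c) = 0)"
proof (cases "z \<in> tensor_free UNIV (i + 1)")
  case True
  then have b: "hochschild_b z \<in> tensor_free UNIV i" by (intro hochschild_b_tensor_free) auto
  show ?thesis
  proof (cases "i = 0")
    case i: True
    have "hochschild_b z = free_extend (\<lambda>xs. 0) z"
      unfolding hochschild_b_def free_extend_def
      using True i by (intro sum.cong refl) (auto simp: tensor_free_def)
    then have "hochschild_b z = 0" by simp
    then show ?thesis using True pairing_hochschild_b[of _ z]
      by (auto simp: connes_cycles_def connes_relations_def free.span_zero)
  next
    case False
    then show ?thesis using True b mem_connes_relations_iff[of i "hochschild_b z"]
      by (auto simp: connes_cycles_def pairing_hochschild_b)
  qed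
qed (simp add: connes_cycles_def)

text \<open>A boundary differs from some \<open>b y\<close> by a Connes relation, and relations are the chains on which all
  cyclic multilinear cochains vanish.\<close>

lemma mem_connes_boundaries_iff:
  "z \<in> connes_boundaries scl UNIV i \<longleftrightarrow> z \<in> tensor_free UNIV (i + 1) \<and>
    (\<exists>y\<in>tensor_free UNIV (i + 2). \<forall>c. multilinear_cochain c \<longrightarrow> cyclic_cochain c \<longrightarrow>
      pairing z c = pairing y (coboundary c))" (is "_ \<longleftrightarrow> ?P z")
proof
  assume "z \<in> connes_boundaries scl UNIV i"
  then show "?P z" unfolding connes_boundaries_def
  proof (induction rule: free.span_induct_alt)
    case base
    show ?case using free.subspace_0[OF subspace_tensor_free]
      by (intro conjI bexI[of _ 0]) auto
  next
    case (step a x w)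
    note sub = subspace_tensor_free
    obtain y where y: "y \<in> tensor_free UNIV (i + 2)" "\<And>c. multilinear_cochain c \<Longrightarrow> cyclic_cochain c \<Longrightarrow>
      pairing w c = pairing y (coboundary c)" and w: "w \<in> tensor_free UNIV (i + 1)" using step(2) by blast
    have "\<exists>y'\<in>tensor_free UNIV (i + 2). \<forall>c. multilinear_cochain c \<longrightarrow> cyclic_cochain c \<longrightarrow>
      pairing x c = pairing y' (coboundary c)" and x: "x \<in> tensor_free UNIV (i + 1)"
    proof -
      consider y' where "y' \<in> tensor_free UNIV (i + 2)" "x = hochschild_b y'"
        | "x \<in> connes_relations scl UNIV (i + 1)" using step(1) by blast
      then have "(\<exists>y'\<in>tensor_free UNIV (i + 2). \<forall>c. multilinear_cochain c \<longrightarrow> cyclic_cochain c \<longrightarrow>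
        pairing x c = pairing y' (coboundary c)) \<and> x \<in> tensor_free UNIV (i + 1)"
      proof cases
        case 1
        have "hochschild_b y' \<in> tensor_free UNIV (i + 1)"
          using 1 by (intro hochschild_b_tensor_free) auto
        then show ?thesis using 1 pairing_hochschild_b[of _ y'] by blast
      next
        case 2
        then have "x \<in> tensor_free UNIV (i + 1)" using connes_relations_subset_tensor_free[of "i + 1"] by auto
        then show ?thesis using 2 mem_connes_relations_iff[of "i + 1" x] free.subspace_0[OF sub]
          by (intro conjI bexI[of _ 0]) auto
      qed
      then show "\<exists>y'\<in>tensor_free UNIV (i + 2). \<forall>c. multilinear_cochain c \<longrightarrow> cyclic_cochain c \<longrightarrow>
        pairing x c = pairing y' (coboundary c)" "x \<in> tensor_free UNIV (i + 1)" by blast+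
    qed
    then obtain y' where y': "y' \<in> tensor_free UNIV (i + 2)" "\<And>c. multilinear_cochain c \<Longrightarrow> cyclic_cochain c \<Longrightarrow>
      pairing x c = pairing y' (coboundary c)" by blast
    show ?case
    proof (intro conjI bexI allI impI)
      show "free_scale a x + w \<in> tensor_free UNIV (i + 1)"
        using x w sub by (intro free.subspace_add free.subspace_scale)
      show "free_scale a y' + y \<in> tensor_free UNIV (i + 2)"
        using y y' sub by (intro free.subspace_add free.subspace_scale)
      fix c assume "multilinear_cochain c" "cyclic_cochain c"
      then show "pairing (free_scale a x + w) c = pairing (free_scale a y' + y) (coboundary c)"
        using y y' by (simp add: pairing_add pairing_free_scale)
    qed
  qed
next
  assume "?P z"
  then obtain y where z: "z \<in> tensor_free UNIV (i + 1)" and y: "y \<in> tensor_free UNIV (i + 2)"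
    "\<And>c. multilinear_cochain c \<Longrightarrow> cyclic_cochain c \<Longrightarrow> pairing z c = pairing y (coboundary c)" by blast
  have "hochschild_b y \<in> tensor_free UNIV (i + 1)"
    using y(1) by (intro hochschild_b_tensor_free) auto
  then have t: "z - hochschild_b y \<in> tensor_free UNIV (i + 1)"
    using z subspace_tensor_free by (intro free.subspace_diff)
  have "z - hochschild_b y \<in> connes_relations scl UNIV (i + 1)"
    using mem_connes_relations_iff[OF _ t] y(2) by (simp add: pairing_diff pairing_hochschild_b)
  then have "hochschild_b y + (z - hochschild_b y) \<in> connes_boundaries scl UNIV i"
    unfolding connes_boundaries_def using y(1) by (intro free.span_add free.span_base) auto
  then show "z \<in> connes_boundaries scl UNIV i" by simp
qed

end

text \<open>The insertion is the transpose of an operator on chains. This is what allows the homotopy, which is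
  formulated for cochains, to produce the chain whose boundary is a given cycle.\<close>

lemma (in algebra_with_idempotents) insertion_chain:
  assumes "f \<in> tensor_free UNIV l"
  shows "\<exists>y\<in>tensor_free UNIV (Suc l). \<forall>c. pairing y c = pairing f (insertion c)"
proof -
  define F where "F ys = (case ys of [] \<Rightarrow> 0
     | x # w \<Rightarrow> \<Sum>i<n. Poly_Mapping.single (p x * e i # e i # w) (1::'k))" for ys :: "'a list"
  define P where "P xs = (\<Sum>r<length xs. free_scale ((-1) ^ (r * (length xs + 1))) (F (rotate r xs)))" for xs
  have "pairing (F ys) c = insert_first c ys" for c ys
    by (cases ys) (simp_all add: F_def pairing_sum)
  then have P: "pairing (P xs) c = insertion c xs" for xs c
    by (simp add: P_def insertion_def cyclic_sum_def pairing_sum pairing_free_scale)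
  note sub = subspace_tensor_free[of UNIV "Suc l"]
  have "P xs \<in> tensor_free UNIV (Suc l)" if "length xs = l" for xs
    unfolding P_def
  proof (intro free.subspace_sum[OF sub] free.subspace_scale[OF sub])
    fix r
    have "length (rotate r xs) = l" using that by simp
    then show "F (rotate r xs) \<in> tensor_free UNIV (Suc l)"
      unfolding F_def using free.subspace_0[OF sub]
      by (cases "rotate r xs") (auto intro!: free.subspace_sum[OF subspace_tensor_free] single_tensor_free)
  qed
  then have "free_extend P f \<in> tensor_free UNIV (Suc l)"
    by (intro free_extend_tensor_free[OF assms])
  then show ?thesis
    by (intro bexI[of _ "free_extend P f"]) (simp_all add: pairing_free_extend P)
qed

section \<open>Averaging over rotations\<close>

locale graded_arrow_basis = arrow_basis +
  fixes G :: "nat \<Rightarrow> 'b set"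
  assumes G_eq: "G k = span {z \<in> letters. deg z = k}"
begin

definition words :: "nat \<Rightarrow> nat \<Rightarrow> 'b list set" where
  "words l k = {w. length w = l \<and> set w \<subseteq> letters \<and> wdeg w = k}"

definition closed_words :: "nat \<Rightarrow> nat \<Rightarrow> 'b list set" where
  "closed_words l k = {w \<in> words l k. closed_path w}"

text \<open>The cyclic cochain that counts, with signs, the rotations taking a word to \<open>w\<close>. It vanishes when \<open>w\<close>
  is fixed by a rotation of sign \<open>-1\<close>.\<close>

definition dual :: "'b list \<Rightarrow> 'b list \<Rightarrow> 'a" where
  "dual w xs = extend xs (cyclic_sum (\<lambda>u. if u = w then 1 else 0))"

lemma multilinear_cochain_dual: "multilinear_cochain (dual w)"
  unfolding dual_def[abs_def] by (rule multilinear_cochain_extend)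

lemma cyclic_cochain_dual: "cyclic_cochain (dual w)"
  unfolding dual_def[abs_def] by (intro cyclic_cochain_extend cyclic_cochain_cyclic_sum)

lemma finite_words: "finite (words l k)"
proof -
  let ?L = "e ` {..<n} \<union> (\<Union>j\<le>k. {z \<in> B. dg z = j})"
  have "finite ?L" using finite_degree by auto
  then have "finite {w. set w \<subseteq> ?L \<and> length w = l}" by (rule finite_lists_length_eq)
  moreover have "words l k \<subseteq> {w. set w \<subseteq> ?L \<and> length w = l}"
  proof
    fix w assume w: "w \<in> words l k"
    have "x \<in> ?L" if "x \<in> set w" for x
    proof -
      have "deg x \<le> wdeg w" unfolding wdeg_def using that by (intro member_le_sum_list) auto
      then show ?thesis using that w by (auto simp: words_def deg_def)
    qed
    then show "w \<in> {w. set w \<subseteq> ?L \<and> length w = l}" using w by (auto simp: words_def)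
  qed
  ultimately show ?thesis by (rule finite_subset[rotated])
qed

lemma finite_closed_words: "finite (closed_words l k)"
  using finite_words by (auto simp: closed_words_def)

lemma rotate_words: "rotate r w \<in> words l k \<longleftrightarrow> w \<in> words l k"
  by (simp add: words_def)

lemma rotate_closed_words: "rotate r w \<in> closed_words l k \<longleftrightarrow> w \<in> closed_words l k"
  by (simp add: closed_words_def rotate_words)

lemma closed_words_iff:
  "k \<noteq> 0 \<Longrightarrow> w \<in> closed_words l k \<longleftrightarrow> w \<in> words l k \<and> bad w = 0"
  using closed_path_bad bad_eq_0_imp_closed_path by (auto simp: closed_words_def words_def)

lemma closed_words_empty: "l > (H + 1) * k \<Longrightarrow> closed_words l k = {}"
  using closed_path_length_le by (fastforce simp: closed_words_def words_def)

text \<open>The averaging projection onto chains that are supported on a rotation invariant set of words and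
  invariant under signed rotation; dividing by the length is another use of characteristic zero.\<close>

definition avg :: "'b list set \<Rightarrow> ('b list \<Rightarrow>\<^sub>0 'a) \<Rightarrow> ('b list \<Rightarrow>\<^sub>0 'a)" where
  "avg X z = (\<Sum>w\<in>X. free_scale (pairing z (dual w) / of_nat (length w)) (Poly_Mapping.single w 1))"

lemma linear_avg: "Vector_Spaces.linear free_scale free_scale (avg X)"
proof -
  interpret vector_space_pair "free_scale :: 'a \<Rightarrow> ('b list \<Rightarrow>\<^sub>0 'a) \<Rightarrow> _" "free_scale :: 'a \<Rightarrow> ('b list \<Rightarrow>\<^sub>0 'a) \<Rightarrow> _" ..
  show ?thesis
    by unfold_locales
      (simp_all add: avg_def pairing_add pairing_free_scale add_divide_distrib
        free.scale_left_distrib sum.distrib free.scale_sum_right)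
qed

lemma keys_avg: "Poly_Mapping.keys (avg X z) \<subseteq> X"
proof -
  have "avg X z \<in> {u. Poly_Mapping.keys u \<subseteq> X}"
    unfolding avg_def
    by (intro free.subspace_sum[OF subspace_keys] free.subspace_scale[OF subspace_keys]) auto
  then show ?thesis by simp
qed

text \<open>The average of a chain is tested by a cyclic cochain in the same way as the chain itself, once the
  cochain is restricted to words in \<open>X\<close>.\<close>

lemma pairing_avg:
  assumes X: "finite X" "\<And>w. w \<in> X \<Longrightarrow> length w = l" "\<And>r w. rotate r w \<in> X \<longleftrightarrow> w \<in> X"
    and l: "l \<noteq> 0" and z: "z \<in> tensor_free UNIV l" and c: "cyclic_cochain c"
  shows "pairing (avg X z) c = pairing z (\<lambda>xs. extend xs (\<lambda>w. if w \<in> X then c w else 0))"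
proof -
  let ?\<delta> = "\<lambda>w. cyclic_sum (\<lambda>u. if u = w then 1 else 0)"
  have "pairing (avg X z) c = (\<Sum>w\<in>X. c w / of_nat l * pairing z (dual w))"
    unfolding avg_def pairing_sum by (intro sum.cong) (simp_all add: pairing_free_scale X)
  also have "\<dots> = pairing z (\<lambda>xs. \<Sum>w\<in>X. c w / of_nat l * dual w xs)"
    by (simp only: pairing_sum_right pairing_scale_right)
  also have "\<dots> = pairing z (\<lambda>xs. extend xs (\<lambda>w. if w \<in> X then c w else 0))"
  proof (rule pairing_cong)
    fix xs assume "xs \<in> Poly_Mapping.keys z"
    then have xs: "length xs = l" using z by (auto simp: tensor_free_def)
    have "(\<Sum>w\<in>X. c w / of_nat l * dual w xs) = extend xs (\<lambda>u. \<Sum>w\<in>X. c w / of_nat l * ?\<delta> w u)"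
      by (simp only: dual_def extend_mult_right extend_sum_right)
    also have "\<dots> = extend xs (\<lambda>w. if w \<in> X then c w else 0)"
    proof (rule extend_cong)
      fix u :: "'b list" assume "length u = length xs"
      then have u: "length u = l" using xs by simp
      let ?c = "\<lambda>v. if v \<in> X then c v else 0"
      have cyc: "cyclic_cochain ?c"
        unfolding cyclic_cochain_def
      proof (intro allI)
        fix x v
        have "(v @ [x] \<in> X) = (x # v \<in> X)" using X(3)[of 1 "x # v"] by simp
        then show "?c (x # v) = (-1) ^ length v * ?c (v @ [x])"
          using c by (simp add: cyclic_cochain_def)
      qed
      have "(\<Sum>w\<in>X. c w / of_nat l * ?\<delta> w u) = cyclic_sum (\<lambda>v. \<Sum>w\<in>X. c w / of_nat l * (if v = w then 1 else 0)) u"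
        by (simp only: cyclic_sum_sum cyclic_sum_mult)
      also have "(\<lambda>v. \<Sum>w\<in>X. c w / of_nat l * (if v = w then 1 else 0)) = (\<lambda>v. 1 / of_nat l * ?c v)"
      proof
        fix v
        have "(\<Sum>w\<in>X. c w / of_nat l * (if v = w then 1 else 0)) = (\<Sum>w\<in>X. if v = w then c w / of_nat l else 0)"
          by (intro sum.cong) auto
        then show "(\<Sum>w\<in>X. c w / of_nat l * (if v = w then 1 else 0)) = 1 / of_nat l * ?c v"
          using X(1) by simp
      qed
      also have "cyclic_sum (\<lambda>v. 1 / of_nat l * ?c v) u = ?c u"
        unfolding cyclic_sum_mult cyclic_sum_cyclic[OF cyc] using l by (simp add: u)
      finally show "(\<Sum>w\<in>X. c w / of_nat l * ?\<delta> w u) = ?c u" .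
    qed
    finally show "(\<Sum>w\<in>X. c w / of_nat l * dual w xs) = extend xs (\<lambda>w. if w \<in> X then c w else 0)" .
  qed
  finally show ?thesis .
qed

text \<open>Projections of cochains: onto closed paths of degree \<open>k\<close>, onto degree \<open>k\<close>, and the inverse
  of the eigenvalue on the remaining part of degree \<open>k\<close>.\<close>

definition "closed_part k = diag (\<lambda>b d. if d = k \<and> b = 0 then 1 else 0)"
definition "degree_part k = diag (\<lambda>b d. if d = k then 1 else 0)"
definition "inverse_defect k = diag (\<lambda>b d. if d = k \<and> b \<noteq> 0 then 1 / of_nat b else 0)"

lemma pairing_avg_closed:
  assumes "k \<noteq> 0" "l \<noteq> 0" "z \<in> tensor_free UNIV l" "cyclic_cochain c"
  shows "pairing (avg (closed_words l k) z) c = pairing z (closed_part k c)"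
proof -
  have "pairing z (\<lambda>xs. extend xs (\<lambda>w. if w \<in> closed_words l k then c w else 0)) = pairing z (closed_part k c)"
  proof (rule pairing_cong)
    fix xs assume "xs \<in> Poly_Mapping.keys z"
    then have xs: "length xs = l" using assms(3) by (auto simp: tensor_free_def)
    show "extend xs (\<lambda>w. if w \<in> closed_words l k then c w else 0) = closed_part k c xs"
      unfolding closed_part_def diag_def
      by (rule extend_cong) (auto simp: closed_words_iff assms(1) words_def xs)
  qed
  then show ?thesis
    using assms finite_closed_words rotate_closed_words
    by (subst pairing_avg[where l = l]) (auto simp: closed_words_def words_def)
qed

lemma pairing_avg_words:
  assumes "l \<noteq> 0" "z \<in> tensor_free UNIV l" "cyclic_cochain c"
  shows "pairing (avg (words l k) z) c = pairing z (degree_part k c)"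
proof -
  have "pairing z (\<lambda>xs. extend xs (\<lambda>w. if w \<in> words l k then c w else 0)) = pairing z (degree_part k c)"
  proof (rule pairing_cong)
    fix xs assume "xs \<in> Poly_Mapping.keys z"
    then have xs: "length xs = l" using assms(2) by (auto simp: tensor_free_def)
    show "extend xs (\<lambda>w. if w \<in> words l k then c w else 0) = degree_part k c xs"
      unfolding degree_part_def diag_def
      by (rule extend_cong) (auto simp: words_def xs)
  qed
  then show ?thesis
    using assms finite_words rotate_words
    by (subst pairing_avg[where l = l]) (auto simp: words_def)
qed

lemma diag_diag:
  "diag g (diag g' c) = diag (\<lambda>b d. g b d * g' b d) c"
  by (intro ext) (simp add: diag_def[of g] diag_def[of "\<lambda>b d. g b d * g' b d"] diag_word mult.assoc cong: extend_cong)

end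

section \<open>The finite complex of cyclic closed paths\<close>

lemma linear_hochschild_b:
  "Vector_Spaces.linear free_scale free_scale
    (hochschild_b :: ('a::{ring, monoid_mult} list \<Rightarrow>\<^sub>0 'k::field) \<Rightarrow> _)"
proof -
  interpret vector_space_pair "free_scale :: 'k \<Rightarrow> ('a list \<Rightarrow>\<^sub>0 'k) \<Rightarrow> _" "free_scale :: 'k \<Rightarrow> ('a list \<Rightarrow>\<^sub>0 'k) \<Rightarrow> _" ..
  show ?thesis
    by unfold_locales (simp_all add: hochschild_b_def free_extend_add free_extend_free_scale)
qed

lemma coboundary_singleton: "coboundary c [x] = 0"
  by (simp add: coboundary_def cyclic_sum_def)

context graded_arrow_basis begin

text \<open>The spaces \<open>closed_space k l\<close> of signed rotation invariant combinations of closed paths, with the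
  averaged Hochschild boundary, form the finite complex that computes the homology in degree \<open>k\<close>.\<close>

definition boundary :: "nat \<Rightarrow> nat \<Rightarrow> ('b list \<Rightarrow>\<^sub>0 'a) \<Rightarrow> ('b list \<Rightarrow>\<^sub>0 'a)" where
  "boundary k l z = avg (closed_words (l - 1) k) (hochschild_b z)"

definition closed_space :: "nat \<Rightarrow> nat \<Rightarrow> ('b list \<Rightarrow>\<^sub>0 'a) set" where
  "closed_space k l = avg (closed_words l k) ` {u. Poly_Mapping.keys u \<subseteq> closed_words l k}"

lemma linear_boundary: "Vector_Spaces.linear free_scale free_scale (boundary k l)"
  using Vector_Spaces.linear_compose[OF linear_hochschild_b linear_avg]
  by (simp add: boundary_def[abs_def] comp_def)

lemma cochain_parts [simp]:
  "multilinear_cochain (closed_part k c)" "multilinear_cochain (degree_part k c)" "multilinear_cochain (inverse_defect k c)"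
  "cyclic_cochain c \<Longrightarrow> cyclic_cochain (closed_part k c)"
  "cyclic_cochain c \<Longrightarrow> cyclic_cochain (degree_part k c)"
  "cyclic_cochain c \<Longrightarrow> cyclic_cochain (inverse_defect k c)"
  by (simp_all add: closed_part_def degree_part_def inverse_defect_def multilinear_cochain_diag cyclic_cochain_diag)

lemma coboundary_parts:
  assumes "multilinear_cochain c" "cyclic_cochain c"
  shows "coboundary (closed_part k c) = closed_part k (coboundary c)"
    "coboundary (inverse_defect k c) = inverse_defect k (coboundary c)"
  by (simp_all add: closed_part_def inverse_defect_def coboundary_diag assms)

lemma closed_part_idem: "closed_part k (closed_part k c) = closed_part k c"
proof -
  have "(\<lambda>b d. (if d = k \<and> b = 0 then 1 else 0) * (if d = k \<and> b = 0 then 1 else 0)) = (\<lambda>b d. if d = k \<and> b = (0::nat) then 1 else 0 :: 'a)"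
    by (auto simp: fun_eq_iff)
  then show ?thesis unfolding closed_part_def diag_diag by simp
qed

lemma pairing_closed_part:
  assumes "k \<noteq> 0" "Poly_Mapping.keys u \<subseteq> closed_words l k"
  shows "pairing u (closed_part k c) = pairing u c"
  using assms closed_words_iff[OF assms(1)]
  by (intro pairing_cong) (auto simp: closed_part_def diag_word words_def simp del: Un_iff dest!: subsetD)

lemma pairing_closed_part_dual:
  assumes k: "k \<noteq> 0" and z: "z \<in> tensor_free UNIV l" and w: "w \<in> closed_words l k"
  shows "pairing z (closed_part k (dual w)) = pairing z (dual w)"
proof -
  have "closed_part k (dual w) = dual w"
  proof (rule multilinear_cochain_eqI[OF _ multilinear_cochain_dual])
    fix u assume u: "set u \<subseteq> letters"
    have "dual w u = 0" if "\<not> (wdeg u = k \<and> bad u = 0)"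
    proof -
      have "rotate r u \<noteq> w" for r
      proof
        assume "rotate r u = w"
        then have "u \<in> closed_words l k" using w rotate_closed_words by blast
        then show False using that closed_words_iff[OF k] by (auto simp: words_def)
      qed
      then show ?thesis by (simp add: dual_def extend_word u cyclic_sum_def)
    qed
    then show "closed_part k (dual w) u = dual w u"
      by (auto simp: closed_part_def diag_word u)
  qed simp
  then show ?thesis by simp
qed

lemma avg_eq_iff:
  assumes "k \<noteq> 0" "l \<noteq> 0" "x \<in> tensor_free UNIV l" "y \<in> tensor_free UNIV l"
  shows "avg (closed_words l k) x = avg (closed_words l k) y \<longleftrightarrow>
    (\<forall>c. multilinear_cochain c \<longrightarrow> cyclic_cochain c \<longrightarrow>
      pairing x (closed_part k c) = pairing y (closed_part k c))"
proof
  assume "avg (closed_words l k) x = avg (closed_words l k) y"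
  then show "\<forall>c. multilinear_cochain c \<longrightarrow> cyclic_cochain c \<longrightarrow>
      pairing x (closed_part k c) = pairing y (closed_part k c)"
    using assms by (metis pairing_avg_closed)
next
  assume *: "\<forall>c. multilinear_cochain c \<longrightarrow> cyclic_cochain c \<longrightarrow>
      pairing x (closed_part k c) = pairing y (closed_part k c)"
  have "pairing x (dual w) = pairing y (dual w)" if "w \<in> closed_words l k" for w
    using *[rule_format, OF multilinear_cochain_dual cyclic_cochain_dual, of w] that assms
    by (simp add: pairing_closed_part_dual)
  then show "avg (closed_words l k) x = avg (closed_words l k) y"
    by (simp add: avg_def)
qed

lemma keys_closed_tensor_free: "Poly_Mapping.keys u \<subseteq> closed_words l k \<Longrightarrow> u \<in> tensor_free UNIV l"
  by (auto simp: tensor_free_def closed_words_def words_def)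

lemma avg_tensor_free: "avg (closed_words l k) z \<in> tensor_free UNIV l"
  by (rule keys_closed_tensor_free[OF keys_avg])

lemma avg_idem:
  assumes "k \<noteq> 0" "l \<noteq> 0" "z \<in> tensor_free UNIV l"
  shows "avg (closed_words l k) (avg (closed_words l k) z) = avg (closed_words l k) z"
  using assms by (subst avg_eq_iff) (simp_all add: avg_tensor_free pairing_avg_closed closed_part_idem)

lemma closed_space_eq:
  assumes "k \<noteq> 0" "l \<noteq> 0"
  shows "closed_space k l = avg (closed_words l k) ` tensor_free UNIV l"
proof
  show "closed_space k l \<subseteq> avg (closed_words l k) ` tensor_free UNIV l"
    unfolding closed_space_def using keys_closed_tensor_free by auto
  show "avg (closed_words l k) ` tensor_free UNIV l \<subseteq> closed_space k l"
  proof
    fix u assume "u \<in> avg (closed_words l k) ` tensor_free UNIV l"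
    then obtain z where "z \<in> tensor_free UNIV l" "u = avg (closed_words l k) z" by blast
    then have "u = avg (closed_words l k) u" "Poly_Mapping.keys u \<subseteq> closed_words l k"
      using avg_idem[OF assms] keys_avg by auto
    then show "u \<in> closed_space k l" unfolding closed_space_def by blast
  qed
qed

lemma closed_spaceD:
  assumes "k \<noteq> 0" "l \<noteq> 0" "u \<in> closed_space k l"
  shows "Poly_Mapping.keys u \<subseteq> closed_words l k" "u \<in> tensor_free UNIV l" "avg (closed_words l k) u = u"
proof -
  obtain z where z: "z \<in> tensor_free UNIV l" "u = avg (closed_words l k) z"
    using assms closed_space_eq by blast
  show "Poly_Mapping.keys u \<subseteq> closed_words l k" unfolding z(2) by (rule keys_avg)
  then show "u \<in> tensor_free UNIV l" by (rule keys_closed_tensor_free)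
  show "avg (closed_words l k) u = u" unfolding z(2) by (rule avg_idem[OF assms(1,2) z(1)])
qed

lemma boundary_eq_0_iff:
  assumes k: "k \<noteq> 0" and u: "u \<in> tensor_free UNIV (Suc i)"
  shows "boundary k (Suc i) u = 0 \<longleftrightarrow>
    (\<forall>c. multilinear_cochain c \<longrightarrow> cyclic_cochain c \<longrightarrow> pairing u (closed_part k (coboundary c)) = 0)"
proof (cases "i = 0")
  case True
  have "closed_words 0 k = {}" by (auto simp: closed_words_def words_def closed_path_def)
  moreover have "pairing u (closed_part k (coboundary c)) = 0" if c: "multilinear_cochain c" "cyclic_cochain c" for c
  proof -
    have "pairing u (coboundary (closed_part k c)) = pairing u (\<lambda>_. 0)"
      using u True by (intro pairing_cong) (auto simp: tensor_free_def length_Suc_conv coboundary_singleton)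
    then show ?thesis by (simp add: coboundary_parts c)
  qed
  ultimately show ?thesis by (simp add: boundary_def True avg_def)
next
  case False
  have b: "hochschild_b u \<in> tensor_free UNIV i" using u by (intro hochschild_b_tensor_free) auto
  have "boundary k (Suc i) u = 0 \<longleftrightarrow> avg (closed_words i k) (hochschild_b u) = avg (closed_words i k) 0"
    by (simp add: boundary_def avg_def)
  also have "\<dots> \<longleftrightarrow> (\<forall>c. multilinear_cochain c \<longrightarrow> cyclic_cochain c \<longrightarrow> pairing u (closed_part k (coboundary c)) = 0)"
    using False k b free.subspace_0[OF subspace_tensor_free]
    by (subst avg_eq_iff) (auto simp: pairing_hochschild_b coboundary_parts)
  finally show ?thesis .
qed

text \<open>Membership in the space of homogeneous cycles, seen by cochains: the coboundaries vanish on the chain,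
  and only the component of degree \<open>k\<close> of a cochain matters.\<close>

lemma homogeneous_cyclesD:
  assumes "z \<in> homogeneous_cycles scl G i k"
  shows "z \<in> tensor_free UNIV (Suc i)"
    "multilinear_cochain c \<Longrightarrow> cyclic_cochain c \<Longrightarrow> pairing z (coboundary c) = 0"
    "multilinear_cochain c \<Longrightarrow> cyclic_cochain c \<Longrightarrow> pairing z c = pairing z (degree_part k c)"
proof -
  have z: "z \<in> connes_cycles scl UNIV i"
    "z \<in> free.span (homogeneous_tensors G (i + 1) k \<union> connes_relations scl UNIV (i + 1))"
    using assms by (simp_all add: homogeneous_cycles_def)
  show "z \<in> tensor_free UNIV (Suc i)" using z(1) by (simp add: mem_connes_cycles_iff)
  assume c: "multilinear_cochain c" "cyclic_cochain c"
  show "pairing z (coboundary c) = 0" using z(1) c by (simp add: mem_connes_cycles_iff)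
  have "pairing z (\<lambda>xs. c xs + (-1) * degree_part k c xs) = 0"
  proof (rule span_pairing_eq_0[OF _ z(2)])
    fix g assume "g \<in> homogeneous_tensors G (i + 1) k \<union> connes_relations scl UNIV (i + 1)"
    then show "pairing g (\<lambda>xs. c xs + (-1) * degree_part k c xs) = 0"
    proof
      assume "g \<in> homogeneous_tensors G (i + 1) k"
      then obtain xs ds where g: "g = pure_tensor xs" and d: "list_all2 (\<lambda>x d. x \<in> G d) xs ds" "sum_list ds = k"
        unfolding homogeneous_tensors_def by blast
      have "extend xs c = degree_part k c xs"
        unfolding degree_part_def diag_def using d
        by (intro extend_degree_cong[OF d(1)[unfolded G_eq]]) auto
      then have "c xs = degree_part k c xs" using multilinear_cochain_eq_extend[OF c(1)] by simp
      then show ?thesis by (simp add: g pure_tensor_def)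
    next
      assume g: "g \<in> connes_relations scl UNIV (i + 1)"
      then have "g \<in> tensor_free UNIV (i + 1)" using connes_relations_subset_tensor_free[of "i + 1"] by auto
      then show ?thesis
        using g mem_connes_relations_iff[of "i + 1" g] c
        unfolding pairing_add_right pairing_scale_right by simp
    qed
  qed
  then show "pairing z c = pairing z (degree_part k c)"
    by (simp only: pairing_add_right pairing_scale_right) simp
qed

lemma homogeneous_cyclesI:
  assumes "Poly_Mapping.keys z \<subseteq> words (Suc i) k"
    and "\<And>c. multilinear_cochain c \<Longrightarrow> cyclic_cochain c \<Longrightarrow> pairing z (coboundary c) = 0"
  shows "z \<in> homogeneous_cycles scl G i k"
proof -
  have "z \<in> tensor_free UNIV (i + 1)" using assms(1) by (auto simp: tensor_free_def words_def)
  then have "z \<in> connes_cycles scl UNIV i" using assms(2) by (simp add: mem_connes_cycles_iff)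
  moreover have "(\<lambda>w. Poly_Mapping.single w (1 :: 'a)) ` words (Suc i) k \<subseteq> homogeneous_tensors G (i + 1) k"
  proof
    fix g assume "g \<in> (\<lambda>w. Poly_Mapping.single w (1 :: 'a)) ` words (Suc i) k"
    then obtain w where g: "g = pure_tensor w" and w: "w \<in> words (Suc i) k" by (auto simp: pure_tensor_def)
    have "list_all2 (\<lambda>x d. x \<in> G d) w (map deg w)"
    proof -
      have "w ! j \<in> letters" if "j < length w" for j
        using w nth_mem[OF that] unfolding words_def by blast
      then show ?thesis unfolding list_all2_conv_all_nth G_eq using letter_span_degree by simp
    qed
    then show "g \<in> homogeneous_tensors G (i + 1) k"
      unfolding homogeneous_tensors_def g using w by (force simp: words_def wdeg_def)
  qed
  then have "free.span ((\<lambda>w. Poly_Mapping.single w (1 :: 'a)) ` words (Suc i) k)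
      \<subseteq> free.span (homogeneous_tensors G (i + 1) k \<union> connes_relations scl UNIV (i + 1))"
    by (intro free.span_mono) blast
  then have "z \<in> free.span (homogeneous_tensors G (i + 1) k \<union> connes_relations scl UNIV (i + 1))"
    using keys_subset_span[of "words (Suc i) k"] assms(1) by blast
  ultimately show ?thesis by (simp add: homogeneous_cycles_def)
qed

text \<open>Averaging over closed paths maps the homogeneous cycles of degree \<open>k\<close> onto the cycles of the finite
  complex, because the projection of cochains to closed paths commutes with the coboundary.\<close>

lemma avg_homogeneous_cycles:
  assumes k: "k \<noteq> 0"
  shows "avg (closed_words (Suc i) k) ` homogeneous_cycles scl G i k
    = {u \<in> closed_space k (Suc i). boundary k (Suc i) u = 0}"
proof (intro equalityI subsetI)
  fix u assume "u \<in> avg (closed_words (Suc i) k) ` homogeneous_cycles scl G i k"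
  then obtain z where z: "z \<in> homogeneous_cycles scl G i k" and u: "u = avg (closed_words (Suc i) k) z" by blast
  note zD = homogeneous_cyclesD[OF z]
  have "pairing u (closed_part k (coboundary c)) = 0" if c: "multilinear_cochain c" "cyclic_cochain c" for c
  proof -
    have "pairing u (closed_part k (coboundary c)) = pairing z (closed_part k (closed_part k (coboundary c)))"
      unfolding u by (rule pairing_avg_closed) (simp_all add: k zD c cyclic_cochain_coboundary)
    also have "\<dots> = pairing z (coboundary (closed_part k c))"
      by (simp add: closed_part_idem coboundary_parts c)
    finally show ?thesis by (simp add: zD c)
  qed
  then have "boundary k (Suc i) u = 0"
    unfolding u by (subst boundary_eq_0_iff[OF k avg_tensor_free]) simp
  then show "u \<in> {u \<in> closed_space k (Suc i). boundary k (Suc i) u = 0}"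
    using zD(1) by (simp add: closed_space_eq k u)
next
  fix u assume "u \<in> {u \<in> closed_space k (Suc i). boundary k (Suc i) u = 0}"
  then have u: "u \<in> closed_space k (Suc i)" "boundary k (Suc i) u = 0" by auto
  note uD = closed_spaceD[OF k _ u(1), simplified]
  have "u \<in> homogeneous_cycles scl G i k"
  proof (rule homogeneous_cyclesI)
    show "Poly_Mapping.keys u \<subseteq> words (Suc i) k" using uD(1) by (auto simp: closed_words_def)
    show "pairing u (coboundary c) = 0" if "multilinear_cochain c" "cyclic_cochain c" for c
      using u(2) that boundary_eq_0_iff[OF k uD(2)] pairing_closed_part[OF k uD(1)] by metis
  qed
  then show "u \<in> avg (closed_words (Suc i) k) ` homogeneous_cycles scl G i k"
    using uD(3) by (metis imageI)
qed

lemma boundary_boundary: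
  assumes k: "k \<noteq> 0" and u: "u \<in> tensor_free UNIV (Suc (Suc i))"
  shows "boundary k (Suc i) (boundary k (Suc (Suc i)) u) = 0"
proof -
  have b: "hochschild_b u \<in> tensor_free UNIV (Suc i)" using u by (intro hochschild_b_tensor_free) auto
  have "pairing (boundary k (Suc (Suc i)) u) (closed_part k (coboundary c)) = 0"
    if c: "multilinear_cochain c" "cyclic_cochain c" for c
  proof -
    have "pairing (boundary k (Suc (Suc i)) u) (closed_part k (coboundary c))
      = pairing (hochschild_b u) (closed_part k (closed_part k (coboundary c)))"
      unfolding boundary_def using k b c
      by (simp add: pairing_avg_closed cyclic_cochain_coboundary)
    also have "\<dots> = pairing u (coboundary (coboundary (closed_part k c)))"
      by (simp add: closed_part_idem coboundary_parts c pairing_hochschild_b cyclic_cochain_coboundary)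
    also have "coboundary (coboundary (closed_part k c)) = (\<lambda>_. 0)"
      using c by (intro ext coboundary_coboundary) simp
    finally show ?thesis by simp
  qed
  moreover have "boundary k (Suc (Suc i)) u \<in> tensor_free UNIV (Suc i)"
    by (simp add: boundary_def avg_tensor_free)
  ultimately show ?thesis by (simp add: boundary_eq_0_iff k)
qed

text \<open>Words that are not closed paths do not contribute to the closed path part of a boundary.\<close>

lemma boundary_avg:
  assumes k: "k \<noteq> 0" and u: "u \<in> tensor_free UNIV (Suc (Suc i))"
  shows "boundary k (Suc (Suc i)) (avg (closed_words (Suc (Suc i)) k) u) = boundary k (Suc (Suc i)) u"
proof -
  have b: "hochschild_b v \<in> tensor_free UNIV (Suc i)" if "v \<in> tensor_free UNIV (Suc (Suc i))" for v :: "'b list \<Rightarrow>\<^sub>0 'a"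
    using that by (intro hochschild_b_tensor_free) auto
  show ?thesis unfolding boundary_def using k u
    by (simp add: avg_eq_iff b avg_tensor_free pairing_hochschild_b coboundary_parts
      cyclic_cochain_coboundary pairing_avg_closed closed_part_idem)
qed

text \<open>A homogeneous cycle represents zero in reduced homology if and only if its closed path part is a boundary in the finite
  complex. The elements of \<open>\<Lambda>\<^sub>0\<close> have no closed path part in degree \<open>k \<noteq> 0\<close>, which gives one
  direction. For the other, the part of the cycle with a nonzero number \<open>b\<close> of bad positions is the
  boundary of the insertion applied to it, divided by \<open>b\<close>.\<close>

lemma reduced_denominator_iff:
  assumes k: "k \<noteq> 0" and z: "z \<in> homogeneous_cycles scl G i k"
  shows "z \<in> reduced_denominator scl G i \<longleftrightarrow>
    avg (closed_words (Suc i) k) z \<in> boundary k (Suc (Suc i)) ` closed_space k (Suc (Suc i))"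
proof
  assume "z \<in> reduced_denominator scl G i"
  then obtain y c0 where zy: "z = y + c0" and y: "y \<in> free.span (connes_boundaries scl UNIV i)"
    and c0: "c0 \<in> free.span (connes_cycles scl (G 0) i)"
    unfolding reduced_denominator_def free.span_Un by blast
  have "y \<in> connes_boundaries scl UNIV i" using y by (simp add: connes_boundaries_def free.span_span)
  then obtain x where x: "x \<in> tensor_free UNIV (Suc (Suc i))"
    "\<And>c. multilinear_cochain c \<Longrightarrow> cyclic_cochain c \<Longrightarrow> pairing y c = pairing x (coboundary c)"
    by (auto simp: mem_connes_boundaries_iff)
  have "free.span (connes_cycles scl (G 0) i) \<subseteq> tensor_free (G 0) (Suc i)"
    by (rule free.span_minimal[OF _ subspace_tensor_free]) (auto simp: connes_cycles_def)
  then have c0: "c0 \<in> tensor_free (G 0) (Suc i)" using c0 by blast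
  have c0_zero: "pairing c0 (closed_part k c) = 0" for c
  proof -
    have "closed_part k c xs = 0" if "set xs \<subseteq> G 0" for xs
    proof -
      have "list_all2 (\<lambda>x d. x \<in> span {z \<in> letters. deg z = d}) xs (map (\<lambda>_. 0) xs)"
        using that unfolding list_all2_conv_all_nth G_eq by auto
      moreover have "sum_list (map (\<lambda>_. 0 :: nat) xs) = 0" by (induction xs) auto
      ultimately have "closed_part k c xs = extend xs (\<lambda>w. 0 * c w)"
        unfolding closed_part_def diag_def using k by (intro extend_degree_cong) auto
      then show ?thesis unfolding extend_mult_right by simp
    qed
    then have "pairing c0 (closed_part k c) = pairing c0 (\<lambda>_. 0)"
      using c0 by (intro pairing_cong) (auto simp: tensor_free_def)
    then show ?thesis by simp
  qed
  have "avg (closed_words (Suc i) k) z = boundary k (Suc (Suc i)) x"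
  proof -
    have b: "hochschild_b x \<in> tensor_free UNIV (Suc i)"
      using x(1) by (intro hochschild_b_tensor_free) auto
    show ?thesis unfolding boundary_def using homogeneous_cyclesD(1)[OF z] b k x(2)
      by (simp add: avg_eq_iff zy pairing_add c0_zero pairing_hochschild_b)
  qed
  also have "\<dots> = boundary k (Suc (Suc i)) (avg (closed_words (Suc (Suc i)) k) x)"
    by (simp add: boundary_avg k x)
  finally show "avg (closed_words (Suc i) k) z \<in> boundary k (Suc (Suc i)) ` closed_space k (Suc (Suc i))"
    using x(1) by (simp add: closed_space_eq k)
next
  assume "avg (closed_words (Suc i) k) z \<in> boundary k (Suc (Suc i)) ` closed_space k (Suc (Suc i))"
  then obtain y where y: "y \<in> closed_space k (Suc (Suc i))" and eq: "avg (closed_words (Suc i) k) z = boundary k (Suc (Suc i)) y"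
    by blast
  note yD = closed_spaceD[OF k _ y, simplified]
  note zD = homogeneous_cyclesD[OF z]
  have b: "hochschild_b y \<in> tensor_free UNIV (Suc i)"
    using yD(2) by (intro hochschild_b_tensor_free) auto
  have closed: "pairing z (closed_part k c) = pairing y (coboundary c)"
    if c: "multilinear_cochain c" "cyclic_cochain c" for c
  proof -
    have "pairing z (closed_part k c) = pairing (hochschild_b y) (closed_part k c)"
      using eq avg_eq_iff[OF k _ zD(1) b] c unfolding boundary_def by simp
    also have "\<dots> = pairing y (closed_part k (coboundary c))"
      by (simp add: pairing_hochschild_b coboundary_parts c)
    finally show ?thesis by (simp add: pairing_closed_part[OF k yD(1)])
  qed
  \<comment> \<open>The part of \<open>z\<close> with bad positions, divided by their number: first pass to a representative supported
    on words of basis elements, then rescale.\<close>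
  define u where "u = avg (words (Suc i) k) z"
  have u: "pairing u c = pairing z (degree_part k c)" if "cyclic_cochain c" for c
    unfolding u_def using that zD(1) by (intro pairing_avg_words) auto
  have inv: "degree_part k (inverse_defect k c) = inverse_defect k c" for c
    unfolding degree_part_def inverse_defect_def diag_diag
    by (rule arg_cong[of _ _ "\<lambda>g. diag g c"]) (auto simp: fun_eq_iff)
  have "Poly_Mapping.keys u \<subseteq> words (Suc i) k" unfolding u_def by (rule keys_avg)
  define u' where "u' = free_extend (\<lambda>w. Poly_Mapping.single w (if bad w = 0 then 0 else 1 / of_nat (bad w))) u"
  have pair_u': "pairing u' c = pairing z (inverse_defect k c)" if c: "cyclic_cochain c" for c
  proof -
    have "pairing u' c = pairing u (inverse_defect k c)"
      unfolding u'_def pairing_free_extend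
    proof (rule pairing_cong)
      fix w assume "w \<in> Poly_Mapping.keys u"
      then have "w \<in> words (Suc i) k" using \<open>Poly_Mapping.keys u \<subseteq> words (Suc i) k\<close> by blast
      then have w: "set w \<subseteq> letters" "wdeg w = k" by (simp_all only: words_def mem_Collect_eq)
      show "pairing (Poly_Mapping.single w (if bad w = 0 then 0 else 1 / of_nat (bad w))) c = inverse_defect k c w"
        unfolding inverse_defect_def diag_word[OF w(1)] w(2) by simp
    qed
    then show ?thesis using c by (simp add: u inv)
  qed
  have "u' \<in> tensor_free UNIV (Suc i)"
    unfolding u'_def
  proof (rule free_extend_tensor_free)
    show "u \<in> tensor_free UNIV (Suc i)"
      using \<open>Poly_Mapping.keys u \<subseteq> words (Suc i) k\<close> by (auto simp: tensor_free_def words_def)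
  qed (rule single_tensor_free)
  then obtain y2 where y2: "y2 \<in> tensor_free UNIV (Suc (Suc i))" "\<And>c. pairing y2 c = pairing u' (insertion c)"
    using insertion_chain by blast
  \<comment> \<open>On the part without bad positions \<open>closed_part\<close> is the identity and \<open>defect\<close> is zero; elsewhere the
    first is zero and the second is inverted.\<close>
  have split: "degree_part k c = (\<lambda>xs. closed_part k c xs + inverse_defect k (defect c) xs)"
    if c: "multilinear_cochain c" "cyclic_cochain c" for c
  proof (rule multilinear_cochain_eqI)
    show "multilinear_cochain (\<lambda>xs. closed_part k c xs + inverse_defect k (defect c) xs)"
      by (intro multilinear_cochain_plus) simp_all
    fix w assume w: "set w \<subseteq> letters"
    show "degree_part k c w = closed_part k c w + inverse_defect k (defect c) w"
      unfolding degree_part_def closed_part_def inverse_defect_def diag_word[OF w] defect_word[OF c w]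
      by simp
  qed simp
  have "pairing z c = pairing (y + y2) (coboundary c)"
    if c: "multilinear_cochain c" "cyclic_cochain c" for c
  proof -
    have "pairing z (inverse_defect k (defect c)) = pairing u' (defect c)"
      by (simp add: pair_u' defect_def cyclic_cochain_cyclic_sum)
    also have "\<dots> = pairing u' (coboundary (insertion c)) + pairing u' (insertion (coboundary c))"
      unfolding defect_eq[OF c] pairing_add_right ..
    also have "pairing u' (coboundary (insertion c)) = pairing z (coboundary (inverse_defect k (insertion c)))"
      by (simp add: pair_u' cyclic_cochain_coboundary coboundary_parts multilinear_cochain_insertion cyclic_cochain_insertion c)
    also have "\<dots> = 0" using c by (intro zD) (simp_all add: cyclic_cochain_insertion)
    finally show ?thesis
      using zD(3)[OF c] closed[OF c] by (simp add: split[OF c] pairing_add_right pairing_add y2(2))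
  qed
  then have "z \<in> connes_boundaries scl UNIV i"
    unfolding mem_connes_boundaries_iff using zD(1) yD(2) y2(1) subspace_tensor_free
    by (auto intro!: bexI[of _ "y + y2"] free.subspace_add)
  then show "z \<in> reduced_denominator scl G i"
    unfolding reduced_denominator_def by (intro free.span_base) simp
qed

lemma subspace_homogeneous_cycles: "free.subspace (homogeneous_cycles scl G i k)"
proof -
  have "connes_cycles scl UNIV i = tensor_free UNIV (i + 1) \<inter>
      (\<Inter>c\<in>{c. multilinear_cochain c \<and> cyclic_cochain c}. {z. pairing z (coboundary c) = 0})"
    by (auto simp: mem_connes_cycles_iff)
  moreover have "free.subspace (tensor_free UNIV (i + 1) \<inter>
      (\<Inter>c\<in>{c. multilinear_cochain c \<and> cyclic_cochain c}. {z :: 'b list \<Rightarrow>\<^sub>0 'a. pairing z (coboundary c) = 0}))"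
    by (intro free.subspace_inter subspace_tensor_free free.subspace_Inter) (auto simp: subspace_pairing_eq_0)
  ultimately show ?thesis
    unfolding homogeneous_cycles_def by (simp add: free.subspace_inter)
qed

definition "closed_dim k l = free.dim (closed_space k l)"
definition "boundary_rank k l = free.dim (boundary k l ` closed_space k l)"

lemma reduced_HC_dim_eq:
  assumes k: "k \<noteq> 0"
  shows "reduced_HC_fin_dim scl G i k"
    "reduced_HC_dim scl G i k + boundary_rank k (Suc (Suc i)) + boundary_rank k (Suc i) = closed_dim k (Suc i)"
proof -
  interpret vector_space_pair "free_scale :: 'a \<Rightarrow> ('b list \<Rightarrow>\<^sub>0 'a) \<Rightarrow> _" "free_scale :: 'a \<Rightarrow> ('b list \<Rightarrow>\<^sub>0 'a) \<Rightarrow> _" ..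
  let ?V = "homogeneous_cycles scl G i k" and ?D = "reduced_denominator scl G i"
  let ?f = "avg (closed_words (Suc i) k)" and ?B = "boundary k (Suc (Suc i)) ` closed_space k (Suc (Suc i))"
  let ?S = "(\<lambda>x. Poly_Mapping.single x (1::'a)) ` closed_words (Suc i) k"
  have fin: "finite ?S" using finite_closed_words by simp
  have sub: "free.subspace (closed_space k l)" for l
    unfolding closed_space_def using linear_avg subspace_keys
    by (rule linear_subspace_image)
  have B: "free.subspace ?B" using linear_boundary sub by (rule linear_subspace_image)
  have Bf: "?B \<subseteq> ?f ` ?V"
  proof
    fix v assume "v \<in> ?B"
    then obtain u where u: "u \<in> closed_space k (Suc (Suc i))" "v = boundary k (Suc (Suc i)) u" by blast
    have ut: "u \<in> tensor_free UNIV (Suc (Suc i))" using closed_spaceD(2)[OF k _ u(1)] by simp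
    have "hochschild_b u \<in> tensor_free UNIV (Suc i)" using ut by (intro hochschild_b_tensor_free) auto
    then have "v \<in> closed_space k (Suc i)" unfolding u(2) boundary_def by (simp add: closed_space_eq k)
    then show "v \<in> ?f ` ?V"
      unfolding avg_homogeneous_cycles[OF k] u(2) using boundary_boundary[OF k ut] by simp
  qed
  have fV: "?f ` ?V \<subseteq> free.span ?S"
    using keys_avg keys_subset_span[of "closed_words (Suc i) k"] by blast
  note q = quotient_dim_eq_image[OF linear_avg subspace_homogeneous_cycles _ fV fin B Bf reduced_denominator_iff[OF k]]
  show "reduced_HC_fin_dim scl G i k"
    unfolding reduced_HC_fin_dim_def by (rule q) (simp_all add: reduced_denominator_def)
  have "reduced_HC_dim scl G i k + boundary_rank k (Suc (Suc i)) = free.dim (?f ` ?V)"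
    unfolding reduced_HC_dim_def boundary_rank_def by (rule q) (simp_all add: reduced_denominator_def)
  moreover have "free.dim {u \<in> closed_space k (Suc i). boundary k (Suc i) u = 0} + boundary_rank k (Suc i) = closed_dim k (Suc i)"
    unfolding boundary_rank_def closed_dim_def
  proof (rule rank_nullity_subspace[OF linear_boundary sub _ fin])
    show "closed_space k (Suc i) \<subseteq> free.span ?S"
      unfolding closed_space_def using keys_avg keys_subset_span[of "closed_words (Suc i) k"] by blast
  qed
  ultimately show "reduced_HC_dim scl G i k + boundary_rank k (Suc (Suc i)) + boundary_rank k (Suc i) = closed_dim k (Suc i)"
    by (simp add: avg_homogeneous_cycles[OF k])
qed

end

section \<open>Internal degree zero\<close>

lemma (in vector_space) quotient_dim_eq_0:
  assumes "V \<subseteq> D" "subspace D" "subspace V"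
  shows "quotient_fin_dim V D" "quotient_dim V D = 0"
proof -
  have sp: "span D = D" using assms(2) by (rule span_eq_iff[THEN iffD2])
  have "quotient_basis V D {}" using assms(1) by (simp add: quotient_basis_def sp)
  then show "quotient_fin_dim V D" unfolding quotient_fin_dim_def by (intro exI[of _ "{}"]) simp
  have "S = {}" if "quotient_basis V D S" for S
  proof (rule ccontr)
    assume "S \<noteq> {}"
    then obtain v where v: "v \<in> S" by blast
    then have "v \<in> D" using that assms(1) by (auto simp: quotient_basis_def)
    then have "(\<Sum>x\<in>{v}. scale 1 x) \<in> D" by simp
    then have "\<forall>x\<in>{v}. (1::'a) = 0"
      using that v unfolding quotient_basis_def by (elim conjE allE[of _ "{v}"] allE[of _ "\<lambda>_. 1"]) auto
    then show False by simp
  qed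
  then show "quotient_dim V D = 0"
    unfolding quotient_dim_def using \<open>quotient_basis V D {}\<close> by (metis card.empty someI)
qed

context graded_arrow_basis begin

lemma degree_zero_projection:
  "\<exists>\<pi>. (\<forall>k a b. \<pi> (scl k a + b) = scl k (\<pi> a) + \<pi> b) \<and> (\<forall>x. \<pi> x \<in> G 0) \<and> (\<forall>x\<in>G 0. \<pi> x = x)"
proof -
  interpret pr: vector_space_pair scl scl ..
  obtain \<pi> where \<pi>: "Vector_Spaces.linear scl scl \<pi>" "\<forall>x\<in>letters. \<pi> x = (if deg x = 0 then x else 0)"
    using pr.linear_independent_extend[OF independent_letters, of "\<lambda>x. if deg x = 0 then x else 0"]
    by (elim exE conjE) (rule that)
  interpret \<pi>: Vector_Spaces.linear scl scl \<pi> by fact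
  show ?thesis
  proof (intro exI[of _ \<pi>] conjI allI ballI)
    fix k a b
    show "\<pi> (scl k a + b) = scl k (\<pi> a) + \<pi> b" by (simp add: \<pi>.add \<pi>.scale)
  next
    fix x
    show "\<pi> x \<in> G 0"
    proof -
      have "x \<in> span letters" by simp
      then show ?thesis
        by (induction rule: span_induct_alt)
          (use \<pi>(2) in \<open>auto simp: G_eq \<pi>.add \<pi>.scale \<pi>.zero span_zero intro!: span_add span_scale intro: span_base simp del: Un_iff\<close>)
    qed
  next
    fix x assume "x \<in> G 0"
    then show "\<pi> x = x" unfolding G_eq
      by (induction rule: span_induct_alt) (use \<pi>(2) in \<open>simp_all add: \<pi>.add \<pi>.scale \<pi>.zero del: Un_iff\<close>)
  qed
qed

lemma G0_mult: "x \<in> G 0 \<Longrightarrow> y \<in> G 0 \<Longrightarrow> x * y \<in> G 0"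
  unfolding G_eq
proof (rule span_mult[where S = "{z \<in> letters. deg z = 0}" and T = "{z \<in> letters. deg z = 0}"])
  fix x y assume "x \<in> {z \<in> letters. deg z = 0}" "y \<in> {z \<in> letters. deg z = 0}"
  then show "x * y \<in> span {z \<in> letters. deg z = 0}" using letter_mult_degree[of x y] by simp
qed

text \<open>In degree zero all letters lie in \<open>\<Lambda>\<^sub>0\<close>, up to Connes relations of \<open>\<Lambda>\<close>. That the resulting chain
  over \<open>\<Lambda>\<^sub>0\<close> is a cycle over \<open>\<Lambda>\<^sub>0\<close>, and not merely over \<open>\<Lambda>\<close>, uses a linear projection onto
  \<open>\<Lambda>\<^sub>0\<close>.\<close>

lemma homogeneous_cycles_degree_zero: "homogeneous_cycles scl G i 0 \<subseteq> reduced_denominator scl G i"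
proof
  fix z assume z: "z \<in> homogeneous_cycles scl G i 0"
  then have "z \<in> free.span (homogeneous_tensors G (i + 1) 0 \<union> connes_relations scl UNIV (i + 1))"
    by (simp add: homogeneous_cycles_def)
  then obtain z0 r where zr: "z = z0 + r" and z0: "z0 \<in> free.span (homogeneous_tensors G (i + 1) 0)"
    and r: "r \<in> free.span (connes_relations scl UNIV (i + 1))"
    unfolding free.span_Un by blast
  have r: "r \<in> connes_relations scl UNIV (i + 1)" using r by (simp add: connes_relations_def free.span_span)
  have "homogeneous_tensors G (i + 1) 0 \<subseteq> (tensor_free (G 0) (i + 1) :: ('b list \<Rightarrow>\<^sub>0 'a) set)"
  proof
    fix g :: "'b list \<Rightarrow>\<^sub>0 'a" assume "g \<in> homogeneous_tensors G (i + 1) 0"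
    then obtain xs ds where g: "g = pure_tensor xs" "length xs = i + 1"
      and d: "list_all2 (\<lambda>x d. x \<in> G d) xs ds" "sum_list ds = 0"
      unfolding homogeneous_tensors_def by blast
    have "x \<in> G 0" if "x \<in> set xs" for x
      using that d by (auto simp: in_set_conv_nth list_all2_conv_all_nth sum_list_eq_0_iff) (metis nth_mem)
    then show "g \<in> tensor_free (G 0) (i + 1)" using g by (auto simp: pure_tensor_def intro: single_tensor_free)
  qed
  then have z0: "z0 \<in> tensor_free (G 0) (i + 1)"
    using z0 free.span_minimal[OF _ subspace_tensor_free] by blast
  have rt: "r \<in> tensor_free UNIV (i + 1)" using r connes_relations_subset_tensor_free[of "i + 1"] by auto
  have rc: "pairing r c = 0" if "multilinear_cochain c" "cyclic_cochain c" for c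
    using r rt that mem_connes_relations_iff[of "i + 1" r] by simp
  have b: "hochschild_b z0 \<in> tensor_free (G 0) i"
    using z0 by (intro hochschild_b_tensor_free G0_mult) auto
  have bz0: "pairing (hochschild_b z0) c = 0" if c: "multilinear_cochain c" "cyclic_cochain c" for c
    using homogeneous_cyclesD(2)[OF z c] rc[OF multilinear_cochain_coboundary[OF c(1)] cyclic_cochain_coboundary]
    by (simp add: pairing_hochschild_b c zr pairing_add)
  have "hochschild_b z0 \<in> connes_relations scl (G 0) i"
  proof (cases "i = 0")
    case True
    have "hochschild_b z0 = free_extend (\<lambda>xs. 0) z0"
      unfolding hochschild_b_def free_extend_def
      using z0 True by (intro sum.cong refl) (auto simp: tensor_free_def)
    then show ?thesis by (simp add: connes_relations_def free.span_zero)
  next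
    case False
    obtain \<pi> where \<pi>: "\<forall>k a b. \<pi> (scl k a + b) = scl k (\<pi> a) + \<pi> b" "\<forall>x. \<pi> x \<in> G 0" "\<forall>x\<in>G 0. \<pi> x = x"
      using degree_zero_projection by (elim exE conjE) (rule that)
    show ?thesis using False by (intro connes_relationsI[OF _ b \<pi>[rule_format] bz0]) auto
  qed
  then have "z0 \<in> connes_cycles scl (G 0) i" using z0 by (simp add: connes_cycles_def)
  moreover have "r \<in> connes_boundaries scl UNIV i"
    using r unfolding connes_boundaries_def by (intro free.span_base) simp
  ultimately show "z \<in> reduced_denominator scl G i"
    unfolding zr reduced_denominator_def by (intro free.span_add free.span_base) auto
qed

lemma reduced_HC_degree_zero: "reduced_HC_fin_dim scl G i 0" "reduced_HC_dim scl G i 0 = 0"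
proof -
  have D: "free.subspace (reduced_denominator scl G i)" by (simp add: reduced_denominator_def)
  note q = free.quotient_dim_eq_0[OF homogeneous_cycles_degree_zero D subspace_homogeneous_cycles]
  show "reduced_HC_fin_dim scl G i 0" "reduced_HC_dim scl G i 0 = 0"
    unfolding reduced_HC_fin_dim_def reduced_HC_dim_def by (rule q)+
qed

section \<open>The Euler characteristic\<close>

text \<open>The space of cyclic closed paths is the image of the averaging projection, so its dimension is the
  trace of that projection: each rotation contributes its sign times the number of its fixed words.\<close>

lemma closed_dim_eq:
  assumes "k \<noteq> 0" "l \<noteq> 0"
  shows "int (closed_dim k l * l) = (\<Sum>r<l. (-1) ^ (r * (l + 1)) * int (card {w \<in> closed_words l k. rotate r w = w}))"
proof -
  let ?X = "closed_words l k"
  have len: "length w = l" "set w \<subseteq> letters" if "w \<in> ?X" for w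
    using that by (auto simp: closed_words_def words_def)
  have "of_nat (closed_dim k l) = (\<Sum>w\<in>?X. Poly_Mapping.lookup (avg ?X (Poly_Mapping.single w 1)) w)"
    unfolding closed_dim_def closed_space_def
    using avg_idem[OF assms keys_closed_tensor_free]
    by (intro dim_projection_eq_trace linear_avg finite_closed_words keys_avg)
  also have "\<dots> = (\<Sum>w\<in>?X. (\<Sum>r<l. (-1) ^ (r * (l + 1)) * (if rotate r w = w then 1 else 0)) / of_nat l)"
  proof (rule sum.cong[OF refl])
    fix w assume w: "w \<in> ?X"
    have "Poly_Mapping.lookup (avg ?X (Poly_Mapping.single w 1)) w = (\<Sum>v\<in>?X. if v = w then dual w w / of_nat l else 0)"
      unfolding avg_def lookup_sum by (intro sum.cong) (auto simp: lookup_single when_def len)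
    also have "\<dots> = dual w w / of_nat l" using w finite_closed_words by simp
    also have "dual w w = (\<Sum>r<l. (-1) ^ (r * (l + 1)) * (if rotate r w = w then 1 else 0))"
      using len[OF w] by (simp add: dual_def extend_word cyclic_sum_def)
    finally show "Poly_Mapping.lookup (avg ?X (Poly_Mapping.single w 1)) w = (\<Sum>r<l. (-1) ^ (r * (l + 1)) * (if rotate r w = w then 1 else 0)) / of_nat l" .
  qed
  finally have "of_nat (closed_dim k l) * of_nat l
      = (\<Sum>w\<in>?X. \<Sum>r<l. (-1) ^ (r * (l + 1)) * (if rotate r w = w then 1 else 0 :: 'a))"
    using assms(2) by (simp add: sum_divide_distrib[symmetric])
  also have "\<dots> = (\<Sum>r<l. (-1) ^ (r * (l + 1)) * (\<Sum>w\<in>?X. if rotate r w = w then 1 else 0))"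
    by (subst sum.swap) (simp add: sum_distrib_left)
  also have "\<dots> = (\<Sum>r<l. (-1) ^ (r * (l + 1)) * of_nat (card {w \<in> ?X. rotate r w = w}))"
    by (simp add: sum.If_cases finite_closed_words Int_def)
  finally have "(of_int (int (closed_dim k l * l)) :: 'a)
     = of_int (\<Sum>r<l. (-1) ^ (r * (l + 1)) * int (card {w \<in> ?X. rotate r w = w}))"
    by simp
  then show ?thesis by (simp only: of_int_eq_iff)
qed

lemma boundary_rank_eq_0:
  assumes "closed_words l k = {} \<or> l = Suc 0"
  shows "boundary_rank k l = 0"
proof -
  interpret linear: Vector_Spaces.linear free_scale free_scale "boundary k l" by (rule linear_boundary)
  have "boundary k l ` closed_space k l \<subseteq> {0}"
  proof (cases "l = Suc 0")
    case True
    have "closed_words 0 k = {}" by (auto simp: closed_words_def words_def closed_path_def)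
    then show ?thesis by (auto simp: boundary_def True avg_def)
  next
    case False
    then show ?thesis using assms by (auto simp: closed_space_def avg_def linear.zero)
  qed
  then have "free.dim (boundary k l ` closed_space k l) \<le> card ({} :: ('b list \<Rightarrow>\<^sub>0 'a) set)"
    using free.dim_le_card[of "boundary k l ` closed_space k l" "{}"] by (auto simp: free.span_empty)
  then show ?thesis by (simp add: boundary_rank_def)
qed

lemma reduced_HC_dim_int:
  assumes "k \<noteq> 0"
  shows "int (reduced_HC_dim scl G i k) = int (closed_dim k (Suc i)) - int (boundary_rank k (Suc i)) - int (boundary_rank k (Suc (Suc i)))"
  using reduced_HC_dim_eq(2)[OF assms, of i] by simp

lemma closed_dim_eq_0: "closed_words l k = {} \<Longrightarrow> closed_dim k l = 0"
proof -
  assume "closed_words l k = {}"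
  then have "closed_space k l \<subseteq> free.span {}" by (auto simp: closed_space_def avg_def free.span_empty)
  then have "free.dim (closed_space k l) \<le> card ({} :: ('b list \<Rightarrow>\<^sub>0 'a) set)"
    using free.dim_le_card[of "closed_space k l" "{}"] by auto
  then show ?thesis by (simp add: closed_dim_def)
qed

lemma reduced_HC_dim_eq_0: "i \<ge> (H + 1) * k \<Longrightarrow> reduced_HC_dim scl G i k = 0"
proof (cases "k = 0")
  case False
  assume "i \<ge> (H + 1) * k"
  then have "closed_words (Suc i) k = {}" by (intro closed_words_empty) simp
  then show ?thesis using reduced_HC_dim_eq(2)[OF False, of i] closed_dim_eq_0 by simp
qed (simp add: reduced_HC_degree_zero)

lemma reduced_HC_support: "{i. reduced_HC_dim scl G i k \<noteq> 0} \<subseteq> {..<(H + 1) * k}"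
proof
  fix i assume i: "i \<in> {i. reduced_HC_dim scl G i k \<noteq> 0}"
  show "i \<in> {..<(H + 1) * k}"
  proof (rule ccontr)
    assume "i \<notin> {..<(H + 1) * k}"
    then have "(H + 1) * k \<le> i" by simp
    then show False using reduced_HC_dim_eq_0[of k i] i by simp
  qed
qed

lemma finite_reduced_HC: "finite {i. reduced_HC_dim scl G i k \<noteq> 0}"
  by (rule finite_subset[OF reduced_HC_support]) simp

text \<open>The ranks of the boundaries telescope. The first boundary maps to zero and no closed path is longer
  than \<open>(H + 1) k\<close>.\<close>

lemma euler_char_coeff:
  assumes k: "k \<noteq> 0"
  shows "fps_nth (graded_euler_char (reduced_HC_dim scl G)) k = (\<Sum>l = 1..(H + 1) * k. (-1) ^ (l - 1) * int (closed_dim k l))"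
proof -
  let ?J = "(H + 1) * k"
  let ?d = "\<lambda>j. int (reduced_HC_dim scl G j k)" and ?\<rho> = "\<lambda>l. int (boundary_rank k l)"
  have tel: "(\<Sum>j<J. (-1) ^ j * (?\<rho> (Suc j) + ?\<rho> (Suc (Suc j)))) = ?\<rho> (Suc 0) - (-1) ^ J * ?\<rho> (Suc J)" for J
    by (induction J) (simp_all add: algebra_simps)
  have "fps_nth (graded_euler_char (reduced_HC_dim scl G)) k = (\<Sum>j | reduced_HC_dim scl G j k \<noteq> 0. (-1) ^ j * ?d j)"
    by (simp add: graded_euler_char_def)
  also have "\<dots> = (\<Sum>j<?J. (-1) ^ j * ?d j)"
    by (rule sum.mono_neutral_left[OF _ reduced_HC_support]) auto
  also have "\<dots> = (\<Sum>j<?J. (-1) ^ j * int (closed_dim k (Suc j))) - (\<Sum>j<?J. (-1) ^ j * (?\<rho> (Suc j) + ?\<rho> (Suc (Suc j))))"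
    unfolding sum_subtractf[symmetric] by (intro sum.cong) (simp_all add: reduced_HC_dim_int k algebra_simps)
  also have "(\<Sum>j<?J. (-1) ^ j * (?\<rho> (Suc j) + ?\<rho> (Suc (Suc j)))) = 0"
    unfolding tel using boundary_rank_eq_0[of "Suc 0" k] boundary_rank_eq_0[of "Suc ?J" k] closed_words_empty[of k "Suc ?J"] by simp
  also have "(\<Sum>j<?J. (-1) ^ j * int (closed_dim k (Suc j))) = (\<Sum>l = 1..?J. (-1) ^ (l - 1) * int (closed_dim k l))"
    by (rule sum.reindex_bij_witness[of _ "\<lambda>l. l - 1" Suc]) auto
  finally show ?thesis by simp
qed

end

section \<open>Logarithmic derivatives of power series\<close>

text \<open>The relation \<open>x f' = f g\<close> avoids division and makes sense for truncated products; the coefficients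
  of \<open>f\<close> up to a given order are determined by those of \<open>g\<close> and the constant term.\<close>

definition is_log_deriv :: "'k::field_char_0 fps \<Rightarrow> 'k fps \<Rightarrow> bool" where
  "is_log_deriv f g \<longleftrightarrow> fps_X * fps_deriv f = f * g"

lemma is_log_deriv_mult:
  "is_log_deriv f g \<Longrightarrow> is_log_deriv f' g' \<Longrightarrow> is_log_deriv (f * f') (g + g')"
proof -
  assume "is_log_deriv f g" "is_log_deriv f' g'"
  then have "fps_X * fps_deriv f = f * g" "fps_X * fps_deriv f' = f' * g'" by (simp_all add: is_log_deriv_def)
  then have "f' * (fps_X * fps_deriv f) + f * (fps_X * fps_deriv f') = f' * (f * g) + f * (f' * g')" by simp
  then show ?thesis by (simp add: is_log_deriv_def algebra_simps)
qed

lemma is_log_deriv_one: "is_log_deriv 1 0"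
  by (simp add: is_log_deriv_def)

lemma is_log_deriv_prod:
  "(\<And>i. i \<in> A \<Longrightarrow> is_log_deriv (f i) (g i)) \<Longrightarrow> is_log_deriv (\<Prod>i\<in>A. f i) (\<Sum>i\<in>A. g i)"
  by (induction A rule: infinite_finite_induct) (simp_all add: is_log_deriv_one is_log_deriv_mult)

lemma is_log_deriv_power: "is_log_deriv f g \<Longrightarrow> is_log_deriv (f ^ m) (of_nat m * g)"
  by (induction m) (simp_all add: is_log_deriv_one is_log_deriv_mult distrib_right)

lemma is_log_deriv_inverse:
  assumes "is_log_deriv f g" "fps_nth f 0 \<noteq> 0"
  shows "is_log_deriv (inverse f) (- g)"
proof -
  have i: "f * inverse f = 1" using assms(2) by (simp add: inverse_mult_eq_1')
  have "fps_X * fps_deriv (f * inverse f) = 0" using i by simp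
  then have "fps_X * fps_deriv f * inverse f + f * (fps_X * fps_deriv (inverse f)) = 0"
    by (simp add: algebra_simps)
  then have "f * g * inverse f + f * (fps_X * fps_deriv (inverse f)) = 0"
    using assms(1) by (simp add: is_log_deriv_def)
  then have eq: "f * (fps_X * fps_deriv (inverse f)) = f * (inverse f * - g)"
    by (simp add: algebra_simps eq_neg_iff_add_eq_0)
  have "f \<noteq> 0" using assms(2) by auto
  from mult_left_cancel[THEN iffD1, OF this eq] show ?thesis by (simp only: is_log_deriv_def)
qed

lemma is_log_deriv_powi:
  assumes "is_log_deriv f g" "fps_nth f 0 \<noteq> 0"
  shows "is_log_deriv (f powi m) (of_int m * g)"
proof (cases "m \<ge> 0")
  case True
  then obtain k where "m = int k" by (metis nat_0_le)
  then show ?thesis using is_log_deriv_power[OF assms(1)] by simp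
next
  case False
  then obtain k where k: "m = - int k" by (metis int_cases2 of_nat_0_le_iff)
  have "f powi m = inverse f ^ k" by (cases "k = 0") (simp_all add: k power_int_def)
  then show ?thesis using is_log_deriv_power[OF is_log_deriv_inverse[OF assms], of k]
    by (simp add: k)
qed

lemma is_log_deriv_unique:
  assumes f: "is_log_deriv f g" "fps_nth f 0 = 1" and f': "is_log_deriv f' g'" "fps_nth f' 0 = 1"
    and g: "\<And>i. 0 < i \<Longrightarrow> i \<le> K \<Longrightarrow> fps_nth g i = fps_nth g' i" and m: "m \<le> K"
  shows "fps_nth f m = fps_nth f' m"
  using m
proof (induction m rule: less_induct)
  case (less m)
  have rec: "of_nat m * fps_nth f m = (\<Sum>i<m. fps_nth f i * fps_nth g (m - i))"
    if f: "is_log_deriv f g" "fps_nth f 0 = 1" for f g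
  proof -
    have "fps_nth (fps_X * fps_deriv f) 0 = fps_nth (f * g) 0" using f by (simp add: is_log_deriv_def)
    then have g0: "fps_nth g 0 = 0" using f by simp
    have "of_nat m * fps_nth f m = fps_nth (fps_X * fps_deriv f) m" by (cases m) auto
    also have "\<dots> = (\<Sum>i=0..m. fps_nth f i * fps_nth g (m - i))"
      using f by (simp add: is_log_deriv_def fps_mult_nth)
    also have "{0..m} = insert m {..<m}" by auto
    finally show ?thesis by (simp add: g0)
  qed
  show ?case
  proof (cases "m = 0")
    case False
    have "of_nat m * fps_nth f m = of_nat m * fps_nth f' m"
      unfolding rec[OF f] rec[OF f'] using less g by (intro sum.cong) auto
    then show ?thesis using False by simp
  qed (use f f' in simp)
qed

lemma is_log_deriv_compose_X_power:
  assumes "is_log_deriv f g" "s > 0"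
  shows "is_log_deriv (f oo fps_X ^ s) (of_nat s * (g oo fps_X ^ s))"
proof -
  have z: "fps_nth (fps_X ^ s) 0 = (0 :: 'a)" using assms(2) by simp
  have "fps_X * fps_deriv (f oo fps_X ^ s) = of_nat s * ((fps_X * fps_deriv f) oo fps_X ^ s)"
  proof (rule fps_ext)
    fix m
    have *: "fps_nth (fps_X * fps_deriv h) j = of_nat j * fps_nth h j" for h :: "'a fps" and j
      by (cases j) auto
    show "fps_nth (fps_X * fps_deriv (f oo fps_X ^ s)) m = fps_nth (of_nat s * ((fps_X * fps_deriv f) oo fps_X ^ s)) m"
      unfolding * fps_mult_of_nat_nth fps_nth_compose_X_power
      using assms(2) by (auto elim!: dvdE)
  qed
  also have "\<dots> = of_nat s * ((f oo fps_X ^ s) * (g oo fps_X ^ s))"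
    using assms(1) by (simp add: is_log_deriv_def fps_compose_mult_distrib[OF z])
  finally show ?thesis by (simp add: is_log_deriv_def algebra_simps)
qed

definition multiples :: "nat \<Rightarrow> 'k::field_char_0 fps" where
  "multiples k = Abs_fps (\<lambda>m. if m \<noteq> 0 \<and> k dvd m then 1 else 0)"

lemma is_log_deriv_one_minus_X_power:
  assumes "k > 0"
  shows "is_log_deriv (1 - fps_X ^ k) (- of_nat k * multiples k :: 'k::field_char_0 fps)"
proof -
  have "(1 - fps_X ^ k) * multiples k = (fps_X ^ k :: 'k fps)"
  proof (rule fps_ext)
    fix m
    have "fps_nth ((1 - fps_X ^ k) * multiples k) m
        = fps_nth (multiples k) m - (if m < k then 0 else fps_nth (multiples k :: 'k fps) (m - k))"
      by (simp add: left_diff_distrib fps_X_power_mult_nth)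
    also have "\<dots> = fps_nth (fps_X ^ k :: 'k fps) m"
    proof (cases m k rule: linorder_cases)
      case less
      then have "\<not> (m \<noteq> 0 \<and> k dvd m)" by (auto dest: dvd_imp_le)
      then show ?thesis using less by (simp add: multiples_def fps_X_power_nth)
    next
      case greater
      then have "k dvd m - k \<longleftrightarrow> k dvd m" by (simp add: dvd_minus_self)
      then show ?thesis using greater by (simp add: multiples_def fps_X_power_nth)
    qed (use assms in \<open>simp add: multiples_def fps_X_power_nth\<close>)
    finally show "fps_nth ((1 - fps_X ^ k) * multiples k) m = fps_nth (fps_X ^ k :: 'k fps) m" .
  qed
  moreover have "fps_X * fps_deriv (1 - fps_X ^ k) = (- of_nat k * fps_X ^ k :: 'k fps)"
  proof -
    obtain j where k: "k = Suc j" using assms by (cases k) auto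
    have "fps_deriv (1 - fps_X ^ k) = (- of_nat k * fps_X ^ j :: 'k fps)"
      unfolding k by (simp add: fps_deriv_power' algebra_simps del: power_Suc)
    then show ?thesis unfolding k by (simp only: power_Suc mult.left_commute)
  qed
  ultimately show ?thesis by (simp add: is_log_deriv_def mult.left_commute)
qed

section \<open>Infinite products of power series\<close>

lemma fps_nth_0_prod: "fps_nth (\<Prod>i\<in>A. f i) 0 = (\<Prod>i\<in>A. fps_nth (f i :: 'k::comm_ring_1 fps) 0)"
  by (induction A rule: infinite_finite_induct) simp_all

text \<open>Since the \<open>k\<close>-th factor is \<open>1\<close> up to order \<open>k\<close>, each coefficient of the partial products is
  eventually constant.\<close>

lemma fps_prodinf:
  fixes f :: "nat \<Rightarrow> 'k::field_char_0 fps"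
  assumes f0: "\<And>k. fps_nth (f k) 0 = 1" and f: "\<And>k m. 0 < m \<Longrightarrow> m \<le> k \<Longrightarrow> fps_nth (f k) m = 0"
  shows "convergent_prod f" "fps_nth (prodinf f) m = fps_nth (\<Prod>k\<le>m. f k) m"
proof -
  have next_coeff: "fps_nth (\<Prod>k\<le>Suc N. f k) m = fps_nth (\<Prod>k\<le>N. f k) m" if "m \<le> N" for m N
  proof -
    have "fps_nth ((\<Prod>k\<le>N. f k) * f (Suc N)) m = (\<Sum>i=0..m. fps_nth (\<Prod>k\<le>N. f k) i * fps_nth (f (Suc N)) (m - i))"
      by (simp add: fps_mult_nth)
    also have "\<dots> = (\<Sum>i\<in>{m}. fps_nth (\<Prod>k\<le>N. f k) i * fps_nth (f (Suc N)) (m - i))"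
      using that f by (intro sum.mono_neutral_right) auto
    finally show ?thesis by (simp add: f0 mult.commute)
  qed
  have stable: "fps_nth (\<Prod>k\<le>N. f k) m = fps_nth (\<Prod>k\<le>m. f k) m" if "m \<le> N" for m N
    using that
  proof (induction rule: dec_induct)
    case (step N)
    then show ?case using next_coeff[of m N] by simp
  qed simp
  define Q where "Q = Abs_fps (\<lambda>m. fps_nth (\<Prod>k\<le>m. f k) m)"
  have "(\<lambda>n. \<Prod>k\<le>n. f k) \<longlonglongrightarrow> Q"
  proof (rule tendsto_fpsI)
    fix m
    show "eventually (\<lambda>n. fps_nth (\<Prod>k\<le>n. f k) m = fps_nth Q m) sequentially"
      using eventually_ge_at_top[of m]
      by eventually_elim (unfold Q_def fps_nth_Abs_fps, rule stable)
  qed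
  moreover have "fps_nth Q 0 = 1" by (simp add: Q_def f0)
  then have "Q \<noteq> 0" by auto
  ultimately have "raw_has_prod f 0 Q" by (simp add: raw_has_prod_def)
  then show "convergent_prod f" by (auto simp: convergent_prod_def)
  have "f has_prod Q" using \<open>raw_has_prod f 0 Q\<close> by (simp add: has_prod_def)
  then have "prodinf f = Q" by (metis has_prod_unique)
  then show "fps_nth (prodinf f) m = fps_nth (\<Prod>k\<le>m. f k) m" by (simp add: Q_def)
qed

lemma fps_nth_0_powi: "fps_nth (f :: 'k::field_char_0 fps) 0 = 1 \<Longrightarrow> fps_nth (f powi m) 0 = 1"
proof (cases "m \<ge> 0")
  case True
  assume "fps_nth f 0 = 1"
  then show ?thesis using True by (simp add: power_int_def fps_nth_power_0)
next
  case False
  assume "fps_nth f 0 = 1"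
  then show ?thesis using False by (simp add: power_int_def fps_nth_power_0)
qed

text \<open>A power series is \<open>1\<close> up to order \<open>K\<close> if and only if its logarithmic derivative vanishes up to order
  \<open>K\<close>, and taking powers scales the latter.\<close>

lemma fps_vanish_powi:
  fixes f :: "'k::field_char_0 fps"
  assumes f0: "fps_nth f 0 = 1" and f: "\<And>m. 0 < m \<Longrightarrow> m \<le> K \<Longrightarrow> fps_nth f m = 0" and m: "0 < m" "m \<le> K"
  shows "fps_nth (f powi j) m = 0"
proof -
  have ld: "is_log_deriv f (inverse f * (fps_X * fps_deriv f))"
    unfolding is_log_deriv_def using inverse_mult_eq_1'[of f] f0 by (simp add: mult.assoc[symmetric])
  have "fps_nth (inverse f * (fps_X * fps_deriv f)) i = 0" if "i \<le> K" for i
    unfolding fps_mult_nth[of "inverse f"]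
  proof (rule sum.neutral, rule ballI)
    fix l assume "l \<in> {0..i}"
    moreover have "fps_nth (fps_X * fps_deriv f) r = 0" if "r \<le> K" for r
      using f[of r] that by (cases r) auto
    moreover have "i - l \<le> K" using that by simp
    ultimately have z: "fps_nth (fps_X * fps_deriv f) (i - l) = 0" by blast
    show "fps_nth (inverse f) l * fps_nth (fps_X * fps_deriv f) (i - l) = 0"
      unfolding z by simp
  qed
  then have "fps_nth (f powi j) m = fps_nth 1 m"
    using m f0 by (intro is_log_deriv_unique[OF is_log_deriv_powi[OF ld] _ is_log_deriv_one _ _ m(2)])
      (simp_all add: fps_nth_0_powi fps_mult_of_int_nth)
  then show ?thesis using m by simp
qed

section \<open>The product formula\<close>

text \<open>Both products have logarithmic derivatives that can be read off factor by factor, so it suffices to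
  compare coefficients: \<open>\<Sum>\<^bsub>k | i\<^esub> k a\<^sub>k\<close> equals
  \<open>\<Sum>\<^bsub>d | i\<^esub> d L\<^sub>d \<Sum>\<^bsub>u | i/d\<^esub> \<phi>(u) = i \<Sum>\<^bsub>d | i\<^esub> L\<^sub>d\<close>.\<close>

lemma product_formula:
  fixes F :: "rat fps" and L :: "nat \<Rightarrow> rat" and a :: "nat \<Rightarrow> int"
  assumes F0: "fps_nth F 0 = 1" and F: "is_log_deriv F (Abs_fps (\<lambda>m. of_nat m * L m))"
    and a: "\<And>k. k > 0 \<Longrightarrow> of_nat k * of_int (a k) = (\<Sum>d | d dvd k. of_nat (d * totient (k div d)) * L d)"
  shows "convergent_prod (\<lambda>k. (1 - fps_X ^ Suc k :: rat fps) powi (- a (Suc k)))"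
    and "convergent_prod (\<lambda>s. F oo fps_X ^ Suc s)"
    and "prodinf (\<lambda>k. (1 - fps_X ^ Suc k :: rat fps) powi (- a (Suc k))) = prodinf (\<lambda>s. F oo fps_X ^ Suc s)"
proof -
  let ?f = "\<lambda>k. (1 - fps_X ^ Suc k :: rat fps) powi (- a (Suc k))" and ?g = "\<lambda>s. F oo fps_X ^ Suc s"
  have f0: "fps_nth (?f k) 0 = 1" for k by (rule fps_nth_0_powi) simp
  have f: "fps_nth (?f k) m = 0" if "0 < m" "m \<le> k" for k m
    using that by (intro fps_vanish_powi[where K = k]) (auto simp: fps_X_power_nth simp del: power_Suc)
  have g0: "fps_nth (?g k) 0 = 1" for k by (simp add: fps_nth_compose_X_power F0 del: power_Suc)
  have g: "fps_nth (?g k) m = 0" if "0 < m" "m \<le> k" for k m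
    using that by (auto simp: fps_nth_compose_X_power simp del: power_Suc dest: dvd_imp_le)
  show "convergent_prod ?f" "convergent_prod ?g"
    using fps_prodinf(1)[of ?f, OF f0 f] fps_prodinf(1)[of ?g, OF g0 g] by simp_all
  show "prodinf ?f = prodinf ?g"
  proof (rule fps_ext)
    fix m
    define \<Lambda> where "\<Lambda> = Abs_fps (\<lambda>m. of_nat m * L m)"
    have 1: "is_log_deriv (\<Prod>k\<le>m. ?f k) (\<Sum>k\<le>m. of_int (- a (Suc k)) * (- of_nat (Suc k) * multiples (Suc k)))"
      by (intro is_log_deriv_prod is_log_deriv_powi is_log_deriv_one_minus_X_power) auto
    have 2: "is_log_deriv (\<Prod>k\<le>m. ?g k) (\<Sum>k\<le>m. of_nat (Suc k) * (\<Lambda> oo fps_X ^ Suc k))"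
      unfolding \<Lambda>_def by (intro is_log_deriv_prod is_log_deriv_compose_X_power F) auto
    have "fps_nth (\<Prod>k\<le>m. ?f k) m = fps_nth (\<Prod>k\<le>m. ?g k) m"
    proof (rule is_log_deriv_unique[OF 1 _ 2])
      show "fps_nth (\<Prod>k\<le>m. ?f k) 0 = 1" "fps_nth (\<Prod>k\<le>m. ?g k) 0 = 1"
        by (simp_all only: fps_nth_0_prod f0 g0 prod.neutral_const)
      show "m \<le> m" by simp
      fix i assume i: "0 < i" "i \<le> m"
      have suc: "(\<Sum>k\<le>m. if Suc k dvd i then h (Suc k) else 0) = (\<Sum>k | k dvd i. h k)" for h :: "nat \<Rightarrow> rat"
      proof -
        have "(\<Sum>k\<le>m. if Suc k dvd i then h (Suc k) else 0) = (\<Sum>k\<in>{k. k \<le> m \<and> Suc k dvd i}. h (Suc k))"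
          by (intro sum.mono_neutral_cong_right) auto
        also have "\<dots> = (\<Sum>k | k dvd i. h k)"
          by (rule sum.reindex_bij_witness[of _ "\<lambda>k. k - 1" Suc]) (use i in \<open>auto dest: dvd_imp_le intro!: Nat.gr0I\<close>)
        finally show ?thesis .
      qed
      have "fps_nth (\<Sum>k\<le>m. of_int (- a (Suc k)) * (- of_nat (Suc k) * multiples (Suc k))) i
        = (\<Sum>k\<le>m. if Suc k dvd i then of_nat (Suc k) * of_int (a (Suc k)) else 0 :: rat)"
        unfolding fps_sum_nth using i
        by (intro sum.cong) (auto simp: fps_mult_of_int_nth fps_mult_of_nat_nth multiples_def simp del: of_nat_Suc)
      also have "\<dots> = (\<Sum>k | k dvd i. of_nat k * of_int (a k))" by (rule suc)
      also have "\<dots> = (\<Sum>k | k dvd i. \<Sum>d | d dvd k. of_nat (d * totient (k div d)) * L d)"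
        using i by (intro sum.cong refl a) (auto intro!: Nat.gr0I)
      also have "\<dots> = (\<Sum>d | d dvd i. \<Sum>u | u dvd i div d. of_nat (d * totient u) * L d)"
      proof -
        have fin: "finite {k. k dvd i}" "\<And>k. k dvd i \<Longrightarrow> finite {d. d dvd k}"
          using i by (auto intro: finite_divisors_nat dest: dvd_pos_nat)
        have h1: "d * u dvd i" if "d dvd i" "u dvd i div d" for d u
          using mult_dvd_mono[OF dvd_refl[of d] that(2)] that(1) by simp
        have h2: "d dvd i" "k div d dvd i div d" if "k dvd i" "d dvd k" for d k
        proof -
          show "d dvd i" using that by (rule dvd_trans[rotated])
          then show "k div d dvd i div d" using that by (simp add: div_dvd_div)
        qed
        have h3: "d \<noteq> 0" if "d dvd i" for d using that i by auto
        have "(\<Sum>k | k dvd i. \<Sum>d | d dvd k. of_nat (d * totient (k div d)) * L d)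
          = (\<Sum>(k, d)\<in>Sigma {k. k dvd i} (\<lambda>k. {d. d dvd k}). of_nat (d * totient (k div d)) * L d)"
          using fin by (subst sum.Sigma) auto
        also have "\<dots> = (\<Sum>(d, u)\<in>Sigma {d. d dvd i} (\<lambda>d. {u. u dvd i div d}). of_nat (d * totient u) * L d)"
          by (rule sum.reindex_bij_witness[of _ "\<lambda>(d, u). (d * u, d)" "\<lambda>(k, d). (d, k div d)"])
            (auto simp: h1 h2 h3 split: prod.splits)
        also have "\<dots> = (\<Sum>d | d dvd i. \<Sum>u | u dvd i div d. of_nat (d * totient u) * L d)"
        proof (subst sum.Sigma)
          show "\<forall>d\<in>{d. d dvd i}. finite {u. u dvd i div d}"
          proof
            fix d assume "d \<in> {d. d dvd i}"
            then have "i div d > 0" using i by (auto simp: div_greater_zero_iff dest: dvd_imp_le intro!: Nat.gr0I)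
            then show "finite {u. u dvd i div d}" by (rule finite_divisors_nat)
          qed
        qed (use fin in auto)
        finally show ?thesis .
      qed
      also have "\<dots> = (\<Sum>d | d dvd i. of_nat d * L d * of_nat (\<Sum>u | u dvd i div d. totient u))"
        by (simp add: sum_distrib_left mult_ac)
      also have "\<dots> = (\<Sum>d | d dvd i. of_nat i * L d)"
        unfolding totient_divisor_sum by (intro sum.cong refl) (auto elim!: dvdE)
      also have "\<dots> = (\<Sum>k | k dvd i. of_nat i * L (i div k))"
        by (rule sum.reindex_bij_witness[of _ "\<lambda>k. i div k" "\<lambda>k. i div k"]) (use i in \<open>auto elim!: dvdE\<close>)
      also have "\<dots> = (\<Sum>k | k dvd i. of_nat k * (of_nat (i div k) * L (i div k)))"
        by (intro sum.cong refl) (auto elim!: dvdE)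
      also have "\<dots> = (\<Sum>k\<le>m. if Suc k dvd i then of_nat (Suc k) * (of_nat (i div Suc k) * L (i div Suc k)) else 0)"
        by (rule suc[symmetric])
      also have "\<dots> = fps_nth (\<Sum>k\<le>m. of_nat (Suc k) * (\<Lambda> oo fps_X ^ Suc k)) i"
        unfolding fps_sum_nth
        by (intro sum.cong) (auto simp: fps_mult_of_nat_nth fps_nth_compose_X_power \<Lambda>_def simp del: of_nat_Suc power_Suc)
      finally show "fps_nth (\<Sum>k\<le>m. of_int (- a (Suc k)) * (- of_nat (Suc k) * multiples (Suc k))) i
        = fps_nth (\<Sum>k\<le>m. of_nat (Suc k) * (\<Lambda> oo fps_X ^ Suc k)) i" .
    qed
    then show "fps_nth (prodinf ?f) m = fps_nth (prodinf ?g) m"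
      using fps_prodinf(2)[of ?f m, OF f0 f] fps_prodinf(2)[of ?g m, OF g0 g] by simp
  qed
qed

section \<open>The logarithmic derivative of a determinant\<close>

text \<open>Matrices of power series are represented here by functions of their indices, which makes traces of
  powers into plain finite sums.\<close>

primrec mat_power :: "nat \<Rightarrow> (nat \<Rightarrow> nat \<Rightarrow> 'r::comm_ring_1) \<Rightarrow> nat \<Rightarrow> nat \<Rightarrow> nat \<Rightarrow> 'r" where
  "mat_power n N 0 i j = (if i = j then 1 else 0)"
| "mat_power n N (Suc d) i j = (\<Sum>k<n. N i k * mat_power n N d k j)"

lemma sum_delta_mult:
  fixes n :: nat and f :: "nat \<Rightarrow> 'r::comm_ring_1"
  assumes "i < n"
  shows "(\<Sum>k<n. (if i = k then 1 else 0) * f k) = f i" "(\<Sum>k<n. (if k = i then 1 else 0) * f k) = f i"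
    "(\<Sum>k<n. f k * (if i = k then 1 else 0)) = f i" "(\<Sum>k<n. f k * (if k = i then 1 else 0)) = f i"
proof -
  have 1: "(\<Sum>k<n. (if i = k then 1 else 0) * f k) = (\<Sum>k<n. if i = k then f k else 0)"
    by (intro sum.cong) auto
  then show "(\<Sum>k<n. (if i = k then 1 else 0) * f k) = f i" using assms by simp
  then show "(\<Sum>k<n. (if k = i then 1 else 0) * f k) = f i"
    "(\<Sum>k<n. f k * (if i = k then 1 else 0)) = f i" "(\<Sum>k<n. f k * (if k = i then 1 else 0)) = f i"
    by (simp_all only: mult.commute[of _ "if _ then _ else _"] eq_commute[of _ i])
qed

lemma mat_power_add:
  assumes "i < n"
  shows "mat_power n N (d + d') i j = (\<Sum>k<n. mat_power n N d i k * mat_power n N d' k j)"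
  using assms
proof (induction d arbitrary: i)
  case 0
  then show ?case by (simp add: sum_delta_mult)
next
  case (Suc d)
  have "mat_power n N (Suc d + d') i j = (\<Sum>l<n. N i l * (\<Sum>k<n. mat_power n N d l k * mat_power n N d' k j))"
    by (simp add: Suc.IH)
  also have "\<dots> = (\<Sum>k<n. \<Sum>l<n. N i l * mat_power n N d l k * mat_power n N d' k j)"
    by (subst sum.swap) (simp add: sum_distrib_left mult.assoc)
  finally show ?case by (simp add: sum_distrib_right)
qed

lemma mat_power_Suc_right:
  "i < n \<Longrightarrow> j < n \<Longrightarrow> mat_power n N (Suc d) i j = (\<Sum>k<n. mat_power n N d i k * N k j)"
  using mat_power_add[of i n N d "Suc 0" j] by (simp add: sum_delta_mult)

lemma fps_deriv_prod:
  assumes "finite S"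
  shows "fps_deriv (\<Prod>i\<in>S. f i :: 'r::comm_ring_1 fps) = (\<Sum>i\<in>S. fps_deriv (f i) * (\<Prod>j\<in>S - {i}. f j))"
  using assms
proof (induction S rule: finite_induct)
  case (insert x S)
  have "(\<Prod>j\<in>insert x S - {i}. f j) = f x * (\<Prod>j\<in>S - {i}. f j)" if "i \<in> S" for i
  proof -
    have "insert x S - {i} = insert x (S - {i})" using insert that by auto
    then show ?thesis using insert by simp
  qed
  moreover have "insert x S - {x} = S" using insert by auto
  ultimately show ?case using insert
    by (simp add: sum_distrib_left mult.left_commute)
qed simp

text \<open>Jacobi's formula: differentiating the Leibniz expansion gives one determinant for each row, with that
  row differentiated, and Laplace expansion along this row produces the cofactors.\<close>

lemma fps_deriv_det:
  fixes A :: "'r::comm_ring_1 fps mat"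
  assumes A: "A \<in> carrier_mat n n"
  shows "fps_deriv (Determinant.det A) = (\<Sum>i<n. \<Sum>j<n. fps_deriv (A $$ (i, j)) * cofactor A i j)"
proof -
  let ?P = "{p. p permutes {0..<n}}"
  define R where "R i = mat n n (\<lambda>(k, j). if k = i then fps_deriv (A $$ (i, j)) else A $$ (k, j))" for i
  have R: "R i \<in> carrier_mat n n" for i by (simp add: R_def)
  have sgn: "fps_deriv (signof p * g) = signof p * fps_deriv g" for p and g :: "'r fps"
    by (simp add: sign_def)
  have "fps_deriv (Determinant.det A) = (\<Sum>p\<in>?P. signof p * (\<Sum>i\<in>{0..<n}. fps_deriv (A $$ (i, p i)) * (\<Prod>k\<in>{0..<n} - {i}. A $$ (k, p k))))"
    unfolding det_def'[OF A] fps_deriv_sum sgn by (simp only: fps_deriv_prod finite_atLeastLessThan)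
  also have "\<dots> = (\<Sum>i\<in>{0..<n}. \<Sum>p\<in>?P. signof p * (fps_deriv (A $$ (i, p i)) * (\<Prod>k\<in>{0..<n} - {i}. A $$ (k, p k))))"
    unfolding sum_distrib_left by (rule sum.swap)
  also have "\<dots> = (\<Sum>i\<in>{0..<n}. Determinant.det (R i))"
  proof (rule sum.cong[OF refl])
    fix i assume i: "i \<in> {0..<n}"
    show "(\<Sum>p\<in>?P. signof p * (fps_deriv (A $$ (i, p i)) * (\<Prod>k\<in>{0..<n} - {i}. A $$ (k, p k)))) = Determinant.det (R i)"
      unfolding det_def'[OF R]
    proof (rule sum.cong[OF refl])
      fix p assume p: "p \<in> ?P"
      then have pl: "p k < n" if "k < n" for k using permutes_in_image[of p "{0..<n}" k] that by auto
      have "(\<Prod>k = 0..<n. R i $$ (k, p k)) = R i $$ (i, p i) * (\<Prod>k\<in>{0..<n} - {i}. R i $$ (k, p k))"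
        using i by (intro prod.remove) auto
      also have "R i $$ (i, p i) = fps_deriv (A $$ (i, p i))" using i pl by (simp add: R_def)
      also have "(\<Prod>k\<in>{0..<n} - {i}. R i $$ (k, p k)) = (\<Prod>k\<in>{0..<n} - {i}. A $$ (k, p k))"
        using pl by (intro prod.cong) (auto simp: R_def)
      finally show "signof p * (fps_deriv (A $$ (i, p i)) * (\<Prod>k\<in>{0..<n} - {i}. A $$ (k, p k)))
        = signof p * (\<Prod>k = 0..<n. R i $$ (k, p k))" by simp
    qed
  qed
  also have "\<dots> = (\<Sum>i\<in>{0..<n}. \<Sum>j<n. fps_deriv (A $$ (i, j)) * cofactor A i j)"
  proof (rule sum.cong[OF refl])
    fix i assume i: "i \<in> {0..<n}"
    have "mat_delete (R i) i j = mat_delete A i j" if "j < n" for j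
      using A i that by (intro eq_matI) (auto simp: mat_delete_def R_def)
    then show "Determinant.det (R i) = (\<Sum>j<n. fps_deriv (A $$ (i, j)) * cofactor A i j)"
      using i by (subst laplace_expansion_row[OF R, of i]) (auto simp: R_def cofactor_def intro!: sum.cong)
  qed
  finally show ?thesis by (simp add: atLeast0LessThan)
qed

text \<open>The powers \<open>N\<^sup>d\<close> have no coefficient of \<open>x\<^sup>m\<close> for \<open>d > bound m\<close>. So the logarithm series of
  \<open>1 + N\<close> is a finite sum in each degree although \<open>N\<close> may have a nonzero constant term.\<close>

locale nilpotent_perturbation =
  fixes n :: nat and N :: "nat \<Rightarrow> nat \<Rightarrow> 'k::field_char_0 fps" and bound :: "nat \<Rightarrow> nat"
  assumes vanish: "bound m < d \<Longrightarrow> i < n \<Longrightarrow> j < n \<Longrightarrow> fps_nth (mat_power n N d i j) m = 0"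
    and mono_bound: "m \<le> m' \<Longrightarrow> bound m \<le> bound m'"
begin

definition unit_mat :: "'k fps mat" where
  "unit_mat = mat n n (\<lambda>(i, j). (if i = j then 1 else 0) + N i j)"

definition trace_coeff :: "nat \<Rightarrow> nat \<Rightarrow> 'k" where
  "trace_coeff d m = (\<Sum>i<n. fps_nth (mat_power n N d i i) m)"

definition log_coeff :: "nat \<Rightarrow> 'k" where
  "log_coeff m = (\<Sum>d = 1..bound m. (-1) ^ (d - 1) / of_nat d * trace_coeff d m)"

abbreviation "P \<equiv> mat_power n N"

definition adj :: "nat \<Rightarrow> nat \<Rightarrow> 'k fps" where
  "adj j i = cofactor unit_mat i j"

definition deriv_trace :: "nat \<Rightarrow> 'k fps" where
  "deriv_trace d = (\<Sum>i<n. \<Sum>j<n. fps_deriv (N i j) * P d j i)"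

definition deriv_adj_trace :: "nat \<Rightarrow> 'k fps" where
  "deriv_adj_trace d = (\<Sum>i<n. \<Sum>j<n. fps_deriv (N i j) * (\<Sum>k<n. P d j k * adj k i))"

lemma unit_mat_carrier: "unit_mat \<in> carrier_mat n n"
  by (simp add: unit_mat_def)

lemma unit_mat_adj:
  assumes "l < n" "i < n"
  shows "(\<Sum>k<n. ((if l = k then 1 else 0) + N l k) * adj k i) = (if l = i then Determinant.det unit_mat else 0)"
proof -
  have "(unit_mat * adj_mat unit_mat) $$ (l, i) = (\<Sum>k<n. ((if l = k then 1 else 0) + N l k) * adj k i)"
    using assms unit_mat_carrier
    by (simp add: scalar_prod_def adj_mat_def adj_def unit_mat_def atLeast0LessThan)
  then show ?thesis using assms by (cases "l = i") (simp_all add: adj_mat(2)[OF unit_mat_carrier])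
qed

lemma P_unit_adj:
  assumes "j < n" "i < n"
  shows "(\<Sum>k<n. P d j k * adj k i) + (\<Sum>k<n. P (Suc d) j k * adj k i) = Determinant.det unit_mat * P d j i"
proof -
  have "P d j k + P (Suc d) j k = (\<Sum>l<n. P d j l * ((if l = k then 1 else 0) + N l k))" if "k < n" for k
    using assms that by (simp add: mat_power_Suc_right distrib_left sum.distrib sum_delta_mult del: mat_power.simps(2))
  then have "(\<Sum>k<n. P d j k * adj k i) + (\<Sum>k<n. P (Suc d) j k * adj k i)
      = (\<Sum>k<n. (\<Sum>l<n. P d j l * ((if l = k then 1 else 0) + N l k)) * adj k i)"
    unfolding sum.distrib[symmetric] distrib_right[symmetric] by (intro sum.cong) simp_all
  also have "\<dots> = (\<Sum>k<n. \<Sum>l<n. P d j l * (((if l = k then 1 else 0) + N l k) * adj k i))"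
    by (simp only: sum_distrib_right mult.assoc)
  also have "\<dots> = (\<Sum>l<n. P d j l * (\<Sum>k<n. ((if l = k then 1 else 0) + N l k) * adj k i))"
    by (subst sum.swap) (simp only: sum_distrib_left)
  also have "\<dots> = (\<Sum>l<n. P d j l * Determinant.det unit_mat * (if l = i then 1 else 0))"
    using assms by (intro sum.cong) (simp_all add: unit_mat_adj)
  also have "\<dots> = P d j i * Determinant.det unit_mat"
    using assms by (simp only: sum_delta_mult)
  finally show ?thesis by (simp add: mult.commute)
qed

text \<open>With \<open>M = 1 + N\<close> one has \<open>(N\<^sup>d + N\<^sup>d N) adj M = det M N\<^sup>d\<close>. Iterating this replaces the adjugate
  in Jacobi's formula by the alternating series of powers of \<open>N\<close>, up to a remainder of high order.\<close>

lemma deriv_adj_trace_Suc: "deriv_adj_trace d + deriv_adj_trace (Suc d) = Determinant.det unit_mat * deriv_trace d"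
proof -
  have "deriv_adj_trace d + deriv_adj_trace (Suc d) = (\<Sum>i<n. \<Sum>j<n. fps_deriv (N i j)
      * ((\<Sum>k<n. P d j k * adj k i) + (\<Sum>k<n. P (Suc d) j k * adj k i)))"
    by (simp add: deriv_adj_trace_def sum.distrib distrib_left del: mat_power.simps(2))
  also have "\<dots> = (\<Sum>i<n. \<Sum>j<n. fps_deriv (N i j) * (Determinant.det unit_mat * P d j i))"
    by (intro sum.cong refl arg_cong2[of _ _ _ _ "(*)"] P_unit_adj) auto
  finally show ?thesis by (simp add: deriv_trace_def sum_distrib_left mult.left_commute)
qed

lemma fps_deriv_det_unit_mat:
  "fps_deriv (Determinant.det unit_mat)
     = Determinant.det unit_mat * (\<Sum>d<D. (-1) ^ d * deriv_trace d) + (-1) ^ D * deriv_adj_trace D"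
proof (induction D)
  case 0
  have "fps_deriv (Determinant.det unit_mat) = (\<Sum>i<n. \<Sum>j<n. fps_deriv (N i j) * adj j i)"
    unfolding fps_deriv_det[OF unit_mat_carrier] by (intro sum.cong refl) (simp add: unit_mat_def adj_def)
  also have "\<dots> = deriv_adj_trace 0"
    unfolding deriv_adj_trace_def mat_power.simps(1)
    by (intro sum.cong refl arg_cong2[of _ _ _ _ "(*)"] sum_delta_mult(1)[symmetric]) auto
  finally show ?case by simp
next
  case (Suc D)
  have e: "deriv_adj_trace D = Determinant.det unit_mat * deriv_trace D - deriv_adj_trace (Suc D)"
    using deriv_adj_trace_Suc[of D] by (simp add: eq_diff_eq)
  show ?case unfolding Suc.IH by (subst e) (simp add: algebra_simps)
qed

text \<open>By cyclicity of the trace, all terms of the product rule for a power of \<open>N\<close> contribute equally.\<close>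

lemma deriv_power_trace:
  "(\<Sum>i<n. \<Sum>j<n. fps_deriv (P (Suc d) i j) * P e j i) = of_nat (Suc d) * deriv_trace (d + e)"
proof -
  define W where "W d e = (\<Sum>i<n. \<Sum>j<n. fps_deriv (P d i j) * P e j i)" for d e
  have step: "W (Suc d) e = W d (Suc e) + deriv_trace (e + d)" for d e
  proof -
    have "W (Suc d) e = (\<Sum>i<n. \<Sum>j<n. \<Sum>k<n. (fps_deriv (P d i k) * N k j + P d i k * fps_deriv (N k j)) * P e j i)"
      unfolding W_def
      by (intro sum.cong refl)
        (simp add: mat_power_Suc_right fps_deriv_sum sum_distrib_right add.commute del: mat_power.simps(2))
    also have "\<dots> = (\<Sum>i<n. \<Sum>j<n. \<Sum>k<n. fps_deriv (P d i k) * N k j * P e j i)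
        + (\<Sum>i<n. \<Sum>j<n. \<Sum>k<n. P d i k * fps_deriv (N k j) * P e j i)"
      by (simp add: distrib_right sum.distrib)
    also have "(\<Sum>i<n. \<Sum>j<n. \<Sum>k<n. fps_deriv (P d i k) * N k j * P e j i)
       = (\<Sum>i<n. \<Sum>k<n. \<Sum>j<n. fps_deriv (P d i k) * N k j * P e j i)"
      by (intro sum.cong refl sum.swap)
    also have "\<dots> = W d (Suc e)"
      unfolding W_def by (simp add: sum_distrib_left mult.assoc)
    also have "(\<Sum>i<n. \<Sum>j<n. \<Sum>k<n. P d i k * fps_deriv (N k j) * P e j i)
        = (\<Sum>i<n. \<Sum>k<n. \<Sum>j<n. P d i k * fps_deriv (N k j) * P e j i)"
      by (intro sum.cong refl sum.swap)
    also have "\<dots> = (\<Sum>k<n. \<Sum>i<n. \<Sum>j<n. P d i k * fps_deriv (N k j) * P e j i)" by (rule sum.swap)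
    also have "\<dots> = (\<Sum>k<n. \<Sum>j<n. \<Sum>i<n. P d i k * fps_deriv (N k j) * P e j i)"
      by (intro sum.cong refl sum.swap)
    also have "\<dots> = deriv_trace (e + d)"
      unfolding deriv_trace_def
    proof (intro sum.cong refl)
      fix k j assume "k \<in> {..<n}" "j \<in> {..<n}"
      then have "P (e + d) j k = (\<Sum>i<n. P e j i * P d i k)" by (intro mat_power_add) simp
      then show "(\<Sum>i<n. P d i k * fps_deriv (N k j) * P e j i) = fps_deriv (N k j) * P (e + d) j k"
        by (simp add: sum_distrib_left mult_ac)
    qed
    finally show ?thesis .
  qed
  have "W 0 e = 0" for e
    unfolding W_def by (intro sum.neutral ballI) simp
  then have "W (Suc d) e = of_nat (Suc d) * deriv_trace (d + e)" for e
  proof (induction d arbitrary: e)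
    case (Suc d)
    then show ?case unfolding step[of "Suc d"] by (simp add: algebra_simps)
  qed (simp add: step)
  then show ?thesis by (simp only: W_def)
qed

lemma deriv_trace_coeff:
  "fps_nth (fps_X * deriv_trace d) m = of_nat m / of_nat (Suc d) * trace_coeff (Suc d) m"
proof -
  have nth: "fps_nth (fps_X * fps_deriv h) m = of_nat m * fps_nth h m" for h :: "'k fps"
    by (cases m) auto
  have "of_nat (Suc d) * deriv_trace d = (\<Sum>i<n. \<Sum>j<n. fps_deriv (P (Suc d) i j) * (if j = i then 1 else 0))"
    using deriv_power_trace[of d 0] by (simp only: mat_power.simps(1) add_0_right)
  also have "\<dots> = (\<Sum>i<n. fps_deriv (P (Suc d) i i))"
    by (intro sum.cong refl) (simp only: lessThan_iff sum_delta_mult)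
  also have "\<dots> = fps_deriv (\<Sum>i<n. P (Suc d) i i)" by (simp only: fps_deriv_sum)
  finally have "of_nat (Suc d) * (fps_X * deriv_trace d) = fps_X * fps_deriv (\<Sum>i<n. P (Suc d) i i)"
    by (simp only: mult.left_commute)
  then have "of_nat (Suc d) * fps_nth (fps_X * deriv_trace d) m = of_nat m * trace_coeff (Suc d) m"
    by (metis (no_types, lifting) fps_mult_of_nat_nth(1) fps_sum_nth nth trace_coeff_def sum.cong)
  then show ?thesis by (simp add: field_simps del: of_nat_Suc)
qed

lemma fps_mult_vanish:
  fixes f g :: "'k fps"
  assumes "\<And>i. i \<le> m \<Longrightarrow> fps_nth f i = 0" "i \<le> m"
  shows "fps_nth (f * g) i = 0" "fps_nth (g * f) i = 0"
  using assms by (auto simp: fps_mult_nth intro!: sum.neutral)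

text \<open>The alternating series of \<open>tr (N' N\<^sup>d)\<close> is the termwise derivative of the logarithm series; the
  number of terms is chosen so large that the remainder starts beyond the coefficient at hand.\<close>

lemma is_log_deriv_det: "is_log_deriv (Determinant.det unit_mat) (Abs_fps (\<lambda>m. of_nat m * log_coeff m))"
  unfolding is_log_deriv_def
proof (rule fps_ext)
  fix M
  define D where "D = Suc (bound M)"
  let ?det = "Determinant.det unit_mat"
  let ?S = "\<Sum>d<D. (-1) ^ d * deriv_trace d"
  have zero: "fps_nth (P D i j) m = 0" if "m \<le> M" "i < n" "j < n" for m i j
    using that mono_bound[of m M] by (intro vanish) (auto simp: D_def)
  have van: "fps_nth (deriv_adj_trace D) m = 0" if "m \<le> M" for m
    unfolding deriv_adj_trace_def fps_sum_nth
  proof (intro sum.neutral ballI)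
    fix i j assume ij: "i \<in> {..<n}" "j \<in> {..<n}"
    have "fps_nth (\<Sum>k<n. P D j k * adj k i) l = 0" if "l \<le> m" for l
      unfolding fps_sum_nth
    proof (intro sum.neutral ballI)
      fix k assume "k \<in> {..<n}"
      then show "fps_nth (P D j k * adj k i) l = 0"
        using ij \<open>m \<le> M\<close> that zero by (intro fps_mult_vanish(1)[of l]) auto
    qed
    then show "fps_nth (fps_deriv (N i j) * (\<Sum>k<n. P D j k * adj k i)) m = 0"
      by (rule fps_mult_vanish(2)) auto
  qed
  have "fps_X * fps_deriv ?det = ?det * (fps_X * ?S) + (-1) ^ D * (fps_X * deriv_adj_trace D)"
    unfolding fps_deriv_det_unit_mat[of D] by (simp add: algebra_simps)
  moreover have "fps_nth ((-1) ^ D * (fps_X * deriv_adj_trace D)) M = 0"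
    by (rule fps_mult_vanish(2)[OF _ order_refl], rule fps_mult_vanish(2)[OF van]) auto
  ultimately have "fps_nth (fps_X * fps_deriv ?det) M = fps_nth (?det * (fps_X * ?S)) M" by simp
  also have "\<dots> = fps_nth (?det * Abs_fps (\<lambda>m. of_nat m * log_coeff m)) M"
    unfolding fps_mult_nth[of ?det]
  proof (intro sum.cong refl arg_cong2[of _ _ _ _ "(*)"])
    fix l assume "l \<in> {0..M}"
    define m where "m = M - l"
    have bm: "bound m < D" using mono_bound[of m M] by (simp add: D_def m_def)
    have sgn: "fps_nth ((-1) ^ d * f) m = (-1) ^ d * fps_nth f m" for d and f :: "'k fps"
      by (cases "even d") simp_all
    have "fps_nth (fps_X * ?S) m = (\<Sum>d<D. (-1) ^ d * (of_nat m / of_nat (Suc d) * trace_coeff (Suc d) m))"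
      by (simp only: sum_distrib_left mult.left_commute[of fps_X] fps_sum_nth sgn deriv_trace_coeff)
    also have "\<dots> = (\<Sum>d<bound m. (-1) ^ d * (of_nat m / of_nat (Suc d) * trace_coeff (Suc d) m))"
      using bm vanish[of m "Suc _"]
      by (intro sum.mono_neutral_right) (auto simp: trace_coeff_def simp del: mat_power.simps)
    also have "\<dots> = (\<Sum>d = 1..bound m. (-1) ^ (d - 1) * (of_nat m / of_nat d * trace_coeff d m))"
      by (rule sum.reindex_bij_witness[of _ "\<lambda>d. d - 1" Suc]) auto
    also have "\<dots> = of_nat m * log_coeff m"
      by (simp add: log_coeff_def sum_distrib_left algebra_simps)
    finally show "fps_nth (fps_X * ?S) (M - l) = fps_nth (Abs_fps (\<lambda>m. of_nat m * log_coeff m)) (M - l)"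
      by (simp add: m_def)
  qed
  finally show "fps_nth (fps_X * fps_deriv ?det) M = fps_nth (?det * Abs_fps (\<lambda>m. of_nat m * log_coeff m)) M" .
qed

text \<open>At \<open>x = 0\<close> the matrix \<open>N\<close> is strictly triangular with respect to \<open>ht\<close>: a permutation other than the
  identity cannot increase \<open>ht\<close> at every point that it moves.\<close>

lemma det_unit_mat_nth_0:
  fixes ht :: "nat \<Rightarrow> nat"
  assumes ht: "\<And>i j. i < n \<Longrightarrow> j < n \<Longrightarrow> fps_nth (N i j) 0 \<noteq> 0 \<Longrightarrow> ht i < ht j"
  shows "fps_nth (Determinant.det unit_mat) 0 = 1"
proof -
  let ?P = "{p. p permutes {0..<n}}"
  have sgn: "fps_nth (signof p * g) 0 = signof p * fps_nth g 0" for p and g :: "'k fps"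
    by (simp add: sign_def)
  have pl: "p i < n" if "p \<in> ?P" "i < n" for p i using permutes_in_image[of p "{0..<n}" i] that by auto
  have "fps_nth (Determinant.det unit_mat) 0
      = (\<Sum>p\<in>?P. signof p * (\<Prod>i = 0..<n. (if i = p i then 1 else 0) + fps_nth (N i (p i)) 0))"
    unfolding det_def'[OF unit_mat_carrier] fps_sum_nth sgn fps_nth_0_prod
    by (intro sum.cong refl arg_cong2[of _ _ _ _ "(*)"] prod.cong) (auto simp: unit_mat_def pl)
  also have "\<dots> = (\<Sum>p\<in>{id}. signof p * (\<Prod>i = 0..<n. (if i = p i then 1 else 0) + fps_nth (N i (p i)) 0))"
  proof (rule sum.mono_neutral_right)
    show "finite ?P" by (simp add: finite_permutations)
    show "{id} \<subseteq> ?P" by (simp add: permutes_id)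
    show "\<forall>p\<in>?P - {id}. signof p * (\<Prod>i = 0..<n. (if i = p i then 1 else 0) + fps_nth (N i (p i)) 0) = 0"
    proof
      fix p assume p: "p \<in> ?P - {id}"
      have "\<exists>i\<in>{0..<n}. (if i = p i then 1 else 0) + fps_nth (N i (p i)) 0 = 0"
      proof (rule ccontr)
        assume "\<not> ?thesis"
        then have nz: "(if i = p i then 1 else 0) + fps_nth (N i (p i)) 0 \<noteq> 0" if "i < n" for i using that by auto
        have le: "ht i \<le> ht (p i)" and lt: "p i \<noteq> i \<Longrightarrow> ht i < ht (p i)" if "i < n" for i
          using nz[OF that] ht[of i "p i"] pl[of p i] p that by (cases "p i = i"; force)+
        obtain i where i: "p i \<noteq> i" using p by (auto simp: fun_eq_iff)
        then have "i < n" using p permutes_not_in[of p "{0..<n}" i] by auto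
        then have "(\<Sum>i\<in>{0..<n}. ht i) < (\<Sum>i\<in>{0..<n}. ht (p i))"
          using le lt[OF \<open>i < n\<close> i] by (intro sum_strict_mono_ex1) (auto intro: bexI[of _ i])
        moreover have "(\<Sum>i\<in>{0..<n}. ht (p i)) = (\<Sum>i\<in>{0..<n}. ht i)"
          using p sum.permute[of p "{0..<n}" ht] by (simp add: comp_def)
        ultimately show False by simp
      qed
      then show "signof p * (\<Prod>i = 0..<n. (if i = p i then 1 else 0) + fps_nth (N i (p i)) 0) = 0"
        by (auto intro!: prod_zero)
    qed
  qed
  also have "\<dots> = 1"
  proof -
    have "fps_nth (N i i) 0 = 0" if "i < n" for i using ht[of i i] that by auto
    then show ?thesis by simp
  qed
  finally show ?thesis .
qed

end

section \<open>Periodic closed paths\<close>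

lemma commuting_append_power:
  "u @ v = v @ u \<Longrightarrow> length v = length u * m \<Longrightarrow> v = concat (replicate m u)"
proof (induction m arbitrary: v)
  case (Suc m)
  have "take (length u) (u @ v) = take (length u) (v @ u)" using Suc.prems(1) by simp
  then have "u = take (length u) v" using Suc.prems(2) by simp
  then obtain v' where v': "v = u @ v'" by (metis append_take_drop_id)
  then show ?case using Suc.IH[of v'] Suc.prems by simp
qed simp

lemma rotate_mult: "rotate r w = w \<Longrightarrow> rotate (r * x) w = w"
proof (induction x)
  case (Suc x)
  have "rotate (r * Suc x) w = rotate r (rotate (r * x) w)" by (simp add: rotate_rotate)
  then show ?case using Suc by simp
qed simp

lemma rotate_gcd:
  assumes "rotate r w = w"
  shows "rotate (gcd r (length w)) w = w"
proof -
  obtain x where "[r * x = gcd r (length w)] (mod length w)" using cong_solve_nat by blast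
  then have "rotate (gcd r (length w)) w = rotate (r * x) w"
    by (metis cong_def rotate_conv_mod)
  then show ?thesis using rotate_mult[OF assms] by simp
qed

lemma rotate_concat_replicate: "rotate (length u * x) (concat (replicate m u)) = concat (replicate m u)"
proof (rule rotate_mult)
  show "rotate (length u) (concat (replicate m u)) = concat (replicate m u)"
  proof (cases m)
    case (Suc m')
    have "concat (replicate m' u) @ u = u @ concat (replicate m' u)" by (induction m') auto
    then show ?thesis using rotate_append[of u "concat (replicate m' u)"] Suc by simp
  qed simp
qed

lemma length_concat_replicate: "length (concat (replicate m u)) = m * length u"
  by (induction m) auto

text \<open>A word fixed by rotation by \<open>r\<close> is fixed by rotation by \<open>gcd r l\<close>, so it is a power of its prefix of
  that length.\<close>

lemma bij_betw_periodic_lists: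
  assumes "l = g * m" "g = gcd r l" "l > 0"
  shows "bij_betw (\<lambda>u :: 'a list. concat (replicate m u)) {u. length u = g} {w. length w = l \<and> rotate r w = w}"
proof (rule bij_betw_byWitness[of _ "take g"])
  have m: "m > 0" using assms by (intro Nat.gr0I) auto
  show "\<forall>u\<in>{u :: 'a list. length u = g}. take g (concat (replicate m u)) = u"
    using m by (cases m) auto
  show "\<forall>w\<in>{w :: 'a list. length w = l \<and> rotate r w = w}. concat (replicate m (take g w)) = w"
  proof
    fix w :: "'a list" assume "w \<in> {w. length w = l \<and> rotate r w = w}"
    then have w: "length w = l" "rotate r w = w" by auto
    have "rotate g w = w" using rotate_gcd[OF w(2)] w(1) assms(2) by simp
    moreover have g: "g \<le> length w" using assms m w(1) by simp
    then have "rotate g w = drop g w @ take g w"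
      using rotate_append[of "take g w" "drop g w"] by (simp add: min_absorb2)
    ultimately have "take g w @ drop g w = drop g w @ take g w" by simp
    moreover have "length (drop g w) = length (take g w) * (m - 1)"
      using g w(1) assms(1) m by (simp add: min_absorb2 algebra_simps)
    ultimately have "drop g w = concat (replicate (m - 1) (take g w))" by (rule commuting_append_power)
    then have "concat (replicate (Suc (m - 1)) (take g w)) = w" by simp (metis append_take_drop_id)
    then show "concat (replicate m (take g w)) = w" using m by simp
  qed
  show "(\<lambda>u :: 'a list. concat (replicate m u)) ` {u. length u = g} \<subseteq> {w. length w = l \<and> rotate r w = w}"
  proof
    fix w :: "'a list" assume "w \<in> (\<lambda>u. concat (replicate m u)) ` {u. length u = g}"
    then obtain u :: "'a list" where u: "length u = g" "w = concat (replicate m u)" by blast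
    have "length u dvd r" using assms(2) u by simp
    then obtain x where "r = length u * x" by (elim dvdE)
    then have "rotate r w = w" by (simp add: u(2) rotate_concat_replicate)
    then show "w \<in> {w. length w = l \<and> rotate r w = w}"
      by (simp add: u length_concat_replicate assms(1))
  qed
  show "take g ` {w :: 'a list. length w = l \<and> rotate r w = w} \<subseteq> {u. length u = g}"
    using assms m by (auto simp: min_absorb2)
qed

text \<open>Exactly \<open>\<phi>(l/g)\<close> of the \<open>l\<close> residues have greatest common divisor \<open>g\<close> with \<open>l\<close>.\<close>

lemma sum_gcd_eq_sum_divisors:
  fixes h :: "nat \<Rightarrow> 'r::comm_semiring_1"
  assumes "l > 0"
  shows "(\<Sum>r<l. h (gcd r l)) = (\<Sum>g | g dvd l. of_nat (totient (l div g)) * h g)"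
proof -
  have "(\<Sum>r<l. h (gcd r l)) = (\<Sum>r\<in>{0<..l}. h (gcd r l))"
    by (rule sum.reindex_bij_witness[of _ "\<lambda>r. if r = l then 0 else r" "\<lambda>r. if r = 0 then l else r"])
      (use assms in auto)
  also have "\<dots> = (\<Sum>g | g dvd l. \<Sum>r | r \<in> {0<..l} \<and> gcd r l = g. h (gcd r l))"
    by (rule sum.group[symmetric]) (use assms in \<open>auto intro: finite_divisors_nat\<close>)
  also have "\<dots> = (\<Sum>g | g dvd l. of_nat (totient (l div g)) * h g)"
  proof (rule sum.cong[OF refl])
    fix g assume "g \<in> {g. g dvd l}"
    then show "(\<Sum>r | r \<in> {0<..l} \<and> gcd r l = g. h (gcd r l)) = of_nat (totient (l div g)) * h g"
      using card_gcd_eq_totient[of l g] assms by simp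
  qed
  finally show ?thesis .
qed

context graded_arrow_basis begin

lemma closed_path_concat_replicate:
  assumes "m > 0"
  shows "closed_path (concat (replicate m u)) \<longleftrightarrow> closed_path u"
proof (cases "u = []")
  case False
  obtain m' where m': "m = Suc m'" using assms by (cases m) auto
  have rep: "path i u i \<Longrightarrow> path i (concat (replicate q u)) i" for i q
    by (induction q) (auto simp: path_append)
  have start: "path i u j \<Longrightarrow> i = src (hd u)" for i j using False by (cases u) auto
  have "path i u i" if p: "path i (concat (replicate m u)) i" for i
  proof (cases m')
    case 0
    then show ?thesis using p m' by simp
  next
    case (Suc q)
    then obtain j j' where "path i u j" "path j u j'" using p m' by (auto simp: path_append)
    then show ?thesis using start by metis
  qed
  moreover have "concat (replicate m u) \<noteq> []" using False m' by simp
  ultimately show ?thesis unfolding closed_path_def using rep False by blast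
qed (simp add: closed_path_def)

lemma wdeg_concat_replicate: "wdeg (concat (replicate m u)) = m * wdeg u"
  by (induction m) (auto simp: wdeg_simps)

lemma card_periodic_closed_words:
  assumes "l = g * m" "g = gcd r l" "l > 0"
  shows "card {w \<in> closed_words l k. rotate r w = w} = (if m dvd k then card (closed_words g (k div m)) else 0)"
proof -
  have m: "m > 0" using assms by (intro Nat.gr0I) auto
  let ?U = "{u. length u = g \<and> m * wdeg u = k \<and> set u \<subseteq> letters \<and> closed_path u}"
  note bij = bij_betw_periodic_lists[OF assms, where 'a = 'b]
  have img: "(\<lambda>u. concat (replicate m u)) ` ?U = {w \<in> closed_words l k. rotate r w = w}"
  proof -
    have "{w \<in> closed_words l k. rotate r w = w} = {w \<in> {w. length w = l \<and> rotate r w = w}. set w \<subseteq> letters \<and> wdeg w = k \<and> closed_path w}"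
      by (auto simp: closed_words_def words_def)
    also have "\<dots> = {w \<in> (\<lambda>u. concat (replicate m u)) ` {u. length u = g}. set w \<subseteq> letters \<and> wdeg w = k \<and> closed_path w}"
      using bij by (simp only: bij_betw_def)
    also have "\<dots> = (\<lambda>u. concat (replicate m u)) ` ?U"
      using m by (auto simp: wdeg_concat_replicate closed_path_concat_replicate simp del: Un_iff)
    finally show ?thesis ..
  qed
  have inj: "inj_on (\<lambda>u. concat (replicate m u)) ?U"
    by (rule inj_on_subset[of _ "{u. length u = g}"]) (use bij in \<open>auto simp: bij_betw_def\<close>)
  have "card {w \<in> closed_words l k. rotate r w = w} = card ?U"
    unfolding img[symmetric] by (rule card_image[OF inj])
  also have "?U = (if m dvd k then closed_words g (k div m) else {})"
    using m by (auto simp: closed_words_def words_def)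
  finally show ?thesis by simp
qed

section \<open>Counting paths with the arrow matrix\<close>

definition arrows :: "nat \<Rightarrow> nat \<Rightarrow> nat \<Rightarrow> 'b set" where
  "arrows i j k = {z \<in> B. src z = i \<and> tgt z = j \<and> dg z = k}"

definition arrow_series :: "nat \<Rightarrow> nat \<Rightarrow> rat fps" where
  "arrow_series i j = Abs_fps (\<lambda>k. of_nat (card (arrows i j k)))"

definition path_words :: "nat \<Rightarrow> nat \<Rightarrow> nat \<Rightarrow> nat \<Rightarrow> 'b list set" where
  "path_words d i j k = {w. length w = d \<and> path i w j \<and> wdeg w = k}"

lemma finite_arrows: "finite (arrows i j k)"
  by (rule finite_subset[OF _ finite_degree[of k]]) (auto simp: arrows_def)

lemma path_words_subset: "path_words d i j k \<subseteq> words d k"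
  using path_set by (fastforce simp: path_words_def words_def)

lemma finite_path_words: "finite (path_words d i j k)"
  by (rule finite_subset[OF path_words_subset finite_words])

lemma card_path_words_Suc:
  "card (path_words (Suc d) i j k) = (\<Sum>l<n. \<Sum>a=0..k. card (arrows i l a) * card (path_words d l j (k - a)))"
proof -
  let ?S = "SIGMA l:{..<n}. SIGMA a:{0..k}. arrows i l a \<times> path_words d l j (k - a)"
  have bij: "bij_betw (\<lambda>(l, a, x, w). x # w) ?S (path_words (Suc d) i j k)"
  proof (rule bij_betw_byWitness[of _ "\<lambda>w. (tgt (hd w), dg (hd w), hd w, tl w)"])
    show "\<forall>s\<in>?S. (\<lambda>w. (tgt (hd w), dg (hd w), hd w, tl w)) ((\<lambda>(l, a, x, w). x # w) s) = s"
      by (auto simp: arrows_def)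
    show "\<forall>w\<in>path_words (Suc d) i j k. (\<lambda>(l, a, x, w). x # w) (tgt (hd w), dg (hd w), hd w, tl w) = w"
      by (auto simp: path_words_def length_Suc_conv)
    show "(\<lambda>(l, a, x, w). x # w) ` ?S \<subseteq> path_words (Suc d) i j k"
      by (auto simp: arrows_def path_words_def wdeg_simps deg_def)
    show "(\<lambda>w. (tgt (hd w), dg (hd w), hd w, tl w)) ` path_words (Suc d) i j k \<subseteq> ?S"
    proof
      fix s assume "s \<in> (\<lambda>w. (tgt (hd w), dg (hd w), hd w, tl w)) ` path_words (Suc d) i j k"
      then obtain x w where s: "s = (tgt x, dg x, x, w)" and w: "x # w \<in> path_words (Suc d) i j k"
        by (auto simp: path_words_def length_Suc_conv)
      then have "x \<in> B" "src x = i" "path (tgt x) w j" "length w = d" "dg x + wdeg w = k"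
        by (auto simp: path_words_def wdeg_simps deg_def)
      then show "s \<in> ?S" using tgt_less by (auto simp: s arrows_def path_words_def)
    qed
  qed
  have "card (path_words (Suc d) i j k) = card ?S"
    by (rule bij_betw_same_card[OF bij, symmetric])
  also have "\<dots> = (\<Sum>l<n. \<Sum>a=0..k. card (arrows i l a) * card (path_words d l j (k - a)))"
    by (simp add: card_SigmaI finite_arrows finite_path_words card_cartesian_product)
  finally show ?thesis .
qed

lemma mat_power_arrow_series:
  assumes "j < n"
  shows "fps_nth (mat_power n arrow_series d i j) k = of_nat (card (path_words d i j k))"
proof (induction d arbitrary: i k)
  case 0
  have "path_words 0 i j k = (if i = j \<and> k = 0 then {[]} else {})"
    by (auto simp: path_words_def wdeg_simps)
  then show ?case by simp
next
  case (Suc d)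
  have "fps_nth (arrow_series i l) a = of_nat (card (arrows i l a))" for l a
    by (simp add: arrow_series_def)
  then show ?case unfolding card_path_words_Suc
    by (simp add: fps_sum_nth fps_mult_nth Suc)
qed

sublocale nilpotent_perturbation n arrow_series "\<lambda>m. H + (H + 1) * m"
proof
  fix m d i j assume *: "H + (H + 1) * m < d" "i < n" "j < n"
  have "path_words d i j m = {}"
  proof (rule ccontr)
    assume "path_words d i j m \<noteq> {}"
    then obtain w where "length w = d" "path i w j" "wdeg w = m" by (auto simp: path_words_def)
    then show False using path_length_le[of i w j] ht_le[OF *(3)] * by simp
  qed
  then show "fps_nth (mat_power n arrow_series d i j) m = 0"
    using * by (simp add: mat_power_arrow_series)
next
  fix m m' :: nat assume "m \<le> m'"
  then show "H + (H + 1) * m \<le> H + (H + 1) * m'" by (intro add_left_mono mult_le_mono2)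
qed

lemma trace_coeff_eq:
  assumes "d > 0"
  shows "trace_coeff d m = of_nat (card (closed_words d m))"
proof -
  have "closed_words d m = (\<Union>i<n. path_words d i i m)"
  proof (intro equalityI subsetI)
    fix w assume w: "w \<in> closed_words d m"
    then obtain i where "path i w i" by (auto simp: closed_words_def closed_path_def)
    moreover from this have "i < n"
      using w src_less by (cases w) (auto simp: closed_words_def closed_path_def)
    ultimately show "w \<in> (\<Union>i<n. path_words d i i m)"
      using w by (auto simp: closed_words_def words_def path_words_def)
  next
    fix w assume "w \<in> (\<Union>i<n. path_words d i i m)"
    then show "w \<in> closed_words d m" using assms path_words_subset
      by (fastforce simp: closed_words_def path_words_def closed_path_def)
  qed
  also have "card \<dots> = (\<Sum>i<n. card (path_words d i i m))"
  proof (rule card_UN_disjoint)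
    show "\<forall>i\<in>{..<n}. \<forall>j\<in>{..<n}. i \<noteq> j \<longrightarrow> path_words d i i m \<inter> path_words d j j m = {}"
    proof (intro ballI impI)
      fix i j :: nat assume "i \<noteq> j"
      then show "path_words d i i m \<inter> path_words d j j m = {}"
        using assms by (auto simp: path_words_def length_Suc_conv gr0_conv_Suc)
    qed
  qed (auto simp: finite_path_words)
  finally show ?thesis by (simp add: trace_coeff_def mat_power_arrow_series)
qed

text \<open>Inserting the count of fixed words into the Euler characteristic gives a sum over pairs \<open>(g, u)\<close> of a
  length \<open>g\<close> and an exponent \<open>u\<close>, where \<open>u\<close>-th powers of closed paths of length \<open>g\<close> and degree
  \<open>k/u\<close> occur with multiplicity \<open>\<phi>(u)\<close>. The signs \<open>(-1)\<^bsup>l-1\<^esup>\<close> and \<open>(-1)\<^bsup>r(l+1)\<^esup>\<close> combine to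
  \<open>(-1)\<^bsup>g-1\<^esup>\<close>, so for fixed \<open>u\<close> the sum over \<open>g\<close> is a coefficient of the logarithm of the
  determinant.\<close>

lemma euler_char_log_coeff:
  assumes k: "k > 0"
  shows "of_nat k * of_int (fps_nth (graded_euler_char (reduced_HC_dim scl G)) k)
    = (\<Sum>d | d dvd k. of_nat (d * totient (k div d)) * log_coeff d)"
proof -
  let ?J = "(H + 1) * k" and ?b = "\<lambda>m. H + (H + 1) * m"
  define T where "T g u = (if u dvd k then of_nat (card (closed_words g (k div u))) else 0 :: rat)" for g u
  define F where "F g u = of_nat (totient u) * ((-1) ^ (g - 1) * (of_nat k / of_nat (g * u)) * T g u)" for g u
  have dim: "of_nat k * ((-1) ^ (l - 1) * of_nat (closed_dim k l)) = (\<Sum>g | g dvd l. F g (l div g))"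
    if l: "l > 0" for l
  proof -
    have c: "of_nat (card {w \<in> closed_words l k. rotate r w = w}) = T (gcd r l) (l div gcd r l)" for r
      using card_periodic_closed_words[of l "gcd r l" "l div gcd r l" r k] l by (simp add: T_def)
    have "(of_int (int (closed_dim k l * l)) :: rat)
        = (\<Sum>r<l. (-1) ^ (r * (l + 1)) * of_nat (card {w \<in> closed_words l k. rotate r w = w}))"
      using k l by (subst closed_dim_eq) auto
    then have "(of_nat (closed_dim k l) * of_nat l :: rat) = (\<Sum>r<l. (-1) ^ (r * (l + 1)) * T (gcd r l) (l div gcd r l))"
      by (simp add: c)
    then have "of_nat (closed_dim k l) = (\<Sum>r<l. (-1) ^ (r * (l + 1)) * T (gcd r l) (l div gcd r l)) / of_nat l"
      using l by (simp add: field_simps)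
    then have "of_nat k * ((-1) ^ (l - 1) * of_nat (closed_dim k l))
      = (\<Sum>r<l. ((-1) ^ (l - 1) * (-1) ^ (r * (l + 1))) * (of_nat k / of_nat l) * T (gcd r l) (l div gcd r l))"
      by (simp add: sum_distrib_left sum_divide_distrib mult_ac)
    also have "\<dots> = (\<Sum>r<l. (-1) ^ (gcd r l - 1) * (of_nat k / of_nat l) * T (gcd r l) (l div gcd r l))"
    proof (intro sum.cong refl arg_cong2[of _ _ _ _ "(*)"])
      fix r
      have g: "gcd r l > 0" using l by simp
      have par: "even (gcd r l) \<longleftrightarrow> even r \<and> even l" by (simp add: gcd_greatest_iff)
      have "even (l - 1 + r * (l + 1) + (gcd r l - 1))"
        using l g par by (cases "even l") auto
      then show "((-1) ^ (l - 1) * (-1) ^ (r * (l + 1)) :: rat) = (-1) ^ (gcd r l - 1)"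
        unfolding power_add[symmetric] by (auto simp: minus_one_power_iff)
    qed
    also have "\<dots> = (\<Sum>g | g dvd l. of_nat (totient (l div g)) * ((-1) ^ (g - 1) * (of_nat k / of_nat l) * T g (l div g)))"
      by (rule sum_gcd_eq_sum_divisors[OF l])
    also have "\<dots> = (\<Sum>g | g dvd l. F g (l div g))"
      by (intro sum.cong refl) (simp add: F_def)
    finally show ?thesis .
  qed
  have "of_nat k * of_int (fps_nth (graded_euler_char (reduced_HC_dim scl G)) k)
      = (\<Sum>l = 1..?J. of_nat k * ((-1) ^ (l - 1) * of_nat (closed_dim k l) :: rat))"
    using k by (subst euler_char_coeff) (simp_all add: sum_distrib_left)
  also have "\<dots> = (\<Sum>l = 1..?J. \<Sum>g | g dvd l. F g (l div g))"
    by (intro sum.cong refl dim) auto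
  also have "\<dots> = (\<Sum>(l, g)\<in>Sigma {1..?J} (\<lambda>l. {g. g dvd l}). F g (l div g))"
    by (rule sum.Sigma) (auto intro: finite_divisors_nat)
  also have "\<dots> = (\<Sum>(u, g)\<in>{(u, g). u > 0 \<and> g > 0 \<and> g * u \<le> ?J}. F g u)"
  proof (rule sum.reindex_bij_witness[of _ "\<lambda>(u, g). (g * u, g)" "\<lambda>(l, g). (l div g, g)"])
    fix p assume "p \<in> Sigma {1..?J} (\<lambda>l. {g. g dvd l})"
    then obtain l g where p: "p = (l, g)" "l \<ge> 1" "l \<le> ?J" "g dvd l" by auto
    then have "g > 0" by (intro Nat.gr0I) auto
    then show "(case case p of (l, g) \<Rightarrow> (l div g, g) of (u, g) \<Rightarrow> (g * u, g)) = p"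
      "(case p of (l, g) \<Rightarrow> (l div g, g)) \<in> {(u, g). u > 0 \<and> g > 0 \<and> g * u \<le> ?J}"
      using p by (auto simp: div_greater_zero_iff dest: dvd_imp_le)
    show "(case case p of (l, g) \<Rightarrow> (l div g, g) of (u, g) \<Rightarrow> F g u) = (case p of (l, g) \<Rightarrow> F g (l div g))"
      using p by simp
  next
    fix p assume "p \<in> {(u, g). u > 0 \<and> g > 0 \<and> g * u \<le> ?J}"
    then obtain u g where "p = (u, g)" "u > 0" "g > 0" "g * u \<le> ?J" by auto
    then show "(case case p of (u, g) \<Rightarrow> (g * u, g) of (l, g) \<Rightarrow> (l div g, g)) = p"
      "(case p of (u, g) \<Rightarrow> (g * u, g)) \<in> Sigma {1..?J} (\<lambda>l. {g. g dvd l})"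
      by auto
  qed
  also have "\<dots> = (\<Sum>(u, g)\<in>Sigma {u. u dvd k} (\<lambda>u. {1..?b (k div u)}). F g u)"
  proof (rule sum.mono_neutral_cong)
    have "{(u, g). u > 0 \<and> g > 0 \<and> g * u \<le> ?J} \<subseteq> {..?J} \<times> {..?J}"
    proof clarsimp
      fix u g :: nat assume "0 < u" "0 < g" "g * u \<le> k + H * k"
      then show "u \<le> k + H * k \<and> g \<le> k + H * k"
        by (metis One_nat_def Suc_leI le_trans mult.commute mult.right_neutral mult_le_mono2)
    qed
    then show "finite {(u, g). u > 0 \<and> g > 0 \<and> g * u \<le> ?J}" by (rule finite_subset) simp
    show "finite (Sigma {u. u dvd k} (\<lambda>u. {1..?b (k div u)}))"
      using k by (intro finite_SigmaI finite_divisors_nat) auto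
    fix p assume p: "p \<in> Sigma {u. u dvd k} (\<lambda>u. {1..?b (k div u)}) - {(u, g). u > 0 \<and> g > 0 \<and> g * u \<le> ?J}"
    then obtain u g where ug: "p = (u, g)" "u dvd k" "g \<ge> 1" by auto
    have "u > 0" using ug k by (intro Nat.gr0I) auto
    then have "\<not> g * u \<le> ?J" using p ug by auto
    then have "\<not> g \<le> (H + 1) * (k div u)"
      using ug(2) \<open>u > 0\<close> by (metis dvd_div_mult_self mult.assoc mult_le_mono1)
    then have "closed_words g (k div u) = {}" by (intro closed_words_empty) simp
    then show "(case p of (u, g) \<Rightarrow> F g u) = 0" by (simp add: ug F_def T_def)
  next
    fix p assume p: "p \<in> {(u, g). u > 0 \<and> g > 0 \<and> g * u \<le> ?J} - Sigma {u. u dvd k} (\<lambda>u. {1..?b (k div u)})"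
    then obtain u g where ug: "p = (u, g)" "u > 0" "g > 0" "g * u \<le> ?J" by auto
    have "\<not> u dvd k"
    proof
      assume "u dvd k"
      then have e: "(H + 1) * (k div u) * u = (H + 1) * k" by (simp only: mult.assoc dvd_div_mult_self)
      have "g * u \<le> (H + 1) * (k div u) * u" using ug(4) unfolding e .
      then have "g \<le> (H + 1) * (k div u)" using ug(2) by (rule mult_le_cancel2[THEN iffD1, rule_format])
      then have "g \<in> {1..?b (k div u)}" using ug(3) by simp
      then show False using p ug(1) \<open>u dvd k\<close> by simp
    qed
    then show "(case p of (u, g) \<Rightarrow> F g u) = 0" by (simp add: ug F_def T_def)
  qed simp
  also have "\<dots> = (\<Sum>u | u dvd k. \<Sum>g = 1..?b (k div u). F g u)"
    using k by (intro sum.Sigma[symmetric]) auto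
  also have "\<dots> = (\<Sum>u | u dvd k. of_nat (k div u * totient u) * log_coeff (k div u))"
  proof (intro sum.cong refl)
    fix u assume "u \<in> {u. u dvd k}"
    then have u: "u dvd k" by simp
    then have u0: "u > 0" using k by (intro Nat.gr0I) auto
    have ku: "(of_nat k / of_nat (g * u) :: rat) = of_nat (k div u) / of_nat g" for g
    proof -
      obtain q where "k = u * q" using u by (elim dvdE)
      then show ?thesis using u0 by simp
    qed
    show "(\<Sum>g = 1..?b (k div u). F g u) = of_nat (k div u * totient u) * log_coeff (k div u)"
      unfolding log_coeff_def sum_distrib_left
    proof (intro sum.cong refl)
      fix g assume "g \<in> {1..?b (k div u)}"
      then have "trace_coeff g (k div u) = T g u" using u by (simp add: trace_coeff_eq T_def)
      then show "F g u = of_nat (k div u * totient u) * ((-1) ^ (g - 1) / of_nat g * trace_coeff g (k div u))"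
        unfolding F_def ku by simp
    qed
  qed
  also have "\<dots> = (\<Sum>d | d dvd k. of_nat (d * totient (k div d)) * log_coeff d)"
    by (rule sum.reindex_bij_witness[of _ "\<lambda>d. k div d" "\<lambda>d. k div d"]) (use k in \<open>auto elim!: dvdE\<close>)
  finally show ?thesis .
qed

lemma det_arrow_series_nth_0: "fps_nth (Determinant.det unit_mat) 0 = 1"
proof (rule det_unit_mat_nth_0)
  fix i j assume "fps_nth (arrow_series i j) 0 \<noteq> 0"
  then have "arrows i j 0 \<noteq> {}" by (auto simp: arrow_series_def)
  then show "ht i < ht j" using ht_less by (auto simp: arrows_def)
qed

end

section \<open>Bases of the corners of a split graded algebra\<close>

context graded_algebra begin

definition component :: "nat \<Rightarrow> 'a::{ring, monoid_mult} \<Rightarrow> 'a" where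
  "component k x = (THE c. finite {i. c i \<noteq> 0} \<and> (\<forall>i. c i \<in> G i) \<and> x = (\<Sum>i | c i \<noteq> 0. c i)) k"

end

text \<open>The subspace \<open>r\<close> plays the role of the radical of the degree zero part, and \<open>ht\<close> expresses that the
  quiver underlying this part is acyclic.\<close>

locale split_graded_algebra = graded_algebra scl G
  for scl :: "'k::field_char_0 \<Rightarrow> 'a::{ring, monoid_mult} \<Rightarrow> 'a" and G :: "nat \<Rightarrow> 'a set" +
  fixes n :: nat and e :: "nat \<Rightarrow> 'a" and r :: "'a set" and ht :: "nat \<Rightarrow> nat" and H :: nat
  assumes e_component: "i < n \<Longrightarrow> e i \<in> G 0"
    and e_mult: "i < n \<Longrightarrow> j < n \<Longrightarrow> e i * e j = (if i = j then e i else 0)"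
    and e_sum: "(\<Sum>i<n. e i) = 1"
    and subspace_r: "subspace r" and r_component: "r \<subseteq> G 0"
    and r_split: "x \<in> G 0 \<Longrightarrow> \<exists>c. x - (\<Sum>i<n. scl (c i) (e i)) \<in> r"
    and r_direct: "(\<Sum>i<n. scl (c i) (e i)) \<in> r \<Longrightarrow> i < n \<Longrightarrow> c i = 0"
    and r_mult: "x \<in> r \<Longrightarrow> y \<in> r \<Longrightarrow> x * y \<in> r"
    and e_r: "i < n \<Longrightarrow> x \<in> r \<Longrightarrow> e i * x \<in> r" and r_e: "i < n \<Longrightarrow> x \<in> r \<Longrightarrow> x * e i \<in> r"
    and ht_le: "i < n \<Longrightarrow> ht i \<le> H"
    and ht_less: "i < n \<Longrightarrow> j < n \<Longrightarrow> x \<in> r \<Longrightarrow> e i * x * e j \<noteq> 0 \<Longrightarrow> ht i < ht j"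
    and finite_dim: "\<exists>B. finite B \<and> span B = G k"
begin

sublocale algebra_over scl
  by unfold_locales (simp_all add: scale_mult_left scale_mult_right)

lemma component_eqI:
  assumes "finite {i. c i \<noteq> 0}" "\<And>i. c i \<in> G i" "x = (\<Sum>i | c i \<noteq> 0. c i)"
  shows "component k x = c k"
proof -
  have "(THE c. finite {i. c i \<noteq> 0} \<and> (\<forall>i. c i \<in> G i) \<and> x = (\<Sum>i | c i \<noteq> 0. c i)) = c"
    using direct_sum[of x] assms by (intro the1_equality) auto
  then show ?thesis by (simp add: component_def)
qed

lemma component_decomposition:
  "finite {i. component i x \<noteq> 0}" "component k x \<in> G k" "x = (\<Sum>i | component i x \<noteq> 0. component i x)"
proof -
  from theI'[OF direct_sum[of x]] show "finite {i. component i x \<noteq> 0}" "component k x \<in> G k" "x = (\<Sum>i | component i x \<noteq> 0. component i x)"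
    unfolding component_def by auto
qed

lemma component_linear: "component k (scl a x + y) = scl a (component k x) + component k y"
proof (rule component_eqI[of "\<lambda>k. scl a (component k x) + component k y"])
  let ?S = "{i. component i x \<noteq> 0} \<union> {i. component i y \<noteq> 0}"
  have fin: "finite ?S" using component_decomposition(1) by simp
  have sub: "{i. scl a (component i x) + component i y \<noteq> 0} \<subseteq> ?S" by auto
  then show "finite {i. scl a (component i x) + component i y \<noteq> 0}" using fin by (rule finite_subset)
  show "scl a (component i x) + component i y \<in> G i" for i
    by (intro subspace_add subspace_scale subspace_component component_decomposition)
  have "(\<Sum>i | scl a (component i x) + component i y \<noteq> 0. scl a (component i x) + component i y)
    = (\<Sum>i\<in>?S. scl a (component i x) + component i y)"
    using fin sub by (intro sum.mono_neutral_left) auto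
  also have "\<dots> = scl a (\<Sum>i\<in>?S. component i x) + (\<Sum>i\<in>?S. component i y)"
    by (simp add: sum.distrib scale_sum_right)
  also have "(\<Sum>i\<in>?S. component i x) = (\<Sum>i | component i x \<noteq> 0. component i x)"
    using fin by (intro sum.mono_neutral_right) auto
  also have "(\<Sum>i\<in>?S. component i y) = (\<Sum>i | component i y \<noteq> 0. component i y)"
    using fin by (intro sum.mono_neutral_right) auto
  finally show "scl a x + y = (\<Sum>i | scl a (component i x) + component i y \<noteq> 0. scl a (component i x) + component i y)"
    using component_decomposition(3)[of x] component_decomposition(3)[of y] by metis
qed

lemma component_homogeneous:
  assumes "x \<in> G l"
  shows "component k x = (if k = l then x else 0)"
proof (rule component_eqI[of "\<lambda>k. if k = l then x else 0"])
  have "{i. (if i = l then x else 0) \<noteq> 0} = (if x = 0 then {} else {l})" by auto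
  then show "finite {i. (if i = l then x else 0) \<noteq> 0}" "x = (\<Sum>i | (if i = l then x else 0) \<noteq> 0. if i = l then x else 0)"
    by simp_all
  show "(if i = l then x else 0) \<in> G i" for i
    using assms subspace_0[OF subspace_component] by simp
qed

text \<open>The corners of the ideal \<open>r \<oplus> G\<^sub>1 \<oplus> G\<^sub>2 \<oplus> \<dots>\<close>; their bases are the arrows. A diagonal corner of
  degree zero of the whole algebra has one more basis vector, the idempotent.\<close>

definition corner :: "nat \<Rightarrow> nat \<Rightarrow> nat \<Rightarrow> 'a set" where
  "corner i j k = (\<lambda>x. e i * x * e j) ` (if k = 0 then r else G k)"

lemma linear_corner: "Vector_Spaces.linear scl scl (\<lambda>x. a * x * b)"
proof -
  interpret vector_space_pair scl scl ..
  show ?thesis by unfold_locales (simp_all add: distrib_left distrib_right scale_mult_left scale_mult_right)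
qed

lemma subspace_corner: "subspace (corner i j k)"
proof -
  interpret vector_space_pair scl scl ..
  show ?thesis unfolding corner_def
    by (rule linear_subspace_image[OF linear_corner]) (simp add: subspace_r subspace_component)
qed

lemma e_nonzero: "i < n \<Longrightarrow> e i \<notin> r" "i < n \<Longrightarrow> e i \<noteq> 0"
proof -
  assume i: "i < n"
  have "(\<Sum>j<n. scl (if j = i then 1 else 0) (e j)) = (\<Sum>j<n. if j = i then e j else 0)"
    by (intro sum.cong) auto
  then have "(\<Sum>j<n. scl (if j = i then 1 else 0) (e j)) = e i" using i by simp
  then show "e i \<notin> r" using r_direct[of "\<lambda>j. if j = i then 1 else 0" i] i by auto
  then show "e i \<noteq> 0" using subspace_0[OF subspace_r] by auto
qed

lemma cornerD:
  assumes "i < n" "j < n" "x \<in> corner i j k"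
  shows "x \<in> G k" "e i * x = x" "x * e j = x" "k = 0 \<Longrightarrow> x \<in> r" "k = 0 \<Longrightarrow> x \<noteq> 0 \<Longrightarrow> ht i < ht j"
proof -
  obtain y where x: "x = e i * y * e j" and y: "y \<in> (if k = 0 then r else G k)"
    using assms(3) by (auto simp: corner_def)
  have yG: "y \<in> G k" using y r_component by (auto split: if_splits)
  show "x \<in> G k"
    unfolding x using mult_component[OF mult_component[OF e_component[OF assms(1)] yG] e_component[OF assms(2)]] by simp
  show "e i * x = x" "x * e j = x"
    unfolding x using e_mult assms by (simp_all add: mult.assoc[symmetric]) (simp add: mult.assoc)
  show "x \<in> r" if "k = 0" using y that assms by (simp add: x e_r r_e)
  show "ht i < ht j" if "k = 0" "x \<noteq> 0" using y that assms ht_less[of i j y] by (simp add: x)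
qed

lemma cornerI:
  assumes "x \<in> G k" "e i * x = x" "x * e j = x" "k = 0 \<Longrightarrow> x \<in> r"
  shows "x \<in> corner i j k"
proof -
  have "x = e i * x * e j" using assms by simp
  moreover have "x \<in> (if k = 0 then r else G k)" using assms by simp
  ultimately show ?thesis unfolding corner_def by (rule image_eqI)
qed

lemma finite_dim_corner: "i < n \<Longrightarrow> j < n \<Longrightarrow> \<exists>B. finite B \<and> B \<subseteq> corner i j k \<and> independent B \<and> span B = corner i j k"
proof -
  assume ij: "i < n" "j < n"
  obtain B where B: "B \<subseteq> corner i j k" "independent B" "corner i j k \<subseteq> span B"
    using maximal_independent_subset by metis
  obtain S where S: "finite S" "span S = G k" using finite_dim by blast
  have "B \<subseteq> span S" using B(1) cornerD(1)[OF ij] S(2) by blast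
  then have "finite B" using independent_span_bound[OF S(1) B(2)] by blast
  moreover have "span B = corner i j k" using span_minimal[OF B(1) subspace_corner] B(3) by (rule subset_antisym)
  ultimately show ?thesis using B by blast
qed

definition corner_basis :: "nat \<Rightarrow> nat \<Rightarrow> nat \<Rightarrow> 'a set" where
  "corner_basis i j k = (SOME B. finite B \<and> B \<subseteq> corner i j k \<and> independent B \<and> span B = corner i j k)"

lemma corner_basis:
  assumes "i < n" "j < n"
  shows "finite (corner_basis i j k)" "corner_basis i j k \<subseteq> corner i j k" "independent (corner_basis i j k)"
    "span (corner_basis i j k) = corner i j k"
  using someI_ex[OF finite_dim_corner[OF assms, of k]] unfolding corner_basis_def[symmetric] by auto

definition full_corner_basis :: "nat \<Rightarrow> nat \<Rightarrow> nat \<Rightarrow> 'a set" where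
  "full_corner_basis i j k = (if i = j \<and> k = 0 then insert (e i) (corner_basis i j k) else corner_basis i j k)"

lemma full_corner_basis_mem:
  assumes "i < n" "j < n" "x \<in> full_corner_basis i j k"
  shows "x \<in> G k" "e i * x = x" "x * e j = x" "x \<noteq> 0"
proof -
  have 1: "x \<in> corner i j k \<or> (x = e i \<and> i = j \<and> k = 0)"
    using assms corner_basis(2)[OF assms(1,2)] by (auto simp: full_corner_basis_def split: if_splits)
  then show "x \<in> G k" "e i * x = x" "x * e j = x"
    using cornerD[OF assms(1,2)] e_component e_mult assms by auto
  show "x \<noteq> 0"
    using assms(3) dependent_zero corner_basis(3)[OF assms(1,2)] e_nonzero(2)[OF assms(1)]
    by (auto simp: full_corner_basis_def split: if_splits)
qed

lemma full_corner_basis: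
  assumes "i < n" "j < n"
  shows "finite (full_corner_basis i j k)" "independent (full_corner_basis i j k)"
    "span (full_corner_basis i j k) = {e i * x * e j | x. x \<in> G k}"
    "card (full_corner_basis i j k) = card (corner_basis i j k) + (if i = j \<and> k = 0 then 1 else 0)"
proof -
  note cb = corner_basis[OF assms, of k]
  have e_notin: "e i \<notin> corner i j k" if "i = j" "k = 0"
    using cornerD(4)[OF assms, of "e i" k] e_nonzero(1)[OF assms(1)] that by blast
  show "finite (full_corner_basis i j k)"
    using cb(1) unfolding full_corner_basis_def by (cases "i = j \<and> k = 0") auto
  show "independent (full_corner_basis i j k)"
    using cb e_notin by (auto simp: full_corner_basis_def independent_insert)
  show "card (full_corner_basis i j k) = card (corner_basis i j k) + (if i = j \<and> k = 0 then 1 else 0)"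
  proof (cases "i = j \<and> k = 0")
    case True
    then have "e i \<notin> corner_basis i j k" using e_notin cb(2) by blast
    then show ?thesis using True cb(1) by (simp add: full_corner_basis_def)
  qed (auto simp: full_corner_basis_def)
  show "span (full_corner_basis i j k) = {e i * x * e j | x. x \<in> G k}"
  proof
    have sub: "subspace {e i * x * e j | x. x \<in> G k}"
    proof -
      interpret vector_space_pair scl scl ..
      have "{e i * x * e j | x. x \<in> G k} = (\<lambda>x. e i * x * e j) ` G k" by auto
      then show ?thesis using linear_subspace_image[OF linear_corner subspace_component] by simp
    qed
    show "span (full_corner_basis i j k) \<subseteq> {e i * x * e j | x. x \<in> G k}"
    proof (rule span_minimal[OF _ sub], rule subsetI)
      fix x assume "x \<in> full_corner_basis i j k"
      from full_corner_basis_mem[OF assms this] have "x = e i * x * e j" "x \<in> G k" by simp_all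
      then show "x \<in> {e i * x * e j | x. x \<in> G k}" by blast
    qed
    show "{e i * x * e j | x. x \<in> G k} \<subseteq> span (full_corner_basis i j k)"
    proof
      fix y assume "y \<in> {e i * x * e j | x. x \<in> G k}"
      then obtain x where x: "y = e i * x * e j" "x \<in> G k" by blast
      have csub: "corner i j k \<subseteq> span (full_corner_basis i j k)"
        unfolding cb(4)[symmetric] by (rule span_mono) (auto simp: full_corner_basis_def)
      show "y \<in> span (full_corner_basis i j k)"
      proof (cases "k = 0")
        case False
        then have "y \<in> corner i j k" using x by (auto simp: corner_def)
        then show ?thesis using csub by blast
      next
        case True
        then obtain c where c: "x - (\<Sum>l<n. scl (c l) (e l)) \<in> r" using r_split x(2) by blast
        let ?z = "x - (\<Sum>l<n. scl (c l) (e l))"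
        have "e i * (\<Sum>l<n. scl (c l) (e l)) * e j = (\<Sum>l<n. scl (c l) (e i * e l * e j))"
          by (simp add: sum_distrib_left sum_distrib_right scale_mult_left scale_mult_right)
        also have "\<dots> = (\<Sum>l<n. if l = i then scl (c i) (e i * e j) else 0)"
          using assms by (intro sum.cong) (auto simp: e_mult)
        also have "\<dots> = (if i = j then scl (c i) (e i) else 0)" using assms by (simp add: e_mult)
        finally have y: "y = e i * ?z * e j + (if i = j then scl (c i) (e i) else 0)"
          by (simp add: x(1) right_diff_distrib left_diff_distrib)
        have "e i * ?z * e j \<in> corner i j k" using c True by (auto simp: corner_def)
        moreover have "(if i = j then scl (c i) (e i) else 0) \<in> span (full_corner_basis i j k)"
          using True by (auto simp: full_corner_basis_def span_zero intro!: span_scale intro: span_base)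
        ultimately show ?thesis unfolding y using csub by (intro span_add) auto
      qed
    qed
  qed
qed

lemma full_corner_basis_unique:
  assumes "i < n" "j < n" "i' < n" "j' < n" "x \<in> full_corner_basis i j k" "x \<in> full_corner_basis i' j' k'"
  shows "i = i'" "j = j'" "k = k'"
proof -
  note m = full_corner_basis_mem[OF assms(1,2,5)] and m' = full_corner_basis_mem[OF assms(3,4,6)]
  have "x = e i * e i' * x" using m(2) m'(2) by (simp add: mult.assoc)
  then show "i = i'" using m(4) e_mult[OF assms(1,3)] by (metis mult_zero_left)
  have "x = x * (e j' * e j)" using m(3) m'(3) by (simp add: mult.assoc[symmetric])
  then show "j = j'" using m(4) e_mult[OF assms(4,2)] by (metis mult_zero_right)
  show "k = k'" using component_homogeneous[OF m(1), of k] component_homogeneous[OF m'(1), of k] m(4)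
    by (metis)
qed

text \<open>An arrow lies in exactly one corner, because the basis vectors are nonzero; this makes the choices
  below unambiguous.\<close>

definition "arrow_set = (\<Union>i<n. \<Union>j<n. \<Union>k. corner_basis i j k)"
definition "arrow_src x = (SOME i. i < n \<and> (\<exists>j<n. \<exists>k. x \<in> corner_basis i j k))"
definition "arrow_tgt x = (SOME j. j < n \<and> (\<exists>i<n. \<exists>k. x \<in> corner_basis i j k))"
definition "arrow_deg x = (SOME k. \<exists>i<n. \<exists>j<n. x \<in> corner_basis i j k)"

lemma corner_basis_subset: "corner_basis i j k \<subseteq> full_corner_basis i j k"
  by (auto simp: full_corner_basis_def)

lemma corner_basis_labels:
  assumes "i < n" "j < n" "x \<in> corner_basis i j k"
  shows "arrow_src x = i" "arrow_tgt x = j" "arrow_deg x = k" "x \<in> arrow_set"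
proof -
  have u: "i = i' \<and> j = j' \<and> k = k'" if "i' < n" "j' < n" "x \<in> corner_basis i' j' k'" for i' j' k'
  proof -
    have "x \<in> full_corner_basis i j k" "x \<in> full_corner_basis i' j' k'"
      using assms(3) that(3) corner_basis_subset by blast+
    from full_corner_basis_unique[OF assms(1,2) that(1,2) this] show ?thesis by simp
  qed
  show "arrow_src x = i" unfolding arrow_src_def by (rule some_equality) (use assms u in blast)+
  show "arrow_tgt x = j" unfolding arrow_tgt_def by (rule some_equality) (use assms u in blast)+
  show "arrow_deg x = k" unfolding arrow_deg_def by (rule some_equality) (use assms u in blast)+
  show "x \<in> arrow_set" unfolding arrow_set_def using assms by blast
qed

lemma arrow_setD:
  assumes "x \<in> arrow_set"
  shows "arrow_src x < n" "arrow_tgt x < n" "x \<in> corner_basis (arrow_src x) (arrow_tgt x) (arrow_deg x)"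
proof -
  obtain i j k where x: "i < n" "j < n" "x \<in> corner_basis i j k" using assms by (auto simp: arrow_set_def)
  then show "arrow_src x < n" "arrow_tgt x < n" "x \<in> corner_basis (arrow_src x) (arrow_tgt x) (arrow_deg x)"
    using corner_basis_labels[OF x] by simp_all
qed

lemma arrow_set_filter:
  "i < n \<Longrightarrow> j < n \<Longrightarrow> {z \<in> arrow_set. arrow_src z = i \<and> arrow_tgt z = j \<and> arrow_deg z = k} = corner_basis i j k"
proof (intro equalityI subsetI)
  assume ij: "i < n" "j < n"
  fix z assume "z \<in> corner_basis i j k"
  from corner_basis_labels[OF ij this]
  show "z \<in> {z \<in> arrow_set. arrow_src z = i \<and> arrow_tgt z = j \<and> arrow_deg z = k}" by simp
next
  fix z assume "z \<in> {z \<in> arrow_set. arrow_src z = i \<and> arrow_tgt z = j \<and> arrow_deg z = k}"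
  then show "z \<in> corner_basis i j k" using arrow_setD(3)[of z] by simp
qed

lemma letters_eq: "e ` {..<n} \<union> arrow_set = (\<Union>i<n. \<Union>j<n. \<Union>k. full_corner_basis i j k)"
proof
  show "e ` {..<n} \<union> arrow_set \<subseteq> (\<Union>i<n. \<Union>j<n. \<Union>k. full_corner_basis i j k)"
  proof
    fix x assume "x \<in> e ` {..<n} \<union> arrow_set"
    then consider i where "i < n" "x = e i" | i j k where "i < n" "j < n" "x \<in> corner_basis i j k"
      by (auto simp: arrow_set_def)
    then show "x \<in> (\<Union>i<n. \<Union>j<n. \<Union>k. full_corner_basis i j k)"
    proof cases
      case 1
      then have "x \<in> full_corner_basis i i 0" by (simp add: full_corner_basis_def)
      then show ?thesis using 1 by blast
    next
      case (2 i j k)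
      have "x \<in> full_corner_basis i j k" using corner_basis_subset 2(3) by (rule subsetD)
      then show ?thesis using 2 by blast
    qed
  qed
  show "(\<Union>i<n. \<Union>j<n. \<Union>k. full_corner_basis i j k) \<subseteq> e ` {..<n} \<union> arrow_set"
  proof
    fix x assume "x \<in> (\<Union>i<n. \<Union>j<n. \<Union>k. full_corner_basis i j k)"
    then obtain i j k where x: "i < n" "j < n" "x \<in> full_corner_basis i j k" by blast
    then consider "x = e i" | "x \<in> corner_basis i j k"
      unfolding full_corner_basis_def by (auto split: if_splits)
    then show "x \<in> e ` {..<n} \<union> arrow_set"
      by cases (use x in \<open>auto simp: arrow_set_def\<close>)
  qed
qed

lemma independent_letters: "independent (e ` {..<n} \<union> arrow_set)"
  unfolding letters_eq
proof (rule independentI_sum)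
  fix T u assume T: "finite T" "T \<subseteq> (\<Union>i<n. \<Union>j<n. \<Union>k. full_corner_basis i j k)" "(\<Sum>v\<in>T. scl (u v) v) = 0"
  show "\<forall>v\<in>T. u v = 0"
  proof
    fix v assume v: "v \<in> T"
    then obtain i j k where ijk: "i < n" "j < n" "v \<in> full_corner_basis i j k" using T(2) by blast
    define F where "F x = e i * component k x * e j" for x
    have F_lin: "F (scl a x + y) = scl a (F x) + F y" for a x y
      by (simp add: F_def component_linear distrib_left distrib_right scale_mult_left scale_mult_right)
    have F0: "F 0 = 0" using F_lin[of 1 0 0] by simp
    have F_sum: "F (\<Sum>v\<in>T. scl (u v) v) = (\<Sum>v\<in>T. scl (u v) (F v))"
      using T(1) by (induction T rule: finite_induct) (simp_all add: F0 F_lin)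
    have F_val: "F w = (if w \<in> full_corner_basis i j k then w else 0)" if w: "w \<in> T" for w
    proof -
      obtain i' j' k' where w': "i' < n" "j' < n" "w \<in> full_corner_basis i' j' k'" using T(2) w by blast
      note mw = full_corner_basis_mem[OF w']
      show ?thesis
      proof (cases "i = i' \<and> j = j' \<and> k = k'")
        case True
        then show ?thesis using w' mw by (simp add: F_def component_homogeneous)
      next
        case False
        then have "w \<notin> full_corner_basis i j k"
          using full_corner_basis_unique[OF ijk(1,2) w'(1,2) _ w'(3), of k] by blast
        moreover have "F w = 0"
        proof (cases "k = k'")
          case True
          have "F w = e i * (e i' * w * e j') * e j" using mw True by (simp add: F_def component_homogeneous)
          also have "\<dots> = (e i * e i') * w * (e j' * e j)" by (simp add: mult.assoc)
          also have "\<dots> = 0" using False True ijk w' by (auto simp: e_mult)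
          finally show ?thesis .
        next
          case False
          then show ?thesis using mw by (simp add: F_def component_homogeneous)
        qed
        ultimately show ?thesis by simp
      qed
    qed
    have "0 = (\<Sum>v\<in>T. scl (u v) (F v))" using F_sum T(3) F0 by simp
    also have "\<dots> = (\<Sum>v\<in>T \<inter> full_corner_basis i j k. scl (u v) v)"
      using T(1) by (intro sum.mono_neutral_cong_right) (auto simp: F_val)
    finally have "(\<Sum>v\<in>T \<inter> full_corner_basis i j k. scl (u v) v) = 0" by simp
    then show "u v = 0"
      using full_corner_basis(2)[OF ijk(1,2), of k] T(1) v ijk(3) unfolding dependent_explicit by blast
  qed
qed

lemma component_span:
  assumes "x \<in> G k"
  shows "x \<in> span (\<Union>i<n. \<Union>j<n. full_corner_basis i j k)"
proof -
  have "x = (\<Sum>i<n. e i) * x * (\<Sum>j<n. e j)" by (simp add: e_sum)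
  also have "\<dots> = (\<Sum>i<n. \<Sum>j<n. e i * x * e j)"
    by (simp add: sum_distrib_left sum_distrib_right) (rule sum.swap)
  finally have x: "x = (\<Sum>i<n. \<Sum>j<n. e i * x * e j)" .
  have "e i * x * e j \<in> span (\<Union>i<n. \<Union>j<n. full_corner_basis i j k)" if "i < n" "j < n" for i j
  proof -
    have "e i * x * e j \<in> span (full_corner_basis i j k)" using full_corner_basis(3)[OF that, of k] assms by blast
    moreover have "full_corner_basis i j k \<subseteq> (\<Union>i<n. \<Union>j<n. full_corner_basis i j k)" using that by blast
    ultimately show ?thesis using span_mono by blast
  qed
  then have "(\<Sum>i<n. \<Sum>j<n. e i * x * e j) \<in> span (\<Union>i<n. \<Union>j<n. full_corner_basis i j k)"
    by (intro span_sum) auto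
  then show ?thesis using x by simp
qed

lemma e_notin_arrow_set:
  assumes "i < n"
  shows "e i \<notin> arrow_set"
proof
  assume "e i \<in> arrow_set"
  then obtain i' j' k where *: "i' < n" "j' < n" "e i \<in> corner_basis i' j' k" by (auto simp: arrow_set_def)
  have "e i \<in> full_corner_basis i i 0" by (simp add: full_corner_basis_def)
  then have "k = 0"
    using full_corner_basis_unique(3)[OF *(1,2) assms assms subsetD[OF corner_basis_subset *(3)]] by blast
  then show False
    using cornerD(4)[OF *(1,2)] corner_basis(2)[OF *(1,2)] *(3) e_nonzero(1)[OF assms] by blast
qed

lemma arrow_basis_arrow_set: "arrow_basis scl n e arrow_set arrow_src arrow_tgt arrow_deg ht H"
proof unfold_locales
  show "i < n \<Longrightarrow> j < n \<Longrightarrow> e i * e j = (if i = j then e i else 0)" for i j by (rule e_mult)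
  show "(\<Sum>i<n. e i) = 1" by (rule e_sum)
  show "i < n \<Longrightarrow> e i \<notin> arrow_set" for i by (rule e_notin_arrow_set)
  show "inj_on e {..<n}"
  proof (rule inj_onI, rule ccontr)
    fix i j assume ij: "i \<in> {..<n}" "j \<in> {..<n}" "e i = e j" "i \<noteq> j"
    then have "e i * e i = 0" using e_mult[of i j] by simp
    then show False using ij e_mult[of i i] e_nonzero(2)[of i] by simp
  qed
  show "independent (e ` {..<n} \<union> arrow_set)" by (rule independent_letters)
  show "span (e ` {..<n} \<union> arrow_set) = UNIV"
  proof -
    have "x \<in> span (e ` {..<n} \<union> arrow_set)" for x
    proof -
      have "component k x \<in> span (e ` {..<n} \<union> arrow_set)" for k
      proof -
        have "(\<Union>i<n. \<Union>j<n. full_corner_basis i j k) \<subseteq> e ` {..<n} \<union> arrow_set" unfolding letters_eq by blast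
        then show ?thesis using component_span[OF component_decomposition(2)] span_mono by blast
      qed
      then have "(\<Sum>k | component k x \<noteq> 0. component k x) \<in> span (e ` {..<n} \<union> arrow_set)"
        by (intro span_sum)
      then show ?thesis using component_decomposition(3)[of x] by simp
    qed
    then show ?thesis by blast
  qed
  fix x assume x: "x \<in> arrow_set"
  note xD = arrow_setD[OF x]
  have xc: "x \<in> corner (arrow_src x) (arrow_tgt x) (arrow_deg x)" by (rule subsetD[OF corner_basis(2)[OF xD(1,2)] xD(3)])
  have x0: "x \<noteq> 0" by (rule full_corner_basis_mem(4)[OF xD(1,2) subsetD[OF corner_basis_subset xD(3)]])
  note cD = cornerD[OF xD(1,2) xc]
  show "arrow_src x < n" "arrow_tgt x < n" by fact+
  show "e (arrow_src x) * x = x" "x * e (arrow_tgt x) = x" by (rule cD)+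
  show "ht (arrow_src x) < ht (arrow_tgt x)" if "arrow_deg x = 0" using cD(5) that x0 by blast
  fix y assume y: "y \<in> arrow_set" and t: "arrow_tgt x = arrow_src y"
  note yD = arrow_setD[OF y]
  have yc: "y \<in> corner (arrow_src y) (arrow_tgt y) (arrow_deg y)" by (rule subsetD[OF corner_basis(2)[OF yD(1,2)] yD(3)])
  note cD' = cornerD[OF yD(1,2) yc]
  have "x * y \<in> corner (arrow_src x) (arrow_tgt y) (arrow_deg x + arrow_deg y)"
  proof (rule cornerI)
    show "x * y \<in> G (arrow_deg x + arrow_deg y)" using cD(1) cD'(1) by (rule mult_component)
    show "e (arrow_src x) * (x * y) = x * y" "x * y * e (arrow_tgt y) = x * y"
      using cD(2) cD'(3) by (simp_all add: mult.assoc) (simp add: mult.assoc[symmetric])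
    show "x * y \<in> r" if "arrow_deg x + arrow_deg y = 0" using that cD(4) cD'(4) by (simp add: r_mult)
  qed
  then show "x * y \<in> span {z \<in> arrow_set. arrow_src z = arrow_src x \<and> arrow_tgt z = arrow_tgt y \<and> arrow_deg z = arrow_deg x + arrow_deg y}"
    using arrow_set_filter[OF xD(1) yD(2)] corner_basis(4)[OF xD(1) yD(2)] by simp
next
  fix k
  have "{z \<in> arrow_set. arrow_deg z = k} \<subseteq> (\<Union>i<n. \<Union>j<n. corner_basis i j k)"
  proof
    fix z assume "z \<in> {z \<in> arrow_set. arrow_deg z = k}"
    then have "z \<in> arrow_set" "arrow_deg z = k" by auto
    then show "z \<in> (\<Union>i<n. \<Union>j<n. corner_basis i j k)" using arrow_setD[of z] by blast
  qed
  then show "finite {z \<in> arrow_set. arrow_deg z = k}"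
    by (rule finite_subset) (auto simp: corner_basis)
next
  show "i < n \<Longrightarrow> ht i \<le> H" for i by (rule ht_le)
qed

lemma graded_arrow_basis_arrow_set:
  "graded_arrow_basis scl n e arrow_set arrow_src arrow_tgt arrow_deg ht H G"
proof -
  interpret ab: arrow_basis scl n e arrow_set arrow_src arrow_tgt arrow_deg ht H
    by (rule arrow_basis_arrow_set)
  have "{z \<in> e ` {..<n} \<union> arrow_set. ab.deg z = k} = (\<Union>i<n. \<Union>j<n. full_corner_basis i j k)" for k
  proof -
    have deg: "ab.deg x = k'" if "i < n" "j < n" "x \<in> full_corner_basis i j k'" for i j k' x
      using that e_notin_arrow_set corner_basis_labels
      by (auto simp: full_corner_basis_def ab.deg_def split: if_splits)
    show ?thesis
    proof (intro equalityI subsetI)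
      fix z assume "z \<in> {z \<in> e ` {..<n} \<union> arrow_set. ab.deg z = k}"
      then have "z \<in> e ` {..<n} \<union> arrow_set" and dz: "ab.deg z = k" by blast+
      then have "z \<in> (\<Union>i<n. \<Union>j<n. \<Union>k. full_corner_basis i j k)" by (simp only: letters_eq)
      then obtain i j k' where z: "i < n" "j < n" "z \<in> full_corner_basis i j k'" by blast
      then have "k' = k" using deg[OF z] dz by simp
      then show "z \<in> (\<Union>i<n. \<Union>j<n. full_corner_basis i j k)" using z by blast
    next
      fix z assume "z \<in> (\<Union>i<n. \<Union>j<n. full_corner_basis i j k)"
      then obtain i j where z: "i < n" "j < n" "z \<in> full_corner_basis i j k" by blast
      then have "z \<in> (\<Union>i<n. \<Union>j<n. \<Union>k. full_corner_basis i j k)" by blast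
      then have "z \<in> e ` {..<n} \<union> arrow_set" by (simp only: letters_eq)
      then show "z \<in> {z \<in> e ` {..<n} \<union> arrow_set. ab.deg z = k}" using deg[OF z] by simp
    qed
  qed
  moreover have "G k = span (\<Union>i<n. \<Union>j<n. full_corner_basis i j k)" for k
  proof
    show "G k \<subseteq> span (\<Union>i<n. \<Union>j<n. full_corner_basis i j k)" using component_span by blast
    show "span (\<Union>i<n. \<Union>j<n. full_corner_basis i j k) \<subseteq> G k"
      using full_corner_basis_mem(1) by (intro span_minimal subspace_component) auto
  qed
  ultimately show ?thesis by unfold_locales simp
qed

text \<open>The identity behind \<open>C = 1 + N\<close> for the Cartan matrix.\<close>

lemma dim_corner:
  assumes "i < n" "j < n"
  shows "dim {e i * x * e j | x. x \<in> G k}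
    = card {z \<in> arrow_set. arrow_src z = i \<and> arrow_tgt z = j \<and> arrow_deg z = k} + (if i = j \<and> k = 0 then 1 else 0)"
  unfolding arrow_set_filter[OF assms] full_corner_basis(3)[OF assms, symmetric] dim_span
    dim_eq_card_independent[OF full_corner_basis(2)[OF assms]] full_corner_basis(4)[OF assms] ..

end

section \<open>The radical of a bound quiver algebra\<close>

lemma awalk_end:
  assumes "wf_digraph Q" "pre_digraph.awalk Q u p v"
  shows "path_end Q (u, p) = v"
proof -
  interpret wf_digraph Q by fact
  show ?thesis using assms(2)
    by (induction p arbitrary: u) (auto simp: path_end_def awalk_Cons_iff awalk_Nil_iff)
qed

definition positive_paths :: "('v, 'e) pre_digraph \<Rightarrow> (('v \<times> 'e list) \<Rightarrow>\<^sub>0 'k::field) set" where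
  "positive_paths Q = {f. Poly_Mapping.keys f \<subseteq> {x \<in> quiver_paths Q. snd x \<noteq> []}}"

lemma path_algebra_simps:
  "carrier (path_algebra Q) = {f. Poly_Mapping.keys f \<subseteq> quiver_paths Q}"
  "monoid.mult (path_algebra Q) = path_algebra_mult Q"
  "ring.add (path_algebra Q) = (+)" "ring.zero (path_algebra Q) = 0"
  "monoid.one (path_algebra Q) = (\<Sum>v\<in>verts Q. Poly_Mapping.single (v, []) 1)"
  by (simp_all add: path_algebra_def)

lemma keys_path_algebra_mult:
  assumes "wf_digraph Q" "Poly_Mapping.keys f \<subseteq> quiver_paths Q" "Poly_Mapping.keys g \<subseteq> quiver_paths Q"
    and "\<And>x y. x \<in> Poly_Mapping.keys f \<Longrightarrow> y \<in> Poly_Mapping.keys g \<Longrightarrow> snd x \<noteq> [] \<or> snd y \<noteq> []"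
  shows "path_algebra_mult Q f g \<in> positive_paths Q"
  unfolding path_algebra_mult_def positive_paths_def mem_Collect_eq
proof (intro keys_free_extend)
  fix x y assume x: "x \<in> Poly_Mapping.keys f" and y: "y \<in> Poly_Mapping.keys g"
  show "Poly_Mapping.keys (path_mult Q x y :: _ \<Rightarrow>\<^sub>0 'c) \<subseteq> {x \<in> quiver_paths Q. snd x \<noteq> []}"
  proof (cases "path_end Q x = fst y")
    case True
    have "(fst x, snd x @ snd y) \<in> quiver_paths Q"
      using x y assms(2,3) by (intro quiver_paths_path_mult[OF assms(1) _ _ True]) auto
    then show ?thesis using assms(4)[OF x y] True by (auto simp: path_mult_def)
  qed (simp add: path_mult_def)
qed

lemma ideal_positive_paths:
  fixes Q :: "('v, 'e) pre_digraph"
  assumes "fin_digraph Q"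
  shows "ideal (positive_paths Q :: (('v \<times> 'e list) \<Rightarrow>\<^sub>0 'k::field) set) (path_algebra Q)"
proof (rule idealI)
  interpret fin_digraph Q by fact
  let ?R = "path_algebra Q :: (('v \<times> 'e list) \<Rightarrow>\<^sub>0 'k) ring"
  let ?P = "positive_paths Q :: (('v \<times> 'e list) \<Rightarrow>\<^sub>0 'k) set"
  show "ring ?R" by (rule ring_path_algebra) fact
  interpret R: ring ?R by (rule ring_path_algebra) fact
  have sub: "free.subspace ?P" unfolding positive_paths_def by (rule subspace_keys)
  have car: "?P \<subseteq> carrier ?R" by (auto simp: positive_paths_def path_algebra_simps)
  show "subgroup ?P (add_monoid ?R)"
  proof (rule R.add.subgroupI)
    show "?P \<subseteq> carrier ?R" by (rule car)
    show "?P \<noteq> {}" using free.subspace_0[OF sub] by blast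
    show "a \<oplus>\<^bsub>?R\<^esub> b \<in> ?P" if "a \<in> ?P" "b \<in> ?P" for a b
      using free.subspace_add[OF sub that] by (simp add: path_algebra_simps)
    fix a assume a: "a \<in> ?P"
    have "\<ominus>\<^bsub>?R\<^esub> a = - a"
    proof (rule R.minus_equality)
      show "- a \<oplus>\<^bsub>?R\<^esub> a = \<zero>\<^bsub>?R\<^esub>" by (simp add: path_algebra_simps)
      show "a \<in> carrier ?R" using a car by blast
      show "- a \<in> carrier ?R" using free.subspace_neg[OF sub a] car by blast
    qed
    then show "\<ominus>\<^bsub>?R\<^esub> a \<in> ?P" using free.subspace_neg[OF sub a] by simp
  qed
  fix a x assume "a \<in> ?P" "x \<in> carrier ?R"
  then have k: "Poly_Mapping.keys a \<subseteq> quiver_paths Q" "\<And>y. y \<in> Poly_Mapping.keys a \<Longrightarrow> snd y \<noteq> []"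
    "Poly_Mapping.keys x \<subseteq> quiver_paths Q"
    by (auto simp: positive_paths_def path_algebra_simps)
  show "x \<otimes>\<^bsub>?R\<^esub> a \<in> ?P"
    unfolding path_algebra_simps using k(2) by (intro keys_path_algebra_mult[OF wf_digraph k(3,1)]) blast
  show "a \<otimes>\<^bsub>?R\<^esub> x \<in> ?P"
    unfolding path_algebra_simps using k(2) by (intro keys_path_algebra_mult[OF wf_digraph k(1,3)]) blast
qed

text \<open>Admissible relations lie in the arrow ideal, which contains no path of length zero. So the vertices
  stay linearly independent modulo the relations and modulo the span of all paths of positive length.\<close>

lemma admissible_ideal_subset_positive_paths:
  fixes I :: "(('v \<times> 'e list) \<Rightarrow>\<^sub>0 'k::field) set"
  assumes "fin_digraph Q" "admissible_ideal Q I"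
  shows "I \<subseteq> positive_paths Q"
proof -
  interpret fin_digraph Q by fact
  let ?R = "path_algebra Q :: (('v \<times> 'e list) \<Rightarrow>\<^sub>0 'k) ring"
  let ?J = "arrow_ideal Q :: (('v \<times> 'e list) \<Rightarrow>\<^sub>0 'k) set"
  interpret R: ring ?R by (rule ring_path_algebra) fact
  let ?S = "(\<lambda>e. Poly_Mapping.single (tail Q e, [e]) (1::'k)) ` arcs Q"
  have "(tail Q e, [e]) \<in> quiver_paths Q" if "e \<in> arcs Q" for e
    using that by (auto simp: quiver_paths_def awalk_def intro!: exI[of _ "head Q e"])
  then have S: "?S \<subseteq> positive_paths Q" "?S \<subseteq> carrier ?R" by (auto simp: positive_paths_def path_algebra_simps)
  have J: "ideal ?J ?R" unfolding arrow_ideal_def by (rule R.genideal_ideal[OF S(2)])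
  have "?J \<subseteq> positive_paths Q"
    unfolding arrow_ideal_def by (rule R.genideal_minimal[OF ideal_positive_paths[OF assms(1)] S(1)])
  moreover have "ideal (ideal_prod ?R ?J (carrier ?R)) ?R"
    by (rule R.ideal_prod_is_ideal[OF J R.oneideal])
  then have "ideal_power ?R ?J 2 \<subseteq> ?J"
    using R.ideal_prod_inter[OF J] by (simp add: numeral_2_eq_2)
  ultimately show ?thesis using assms(2) by (auto simp: admissible_ideal_def)
qed

text \<open>The radical \<open>r\<close> is the image of the span of the paths of positive length. The potential of a vertex is
  the number of vertices from which it can be reached, which strictly increases along every nontrivial
  path of an acyclic quiver.\<close>

lemma bound_quiver_split:
  fixes scl :: "'k::field_char_0 \<Rightarrow> 'a::{ring, monoid_mult} \<Rightarrow> 'a" and Q :: "('v, 'e) pre_digraph"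
  assumes ga: "graded_algebra scl G" and lfd: "graded_algebra.locally_finite_dimensional scl G"
    and Q: "finite_acyclic_quiver Q" and adm: "admissible_ideal Q I"
    and iso: "path_algebra_quotient_iso scl Q I (G 0) h"
    and vs: "distinct vs" "set vs = verts Q"
  shows "\<exists>r ht H. split_graded_algebra scl G (length vs) (\<lambda>i. vertex_idempotent Q I h (vs ! i)) r ht H"
proof -
  have fin: "fin_digraph Q" and acyclic: "\<not> (\<exists>p. pre_digraph.cycle Q p)"
    using Q by (simp_all add: finite_acyclic_quiver_def)
  interpret fin_digraph Q by fact
  interpret graded_algebra scl G by fact
  let ?R = "path_algebra Q :: (('v \<times> 'e list) \<Rightarrow>\<^sub>0 'k) ring"
  let ?P = "positive_paths Q :: (('v \<times> 'e list) \<Rightarrow>\<^sub>0 'k) set"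
  have I: "ideal I ?R" using adm by (simp add: admissible_ideal_def)
  interpret R: ring ?R by (rule ring_path_algebra) fact
  interpret I: ideal I ?R by fact
  have IP: "I \<subseteq> ?P" by (rule admissible_ideal_subset_positive_paths[OF fin adm])
  have h: "h \<in> Ring.ring_hom (?R Quot I) (subring_of (G 0))" "bij_betw h (carrier (?R Quot I)) (G 0)"
    using iso by (simp_all add: path_algebra_quotient_iso_def ring_iso_def subring_of_def)
  define q where "q f = h (I +>\<^bsub>?R\<^esub> f)" for f
  have "h \<circ> (+>\<^bsub>?R\<^esub>) I \<in> Ring.ring_hom ?R (subring_of (G 0))"
    by (rule Ring.ring_hom_trans[OF I.rcos_ring_hom h(1)])
  then have qhom: "q \<in> Ring.ring_hom ?R (subring_of (G 0))" by (simp add: q_def[abs_def] comp_def)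
  let ?C = "{f :: ('v \<times> 'e list) \<Rightarrow>\<^sub>0 'k. Poly_Mapping.keys f \<subseteq> quiver_paths Q}"
  have car: "carrier ?R = ?C" by (rule path_algebra_simps)
  have subC: "free.subspace ?C" by (rule subspace_keys)
  have q_mem: "q f \<in> G 0" if "f \<in> ?C" for f
    using Ring.ring_hom_closed[OF qhom] that by (simp add: car subring_of_def)
  have q_mult: "q (path_algebra_mult Q f g) = q f * q g" if "f \<in> ?C" "g \<in> ?C" for f g
    using Ring.ring_hom_mult[OF qhom, of f g] that by (simp add: car subring_of_def path_algebra_simps)
  have q_add: "q (f + g) = q f + q g" if "f \<in> ?C" "g \<in> ?C" for f g
    using Ring.ring_hom_add[OF qhom, of f g] that by (simp add: car subring_of_def path_algebra_simps)
  have q_one: "q (\<Sum>v\<in>verts Q. Poly_Mapping.single (v, []) 1) = 1"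
    using Ring.ring_hom_one[OF qhom] by (simp add: subring_of_def path_algebra_simps)
  have q_scale: "q (free_scale c f) = scl c (q f)" if "f \<in> ?C" for c f
    using iso that by (simp add: path_algebra_quotient_iso_def car q_def)
  have q_zero: "q 0 = 0" using q_add[of 0 0] by simp
  have q_sum: "q (\<Sum>i\<in>A. f i) = (\<Sum>i\<in>A. q (f i))" if "\<And>i. i \<in> A \<Longrightarrow> f i \<in> ?C" for f and A :: "'x set"
    using that
  proof (induction A rule: infinite_finite_induct)
    case (insert x A)
    then have "sum f A \<in> ?C" by (intro free.subspace_sum[OF subC]) simp
    then show ?case using insert by (simp add: q_add)
  qed (simp_all add: q_zero)
  have q_ker: "f \<in> ?P" if "f \<in> ?C" "q f = 0" for f
  proof -
    have "I +>\<^bsub>?R\<^esub> f \<in> carrier (?R Quot I)" "I +>\<^bsub>?R\<^esub> 0 \<in> carrier (?R Quot I)"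
      using Ring.ring_hom_closed[OF I.rcos_ring_hom] that(1) by (auto simp: car)
    moreover have "h (I +>\<^bsub>?R\<^esub> f) = h (I +>\<^bsub>?R\<^esub> 0)" using that(2) q_zero by (simp add: q_def)
    ultimately have "I +>\<^bsub>?R\<^esub> f = I +>\<^bsub>?R\<^esub> 0"
      using inj_onD[OF bij_betw_imp_inj_on[OF h(2)]] by blast
    then have "f \<in> I +>\<^bsub>?R\<^esub> 0" using I.a_rcos_self[of f] that(1) by (simp add: car)
    then have "f \<in> I" by (auto simp: a_r_coset_def' path_algebra_simps)
    then show ?thesis using IP by blast
  qed
  have q_surj: "\<exists>f\<in>?C. q f = x" if x: "x \<in> G 0" for x
  proof -
    have "x \<in> h ` carrier (?R Quot I)" using bij_betw_imp_surj_on[OF h(2)] x by simp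
    then obtain X where X: "X \<in> carrier (?R Quot I)" "h X = x" by blast
    then obtain f where "f \<in> carrier ?R" "X = I +>\<^bsub>?R\<^esub> f"
      by (auto simp: FactRing_def A_RCOSETS_def')
    then show ?thesis using X(2) by (auto simp: q_def car)
  qed
  let ?s = "\<lambda>v. Poly_Mapping.single (v, [] :: 'e list) (1::'k)"
  have vert: "(v, []) \<in> quiver_paths Q" if "v \<in> verts Q" for v
    using that by (auto simp: quiver_paths_def awalk_def intro!: exI[of _ v])
  let ?n = "length vs"
  define e where "e i = q (?s (vs ! i))" for i
  have e_eq: "e = (\<lambda>i. vertex_idempotent Q I h (vs ! i))"
    by (simp add: e_def vertex_idempotent_def q_def fun_eq_iff)
  have vsi: "vs ! i \<in> verts Q" if "i < ?n" for i using vs(2) that nth_mem by blast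
  have sC: "?s (vs ! i) \<in> ?C" if "i < ?n" for i using vert[OF vsi[OF that]] by simp
  have inj: "vs ! i = vs ! j \<longleftrightarrow> i = j" if "i < ?n" "j < ?n" for i j
    using vs(1) that by (simp add: nth_eq_iff_index_eq)
  have sumv: "(\<Sum>v\<in>verts Q. g v) = (\<Sum>i<?n. g (vs ! i))" for g :: "'v \<Rightarrow> 'z::comm_monoid_add"
  proof (rule sum.reindex_bij_betw[symmetric])
    show "bij_betw ((!) vs) {..<?n} (verts Q)" using bij_betw_nth[OF vs(1) refl] vs(2) by simp
  qed
  define r where "r = q ` ?P"
  have PC: "?P \<subseteq> ?C" by (auto simp: positive_paths_def)
  have subP: "free.subspace ?P" unfolding positive_paths_def by (rule subspace_keys)
  have idP: "path_algebra_mult Q f g \<in> ?P" "path_algebra_mult Q g f \<in> ?P" if "f \<in> ?P" "g \<in> ?C" for f g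
    using ideal.I_r_closed[OF ideal_positive_paths[OF fin] that(1)] ideal.I_l_closed[OF ideal_positive_paths[OF fin] that(1)] that(2)
    by (simp_all add: path_algebra_simps)
  define reach where "reach v = {u \<in> verts Q. \<exists>p. awalk u p v}" for v
  define ht where "ht i = card (reach (vs ! i))" for i
  have fin_reach: "finite (reach v)" for v using finite_verts by (simp add: reach_def)
  have reach_less: "card (reach a) < card (reach b)" if p: "awalk a p b" "p \<noteq> []" for a b p
  proof (rule psubset_card_mono[OF fin_reach])
    have "reach a \<subseteq> reach b"
    proof
      fix u assume "u \<in> reach a"
      then obtain p' where u: "u \<in> verts Q" "awalk u p' a" unfolding reach_def by blast
      from awalk_appendI[OF u(2) p(1)] show "u \<in> reach b" using u(1) unfolding reach_def by blast
    qed
    moreover have "b \<in> reach b"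
    proof -
      have "b \<in> verts Q" using p(1) by (rule awalk_last_in_verts)
      then have "awalk b [] b" by (simp add: awalk_Nil_iff)
      then show ?thesis using \<open>b \<in> verts Q\<close> unfolding reach_def by blast
    qed
    moreover have "b \<notin> reach a"
    proof
      assume "b \<in> reach a"
      then obtain p' where "awalk b p' a" unfolding reach_def by blast
      from awalk_appendI[OF p(1) this] have "closed_w (p @ p')"
        unfolding closed_w_def using p(2) by (intro exI[of _ a]) simp
      then show False using closed_w_imp_cycle acyclic by blast
    qed
    ultimately show "reach a \<subset> reach b" by blast
  qed
  have "split_graded_algebra scl G ?n e r ht (card (verts Q))"
  proof unfold_locales
    fix i j assume ij: "i < ?n" "j < ?n"
    show "e i * e j = (if i = j then e i else 0)"
      unfolding e_def q_mult[OF sC[OF ij(1)] sC[OF ij(2)], symmetric] path_algebra_mult_single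
      using ij by (simp add: path_mult_def path_end_def inj q_zero)
  next
    show "e i \<in> G 0" if "i < ?n" for i unfolding e_def using sC[OF that] by (rule q_mem)
    have "(\<Sum>i<?n. e i) = q (\<Sum>i<?n. ?s (vs ! i))" unfolding e_def by (rule q_sum[symmetric]) (use sC in auto)
    then show "(\<Sum>i<?n. e i) = 1" using q_one sumv[of ?s] by simp
    show "subspace r" unfolding r_def subspace_def
    proof (intro conjI ballI allI)
      show "0 \<in> q ` ?P" using imageI[OF free.subspace_0[OF subP], of q] q_zero by simp
      fix x assume "x \<in> q ` ?P"
      then obtain f where f: "f \<in> ?P" "x = q f" by blast
      have fC: "f \<in> ?C" using f(1) PC by blast
      show "scl c x \<in> q ` ?P" for c
        unfolding f(2) q_scale[OF fC, symmetric] using free.subspace_scale[OF subP f(1)] by (rule imageI)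
      fix y assume "y \<in> q ` ?P"
      then obtain g where g: "g \<in> ?P" "y = q g" by blast
      have gC: "g \<in> ?C" using g(1) PC by blast
      show "x + y \<in> q ` ?P"
        unfolding f(2) g(2) q_add[OF fC gC, symmetric] using free.subspace_add[OF subP f(1) g(1)] by (rule imageI)
    qed
    show "r \<subseteq> G 0" unfolding r_def using q_mem PC by blast
    show "x * y \<in> r" if xy: "x \<in> r" "y \<in> r" for x y
    proof -
      obtain f g where f: "f \<in> ?P" "x = q f" and g: "g \<in> ?P" "y = q g" using xy by (auto simp: r_def)
      have "f \<in> ?C" "g \<in> ?C" using f(1) g(1) PC by blast+
      then have "x * y = q (path_algebra_mult Q f g)" using q_mult[of f g] f(2) g(2) by simp
      then show ?thesis using idP(1)[OF f(1) \<open>g \<in> ?C\<close>] by (simp add: r_def)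
    qed
    show "e i * x \<in> r" "x * e i \<in> r" if ix: "i < ?n" "x \<in> r" for i x
    proof -
      obtain f where f: "f \<in> ?P" "x = q f" using ix(2) by (auto simp: r_def)
      then have "f \<in> ?C" using PC by blast
      then have "e i * x = q (path_algebra_mult Q (?s (vs ! i)) f)" "x * e i = q (path_algebra_mult Q f (?s (vs ! i)))"
        using sC[OF ix(1)] by (simp_all only: e_def f(2) q_mult)
      then show "e i * x \<in> r" "x * e i \<in> r" using idP[OF f(1) sC[OF ix(1)]] by (simp_all add: r_def)
    qed
    show "ht i \<le> card (verts Q)" for i
      unfolding ht_def by (rule card_mono) (auto simp: reach_def)
    show "\<exists>B. finite B \<and> span B = G k" for k using lfd by (simp add: locally_finite_dimensional_def)
    show "\<exists>c. x - (\<Sum>i<?n. scl (c i) (e i)) \<in> r" if x: "x \<in> G 0" for x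
    proof -
      obtain f where f: "f \<in> ?C" "q f = x" using q_surj[OF x] by blast
      let ?c = "\<lambda>i. Poly_Mapping.lookup f (vs ! i, [])"
      let ?d = "\<Sum>v\<in>verts Q. free_scale (Poly_Mapping.lookup f (v, [])) (?s v)"
      have dC: "?d \<in> ?C" using vert by (intro free.subspace_sum[OF subC] free.subspace_scale[OF subC]) auto
      have "(\<Sum>i<?n. scl (?c i) (e i)) = q ?d"
        unfolding sumv e_def using sC by (subst q_sum) (simp_all add: q_scale free.subspace_scale[OF subC, simplified])
      moreover have "f - ?d \<in> ?P"
      proof -
        have "f - ?d \<in> ?C" using f(1) dC by (rule free.subspace_diff[OF subC])
        moreover have "Poly_Mapping.lookup (f - ?d) (v, []) = 0" if "v \<in> verts Q" for v
        proof -
          have "Poly_Mapping.lookup ?d (v, []) = (\<Sum>u\<in>verts Q. if u = v then Poly_Mapping.lookup f (v, []) else 0)"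
            unfolding lookup_sum by (intro sum.cong) (auto simp: lookup_single when_def)
          then show ?thesis using that finite_verts by (simp add: lookup_minus)
        qed
        moreover have "fst y \<in> verts Q" if "y \<in> quiver_paths Q" for y
          using that by (auto simp: quiver_paths_def awalk_def)
        moreover have "Poly_Mapping.keys (f - ?d) \<subseteq> {x \<in> quiver_paths Q. snd x \<noteq> []}"
          if *: "Poly_Mapping.keys (f - ?d) \<subseteq> quiver_paths Q"
            "\<And>v. v \<in> verts Q \<Longrightarrow> Poly_Mapping.lookup (f - ?d) (v, []) = 0"
            "\<And>y. y \<in> quiver_paths Q \<Longrightarrow> fst y \<in> verts Q"
        proof
          fix y assume y: "y \<in> Poly_Mapping.keys (f - ?d)"
          then have yQ: "y \<in> quiver_paths Q" using *(1) by blast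
          have "snd y \<noteq> []"
          proof
            assume "snd y = []"
            then obtain v where v: "y = (v, [])" by (cases y) auto
            then have "v \<in> verts Q" using *(3)[OF yQ] by simp
            then have "Poly_Mapping.lookup (f - ?d) y = 0" unfolding v by (rule *(2))
            then show False using y unfolding in_keys_iff by contradiction
          qed
          then show "y \<in> {x \<in> quiver_paths Q. snd x \<noteq> []}" using yQ by simp
        qed
        ultimately show ?thesis unfolding positive_paths_def by blast
      qed
      moreover have "q f = q (f - ?d) + q ?d"
        using q_add[OF free.subspace_diff[OF subC f(1) dC] dC] by simp
      ultimately have "x - (\<Sum>i<?n. scl (?c i) (e i)) = q (f - ?d)" "f - ?d \<in> ?P" using f(2) by simp_all
      then have "x - (\<Sum>i<?n. scl (?c i) (e i)) \<in> r" unfolding r_def by (rule image_eqI)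
      then show ?thesis by (rule exI[of _ ?c])
    qed
    show "c i = 0" if c: "(\<Sum>i<?n. scl (c i) (e i)) \<in> r" and i: "i < ?n" for c i
    proof -
      obtain g where g: "g \<in> ?P" "(\<Sum>i<?n. scl (c i) (e i)) = q g" using c by (auto simp: r_def)
      let ?d = "\<Sum>i<?n. free_scale (c i) (?s (vs ! i))"
      have summand: "free_scale (c i) (?s (vs ! i)) \<in> ?C" if "i < ?n" for i
        using sC[OF that] by (rule free.subspace_scale[OF subC])
      have dC: "?d \<in> ?C" using summand by (intro free.subspace_sum[OF subC]) auto
      have qd: "q ?d = q g"
      proof -
        have "q ?d = (\<Sum>i<?n. q (free_scale (c i) (?s (vs ! i))))" using summand by (intro q_sum) auto
        also have "\<dots> = (\<Sum>i<?n. scl (c i) (e i))"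
          unfolding e_def using sC by (intro sum.cong refl q_scale) auto
        finally show ?thesis using g(2) by simp
      qed
      have gC: "g \<in> ?C" using g(1) PC by blast
      have dgC: "?d - g \<in> ?C" using dC gC by (rule free.subspace_diff[OF subC])
      have "q (?d - g) + q g = q ?d" using q_add[OF dgC gC] by simp
      then have "?d - g \<in> ?P" using qd by (intro q_ker[OF dgC]) simp
      then have "(?d - g) + g \<in> ?P" using g(1) by (rule free.subspace_add[OF subP])
      then have "(vs ! i, []) \<notin> Poly_Mapping.keys ?d" by (auto simp: positive_paths_def)
      moreover have "Poly_Mapping.lookup ?d (vs ! i, []) = (\<Sum>j<?n. if j = i then c i else 0)"
        unfolding lookup_sum using i by (intro sum.cong) (auto simp: lookup_single when_def inj)
      ultimately show ?thesis using i by (simp add: in_keys_iff)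
    qed
    show "ht i < ht j" if ij: "i < ?n" "j < ?n" and x: "x \<in> r" and nz: "e i * x * e j \<noteq> 0" for i j x
    proof -
      obtain f where f: "f \<in> ?P" "x = q f" using x by (auto simp: r_def)
      let ?t = "\<lambda>y. Poly_Mapping.single y (1::'k)"
      have keys: "y \<in> quiver_paths Q" "snd y \<noteq> []" if "y \<in> Poly_Mapping.keys f" for y
        using f(1) that by (auto simp: positive_paths_def)
      have tC: "?t y \<in> ?C" if "y \<in> Poly_Mapping.keys f" for y using keys[OF that] by simp
      have stC: "free_scale (Poly_Mapping.lookup f y) (?t y) \<in> ?C" if "y \<in> Poly_Mapping.keys f" for y
        using tC[OF that] by (rule free.subspace_scale[OF subC])
      have "x = (\<Sum>y\<in>Poly_Mapping.keys f. q (free_scale (Poly_Mapping.lookup f y) (?t y)))"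
        unfolding f(2) using arg_cong[OF sum_single_keys[of f], of q] stC by (subst (asm) q_sum) auto
      also have "\<dots> = (\<Sum>y\<in>Poly_Mapping.keys f. scl (Poly_Mapping.lookup f y) (q (?t y)))"
        using tC by (intro sum.cong refl q_scale)
      finally have "e i * x * e j = (\<Sum>y\<in>Poly_Mapping.keys f. scl (Poly_Mapping.lookup f y) (e i * q (?t y) * e j))"
        by (simp add: sum_distrib_left sum_distrib_right scale_mult_left scale_mult_right)
      then have "(\<Sum>y\<in>Poly_Mapping.keys f. scl (Poly_Mapping.lookup f y) (e i * q (?t y) * e j)) \<noteq> 0"
        using nz by simp
      then obtain y where y: "y \<in> Poly_Mapping.keys f" "e i * q (?t y) * e j \<noteq> 0"
        by (rule sum.not_neutral_contains_not_neutral) auto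
      have "e i * q (?t y) \<noteq> 0" using y(2) by auto
      moreover have "q (?t y) * e j \<noteq> 0" using y(2) by (auto simp: mult.assoc)
      ultimately have "q (path_mult Q (vs ! i, []) y) \<noteq> 0" "q (path_mult Q y (vs ! j, [])) \<noteq> 0"
        using q_mult[OF sC[OF ij(1)] tC[OF y(1)]] q_mult[OF tC[OF y(1)] sC[OF ij(2)]]
        by (simp_all add: e_def path_algebra_mult_single)
      then have "fst y = vs ! i" "path_end Q y = vs ! j"
        using q_zero by (auto simp: path_mult_def path_end_def split: if_splits)
      moreover obtain w where "awalk (fst y) (snd y) w" using keys(1)[OF y(1)] by (auto simp: quiver_paths_def)
      ultimately have "awalk (vs ! i) (snd y) (vs ! j)" using awalk_end[OF wf_digraph, of "fst y" "snd y" w] by (cases y) simp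
      then show ?thesis unfolding ht_def using keys(2)[OF y(1)] by (rule reach_less)
    qed
  qed
  then show ?thesis unfolding e_eq by blast
qed

section \<open>The determinant formula\<close>

theorem theorem1p2:
  fixes scl :: "'k::field_char_0 \<Rightarrow> 'a::{ring, monoid_mult} \<Rightarrow> 'a"
    and G :: "nat \<Rightarrow> 'a set"
    and Q :: "('v, 'e) pre_digraph"
    and I :: "(('v \<times> 'e list) \<Rightarrow>\<^sub>0 'k) set"
    and h :: "(('v \<times> 'e list) \<Rightarrow>\<^sub>0 'k) set \<Rightarrow> 'a"
    and vs :: "'v list"
    and C :: "rat fps mat"
    and a :: "nat \<Rightarrow> int"
  assumes "graded_algebra scl G"
    and "graded_algebra.locally_finite_dimensional scl G"
    and "finite_acyclic_quiver Q"
    and "admissible_ideal Q I"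
    and "path_algebra_quotient_iso scl Q I (G 0) h"
    and "distinct vs" and "set vs = verts Q"
  defines "C \<equiv> cartan_matrix scl G (map (vertex_idempotent Q I h) vs)"
    and "a \<equiv> fps_nth (graded_euler_char (reduced_HC_dim scl G))"
  shows "(\<forall>j k. reduced_HC_fin_dim scl G j k) \<and>
         (\<forall>k. finite {j. reduced_HC_dim scl G j k \<noteq> 0}) \<and>
         a 0 = 0 \<and>
         convergent_prod (\<lambda>k. (1 - fps_X ^ Suc k :: rat fps) powi (- a (Suc k))) \<and>
         convergent_prod (\<lambda>s. Determinant.det (subst_power C (Suc s))) \<and>
         prodinf (\<lambda>k. (1 - fps_X ^ Suc k :: rat fps) powi (- a (Suc k))) =
           prodinf (\<lambda>s. Determinant.det (subst_power C (Suc s)))"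
proof -
  obtain r ht H where "split_graded_algebra scl G (length vs) (\<lambda>i. vertex_idempotent Q I h (vs ! i)) r ht H"
    using bound_quiver_split[OF assms(1-7)] by (elim exE)
  then interpret A: split_graded_algebra scl G "length vs" "\<lambda>i. vertex_idempotent Q I h (vs ! i)" r ht H .
  interpret B: graded_arrow_basis scl "length vs" "\<lambda>i. vertex_idempotent Q I h (vs ! i)"
    A.arrow_set A.arrow_src A.arrow_tgt A.arrow_deg ht H G
    by (rule A.graded_arrow_basis_arrow_set)
  have C: "C = B.unit_mat"
  proof (rule eq_matI)
    fix i j assume "i < dim_row B.unit_mat" "j < dim_col B.unit_mat"
    then have ij: "i < length vs" "j < length vs" by (simp_all add: B.unit_mat_def)
    show "C $$ (i, j) = B.unit_mat $$ (i, j)"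
      unfolding C_def cartan_matrix_def B.unit_mat_def using ij A.dim_corner[OF ij]
      by (auto simp: fps_eq_iff B.arrow_series_def B.arrows_def)
  qed (simp_all add: C_def cartan_matrix_def B.unit_mat_def)
  have subst: "Determinant.det (subst_power C (Suc s)) = Determinant.det B.unit_mat oo fps_X ^ Suc s" for s
  proof -
    have z: "fps_nth (fps_X ^ Suc s) 0 = (0 :: rat)" by simp
    interpret comp: comm_ring_hom "\<lambda>f. fps_compose f (fps_X ^ Suc s) :: rat fps"
      by unfold_locales (simp_all add: fps_compose_add_distrib fps_compose_mult_distrib[OF z] del: power_Suc)
    show ?thesis unfolding subst_power_def C by (rule comp.hom_det)
  qed
  have fin: "reduced_HC_fin_dim scl G j k" for j k
    using B.reduced_HC_degree_zero(1) B.reduced_HC_dim_eq(1) by (cases "k = 0") auto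
  have a0: "a 0 = 0"
    by (simp add: a_def graded_euler_char_def B.reduced_HC_degree_zero)
  note product = product_formula[OF B.det_arrow_series_nth_0 B.is_log_deriv_det,
      of a, unfolded a_def, OF B.euler_char_log_coeff]
  show ?thesis
    unfolding subst using fin B.finite_reduced_HC a0 product unfolding a_def by blast
qed

end
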